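(* Let $\mathcal{T}$ be a triangulated category, let $\mathcal{P}=\operatorname{add}\mathcal{P}$ be a presilting subcategory of $\mathcal{T}$ satisfying conditions (P1) and (P2) (stated in the context), and let $\rho:\mathcal{T}\to\mathcal{U}:=\mathcal{T}/\operatorname{thick}\mathcal{P}$ be the canonical projection functor to the triangle quotient. Then $\rho$ induces (via $\mathcal{M}\mapsto\rho(\mathcal{M})$) bijections $$\operatorname{silt}_{\mathcal{P}}\mathcal{T}\to\operatorname{silt}\mathcal{U}\quad\text{and}\quad \operatorname{presilt}_{\mathcal{P}}\mathcal{T}\to\operatorname{presilt}\mathcal{U}.$$
   Context: All subcategories are full. $[1]$ is the shift functor. $\operatorname{add}\mathcal{S}$ is the smallest full subcategory containing $\mathcal{S}$ and closed under isomorphisms, finite direct sums and direct summands; $\operatorname{thick}\mathcal{S}$ is the smallest triangulated subcategory containing $\mathcal{S}$ and closed under direct summands. A subcategory $\mathcal{M}$ of a triangulated category $\mathcal{T}$ is presilting if $\operatorname{Hom}_{\mathcal{T}}(\mathcal{M},\mathcal{M}[i])=0$ for all $i>0$, and silting if in addition $\mathcal{T}=\operatorname{thick}\mathcal{M}$. $\operatorname{silt}\mathcal{T}$ (resp. $\operatorname{presilt}\mathcal{T}$) is the class of silting (resp. presilting) subcategories of $\mathcal{T}$, where $\mathcal{M}$ and $\mathcal{N}$ are identified when $\operatorname{add}\mathcal{M}=\operatorname{add}\mathcal{N}$. $\operatorname{silt}_{\mathcal{P}}\mathcal{T}$ (resp. $\operatorname{presilt}_{\mathcal{P}}\mathcal{T}$)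 is the class of those silting (resp. presilting) subcategories containing $\mathcal{P}$. ${}^{\perp}\mathcal{P}[>0]=\{X\in\mathcal{T}\mid\operatorname{Hom}_{\mathcal{T}}(X,\mathcal{P}[i])=0\ \forall i>0\}$ and $\mathcal{P}[<0]^{\perp}=\{X\in\mathcal{T}\mid\operatorname{Hom}_{\mathcal{T}}(\mathcal{P}[i],X)=0\ \forall i<0\}$. $\mathcal{S}$ is contravariantly finite in a category if every object $X$ of it has a right $\mathcal{S}$-approximation, i.e. a morphism $f:S\to X$ with $S\in\mathcal{S}$ such that $\operatorname{Hom}(S',f)$ is surjective for all $S'\in\mathcal{S}$; covariantly finite is defined dually via left approximations. (P1) $\mathcal{P}$ is covariantly finite in ${}^{\perp}\mathcal{P}[>0]$ and contravariantly finite in $\mathcal{P}[<0]^{\perp}$. (P2) For any $X\in\mathcal{T}$, $\operatorname{Hom}_{\mathcal{T}}(X,\mathcal{P}[\ell])=0=\operatorname{Hom}_{\mathcal{T}}(\mathcal{P},X[\ell])$ for all $\ell\gg0$. *)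

theory Defs
  imports "HOL-Algebra.Group"
begin

section \<open>Triangulated categories\<close>

text \<open>
  Categories are given by a set of objects and a family of morphism sets, so that full
  subcategories are simply sets of objects. The morphism sets are required to be pairwise
  disjoint (a morphism determines its source and target), which is why composition and addition
  take morphisms only. \<open>g \<cdot> f\<close> is \<open>f\<close> followed by \<open>g\<close>.
\<close>

record ('o, 'm) preadditive =
  Obj :: "'o set"
  Hom :: "'o \<Rightarrow> 'o \<Rightarrow> 'm set"
  Ident :: "'o \<Rightarrow> 'm"
  Comp :: "'m \<Rightarrow> 'm \<Rightarrow> 'm" (infixl "\<cdot>\<index>" 70)
  Zero :: "'o \<Rightarrow> 'o \<Rightarrow> 'm"
  Plus :: "'m \<Rightarrow> 'm \<Rightarrow> 'm" (infixl "\<boxplus>\<index>" 65)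

record ('o, 'm) shifted = "('o, 'm) preadditive" +
  ShO :: "'o \<Rightarrow> 'o"
  ShM :: "'m \<Rightarrow> 'm"

record ('o, 'm) triangulated = "('o, 'm) shifted" +
  Tri :: "('m \<times> 'm \<times> 'm) set"

definition hom_group :: "('o, 'm, 'z) preadditive_scheme \<Rightarrow> 'o \<Rightarrow> 'o \<Rightarrow> 'm monoid" where
  "hom_group C X Y = \<lparr>carrier = Hom C X Y, mult = Plus C, one = Zero C X Y\<rparr>"

definition Neg :: "('o, 'm, 'z) preadditive_scheme \<Rightarrow> 'o \<Rightarrow> 'o \<Rightarrow> 'm \<Rightarrow> 'm" where
  "Neg C X Y f = inv\<^bsub>hom_group C X Y\<^esub> f"

definition hom_zero :: "('o, 'm, 'z) preadditive_scheme \<Rightarrow> 'o \<Rightarrow> 'o \<Rightarrow> bool" where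
  "hom_zero C X Y \<longleftrightarrow> Hom C X Y = {Zero C X Y}"

definition zero_object :: "('o, 'm, 'z) preadditive_scheme \<Rightarrow> 'o \<Rightarrow> bool" where
  "zero_object C Z \<longleftrightarrow> Z \<in> Obj C \<and> (\<forall>X\<in>Obj C. hom_zero C Z X \<and> hom_zero C X Z)"

definition is_iso :: "('o, 'm, 'z) preadditive_scheme \<Rightarrow> 'o \<Rightarrow> 'o \<Rightarrow> 'm \<Rightarrow> bool" where
  "is_iso C X Y f \<longleftrightarrow> f \<in> Hom C X Y \<and>
     (\<exists>g\<in>Hom C Y X. g \<cdot>\<^bsub>C\<^esub> f = Ident C X \<and> f \<cdot>\<^bsub>C\<^esub> g = Ident C Y)"

definition isomorphic :: "('o, 'm, 'z) preadditive_scheme \<Rightarrow> 'o \<Rightarrow> 'o \<Rightarrow> bool" where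
  "isomorphic C X Y \<longleftrightarrow> X \<in> Obj C \<and> Y \<in> Obj C \<and> (\<exists>f. is_iso C X Y f)"

definition direct_sum :: "('o, 'm, 'z) preadditive_scheme \<Rightarrow> 'o \<Rightarrow> 'o \<Rightarrow> 'o \<Rightarrow> bool" where
  "direct_sum C X Y S \<longleftrightarrow> X \<in> Obj C \<and> Y \<in> Obj C \<and> S \<in> Obj C \<and>
     (\<exists>i\<in>Hom C X S. \<exists>j\<in>Hom C Y S. \<exists>p\<in>Hom C S X. \<exists>q\<in>Hom C S Y.
        p \<cdot>\<^bsub>C\<^esub> i = Ident C X \<and> q \<cdot>\<^bsub>C\<^esub> j = Ident C Y \<and>
        q \<cdot>\<^bsub>C\<^esub> i = Zero C X Y \<and> p \<cdot>\<^bsub>C\<^esub> j = Zero C Y X \<and>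
        (i \<cdot>\<^bsub>C\<^esub> p) \<boxplus>\<^bsub>C\<^esub> (j \<cdot>\<^bsub>C\<^esub> q) = Ident C S)"

definition candidate_triangle ::
  "('o, 'm, 'z) shifted_scheme \<Rightarrow> 'o \<Rightarrow> 'o \<Rightarrow> 'o \<Rightarrow> 'm \<Rightarrow> 'm \<Rightarrow> 'm \<Rightarrow> bool" where
  "candidate_triangle C X Y Z f g h \<longleftrightarrow> X \<in> Obj C \<and> Y \<in> Obj C \<and> Z \<in> Obj C \<and>
     f \<in> Hom C X Y \<and> g \<in> Hom C Y Z \<and> h \<in> Hom C Z (ShO C X)"

definition triangle ::
  "('o, 'm, 'z) triangulated_scheme \<Rightarrow> 'o \<Rightarrow> 'o \<Rightarrow> 'o \<Rightarrow> 'm \<Rightarrow> 'm \<Rightarrow> 'm \<Rightarrow> bool" where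
  "triangle C X Y Z f g h \<longleftrightarrow> candidate_triangle C X Y Z f g h \<and> (f, g, h) \<in> Tri C"

definition triangle_isomorphic ::
  "('o, 'm, 'z) shifted_scheme \<Rightarrow>
     'o \<Rightarrow> 'o \<Rightarrow> 'o \<Rightarrow> 'm \<Rightarrow> 'm \<Rightarrow> 'm \<Rightarrow> 'o \<Rightarrow> 'o \<Rightarrow> 'o \<Rightarrow> 'm \<Rightarrow> 'm \<Rightarrow> 'm \<Rightarrow> bool" where
  "triangle_isomorphic C X Y Z f g h X' Y' Z' f' g' h' \<longleftrightarrow>
     candidate_triangle C X Y Z f g h \<and> candidate_triangle C X' Y' Z' f' g' h' \<and>
     (\<exists>a b c. is_iso C X X' a \<and> is_iso C Y Y' b \<and> is_iso C Z Z' c \<and>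
        b \<cdot>\<^bsub>C\<^esub> f = f' \<cdot>\<^bsub>C\<^esub> a \<and> c \<cdot>\<^bsub>C\<^esub> g = g' \<cdot>\<^bsub>C\<^esub> b \<and>
        ShM C a \<cdot>\<^bsub>C\<^esub> h = h' \<cdot>\<^bsub>C\<^esub> c)"

locale preadditive_category =
  fixes C (structure)
  assumes Hom_disjoint: "\<lbrakk>X \<in> Obj C; Y \<in> Obj C; X' \<in> Obj C; Y' \<in> Obj C;
      f \<in> Hom C X Y; f \<in> Hom C X' Y'\<rbrakk> \<Longrightarrow> X = X' \<and> Y = Y'"
    and Ident_in_Hom: "X \<in> Obj C \<Longrightarrow> Ident C X \<in> Hom C X X"
    and Comp_in_Hom: "\<lbrakk>X \<in> Obj C; Y \<in> Obj C; Z \<in> Obj C; f \<in> Hom C X Y; g \<in> Hom C Y Z\<rbrakk>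
      \<Longrightarrow> g \<cdot> f \<in> Hom C X Z"
    and Comp_Ident: "\<lbrakk>X \<in> Obj C; Y \<in> Obj C; f \<in> Hom C X Y\<rbrakk> \<Longrightarrow> f \<cdot> Ident C X = f"
    and Ident_Comp: "\<lbrakk>X \<in> Obj C; Y \<in> Obj C; f \<in> Hom C X Y\<rbrakk> \<Longrightarrow> Ident C Y \<cdot> f = f"
    and Comp_assoc: "\<lbrakk>W \<in> Obj C; X \<in> Obj C; Y \<in> Obj C; Z \<in> Obj C;
      f \<in> Hom C W X; g \<in> Hom C X Y; h \<in> Hom C Y Z\<rbrakk> \<Longrightarrow> h \<cdot> (g \<cdot> f) = (h \<cdot> g) \<cdot> f"
    and hom_comm_group: "\<lbrakk>X \<in> Obj C; Y \<in> Obj C\<rbrakk> \<Longrightarrow> comm_group (hom_group C X Y)"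
    and Comp_Plus: "\<lbrakk>X \<in> Obj C; Y \<in> Obj C; Z \<in> Obj C;
      f \<in> Hom C X Y; f' \<in> Hom C X Y; g \<in> Hom C Y Z\<rbrakk>
      \<Longrightarrow> g \<cdot> (f \<boxplus> f') = (g \<cdot> f) \<boxplus> (g \<cdot> f')"
    and Plus_Comp: "\<lbrakk>X \<in> Obj C; Y \<in> Obj C; Z \<in> Obj C;
      f \<in> Hom C X Y; g \<in> Hom C Y Z; g' \<in> Hom C Y Z\<rbrakk>
      \<Longrightarrow> (g \<boxplus> g') \<cdot> f = (g \<cdot> f) \<boxplus> (g' \<cdot> f)"

locale additive_category = preadditive_category +
  assumes zero_object_exists: "\<exists>Z. zero_object C Z"
    and direct_sum_exists: "\<lbrakk>X \<in> Obj C; Y \<in> Obj C\<rbrakk> \<Longrightarrow> \<exists>S. direct_sum C X Y S"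

text \<open>The shift is an automorphism (not merely an autoequivalence) of the category.\<close>

locale shifted_category = additive_category +
  assumes ShO_bij: "bij_betw (ShO C) (Obj C) (Obj C)"
    and ShM_bij: "\<lbrakk>X \<in> Obj C; Y \<in> Obj C\<rbrakk>
      \<Longrightarrow> bij_betw (ShM C) (Hom C X Y) (Hom C (ShO C X) (ShO C Y))"
    and ShM_Ident: "X \<in> Obj C \<Longrightarrow> ShM C (Ident C X) = Ident C (ShO C X)"
    and ShM_Comp: "\<lbrakk>X \<in> Obj C; Y \<in> Obj C; Z \<in> Obj C; f \<in> Hom C X Y; g \<in> Hom C Y Z\<rbrakk>
      \<Longrightarrow> ShM C (g \<cdot> f) = ShM C g \<cdot> ShM C f"
    and ShM_Plus: "\<lbrakk>X \<in> Obj C; Y \<in> Obj C; f \<in> Hom C X Y; f' \<in> Hom C X Y\<rbrakk>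
      \<Longrightarrow> ShM C (f \<boxplus> f') = ShM C f \<boxplus> ShM C f'"

locale triangulated_category = shifted_category +
  assumes Tri_typed: "(f, g, h) \<in> Tri C \<Longrightarrow> \<exists>X Y Z. triangle C X Y Z f g h"
    and TR1_iso: "\<lbrakk>triangle C X Y Z f g h;
      triangle_isomorphic C X Y Z f g h X' Y' Z' f' g' h'\<rbrakk> \<Longrightarrow> triangle C X' Y' Z' f' g' h'"
    and TR1_Ident: "\<lbrakk>X \<in> Obj C; zero_object C Z\<rbrakk>
      \<Longrightarrow> triangle C X X Z (Ident C X) (Zero C X Z) (Zero C Z (ShO C X))"
    and TR1_cone: "\<lbrakk>X \<in> Obj C; Y \<in> Obj C; f \<in> Hom C X Y\<rbrakk>
      \<Longrightarrow> \<exists>Z g h. triangle C X Y Z f g h"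
    and TR2_rotate: "candidate_triangle C X Y Z f g h \<Longrightarrow>
      triangle C X Y Z f g h \<longleftrightarrow>
      triangle C Y Z (ShO C X) g h (Neg C (ShO C X) (ShO C Y) (ShM C f))"
    and TR3_complete: "\<lbrakk>triangle C X Y Z f g h; triangle C X' Y' Z' f' g' h';
      a \<in> Hom C X X'; b \<in> Hom C Y Y'; b \<cdot> f = f' \<cdot> a\<rbrakk>
      \<Longrightarrow> \<exists>c\<in>Hom C Z Z'. c \<cdot> g = g' \<cdot> b \<and> ShM C a \<cdot> h = h' \<cdot> c"
    and TR4_octahedral: "\<lbrakk>triangle C X Y A f f1 f2; triangle C Y Z B g g1 g2;
      triangle C X Z D (g \<cdot> f) h1 h2\<rbrakk>
      \<Longrightarrow> \<exists>a b. triangle C A D B a b (ShM C f1 \<cdot> g2) \<and>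
            a \<cdot> f1 = h1 \<cdot> g \<and> h2 \<cdot> a = f2 \<and> b \<cdot> h1 = g1 \<and> g2 \<cdot> b = ShM C f \<cdot> h2"

definition shift :: "('o, 'm, 'z) shifted_scheme \<Rightarrow> int \<Rightarrow> 'o \<Rightarrow> 'o" where
  "shift C n X =
     (if 0 \<le> n then (ShO C ^^ nat n) X else (inv_into (Obj C) (ShO C) ^^ nat (- n)) X)"

section \<open>Silting subcategories\<close>

definition closed_under_summands ::
  "('o, 'm, 'z) preadditive_scheme \<Rightarrow> 'o set \<Rightarrow> bool" where
  "closed_under_summands C D \<longleftrightarrow> (\<forall>X Y S. direct_sum C X Y S \<and> S \<in> D \<longrightarrow> X \<in> D)"

text \<open>Finite direct sums include the empty one, the zero objects.\<close>

definition add_closure :: "('o, 'm, 'z) preadditive_scheme \<Rightarrow> 'o set \<Rightarrow> 'o set" where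
  "add_closure C M = \<Inter>{D. M \<subseteq> D \<and> D \<subseteq> Obj C \<and>
     (\<forall>X Y. X \<in> D \<and> isomorphic C X Y \<longrightarrow> Y \<in> D) \<and>
     (\<forall>Z. zero_object C Z \<longrightarrow> Z \<in> D) \<and>
     (\<forall>X Y S. X \<in> D \<and> Y \<in> D \<and> direct_sum C X Y S \<longrightarrow> S \<in> D) \<and>
     closed_under_summands C D}"

text \<open>Such a subcategory contains every zero object and is closed under isomorphisms: both arise
  as third terms of triangles on objects already in it.\<close>

definition triangulated_subcategory ::
  "('o, 'm, 'z) triangulated_scheme \<Rightarrow> 'o set \<Rightarrow> bool" where
  "triangulated_subcategory C D \<longleftrightarrow> D \<noteq> {} \<and> D \<subseteq> Obj C \<and>
     (\<forall>X\<in>D. shift C 1 X \<in> D \<and> shift C (- 1) X \<in> D) \<and>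
     (\<forall>X Y Z f g h. triangle C X Y Z f g h \<and> X \<in> D \<and> Y \<in> D \<longrightarrow> Z \<in> D)"

definition thick :: "('o, 'm, 'z) triangulated_scheme \<Rightarrow> 'o set \<Rightarrow> 'o set" where
  "thick C M = \<Inter>{D. M \<subseteq> D \<and> triangulated_subcategory C D \<and> closed_under_summands C D}"

definition presilting :: "('o, 'm, 'z) triangulated_scheme \<Rightarrow> 'o set \<Rightarrow> bool" where
  "presilting C M \<longleftrightarrow> M \<subseteq> Obj C \<and> (\<forall>X\<in>M. \<forall>Y\<in>M. \<forall>i>0. hom_zero C X (shift C i Y))"

definition silting :: "('o, 'm, 'z) triangulated_scheme \<Rightarrow> 'o set \<Rightarrow> bool" where
  "silting C M \<longleftrightarrow> presilting C M \<and> thick C M = Obj C"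

definition add_equiv ::
  "('o, 'm, 'z) preadditive_scheme \<Rightarrow> 'o set set \<Rightarrow> ('o set \<times> 'o set) set" where
  "add_equiv C A = {(M, N). M \<in> A \<and> N \<in> A \<and> add_closure C M = add_closure C N}"

definition presilt :: "('o, 'm, 'z) triangulated_scheme \<Rightarrow> 'o set set set" where
  "presilt C = Collect (presilting C) // add_equiv C (Collect (presilting C))"

definition silt :: "('o, 'm, 'z) triangulated_scheme \<Rightarrow> 'o set set set" where
  "silt C = Collect (silting C) // add_equiv C (Collect (silting C))"

text \<open>A class belongs to \<open>silt_containing C P\<close> as soon as one of its representatives
  contains \<open>P\<close>.\<close>

definition presilt_containing ::
  "('o, 'm, 'z) triangulated_scheme \<Rightarrow> 'o set \<Rightarrow> 'o set set set" where
  "presilt_containing C P = {c \<in> presilt C. \<exists>M\<in>c. P \<subseteq> M}"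

definition silt_containing ::
  "('o, 'm, 'z) triangulated_scheme \<Rightarrow> 'o set \<Rightarrow> 'o set set set" where
  "silt_containing C P = {c \<in> silt C. \<exists>M\<in>c. P \<subseteq> M}"

section \<open>The conditions (P1) and (P2)\<close>

definition left_perp_pos :: "('o, 'm, 'z) shifted_scheme \<Rightarrow> 'o set \<Rightarrow> 'o set" where
  "left_perp_pos C P = {X \<in> Obj C. \<forall>i>0. \<forall>Y\<in>P. hom_zero C X (shift C i Y)}"

definition right_perp_neg :: "('o, 'm, 'z) shifted_scheme \<Rightarrow> 'o set \<Rightarrow> 'o set" where
  "right_perp_neg C P = {X \<in> Obj C. \<forall>i<0. \<forall>Y\<in>P. hom_zero C (shift C i Y) X}"

definition contravariantly_finite ::
  "('o, 'm, 'z) preadditive_scheme \<Rightarrow> 'o set \<Rightarrow> 'o set \<Rightarrow> bool" where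
  "contravariantly_finite C S D \<longleftrightarrow>
     (\<forall>X\<in>D. \<exists>Y\<in>S. \<exists>f\<in>Hom C Y X. \<forall>S'\<in>S. (\<lambda>g. f \<cdot>\<^bsub>C\<^esub> g) ` Hom C S' Y = Hom C S' X)"

definition covariantly_finite ::
  "('o, 'm, 'z) preadditive_scheme \<Rightarrow> 'o set \<Rightarrow> 'o set \<Rightarrow> bool" where
  "covariantly_finite C S D \<longleftrightarrow>
     (\<forall>X\<in>D. \<exists>Y\<in>S. \<exists>f\<in>Hom C X Y. \<forall>S'\<in>S. (\<lambda>g. g \<cdot>\<^bsub>C\<^esub> f) ` Hom C Y S' = Hom C X S')"

definition condP1 :: "('o, 'm, 'z) shifted_scheme \<Rightarrow> 'o set \<Rightarrow> bool" where
  "condP1 C P \<longleftrightarrow> covariantly_finite C P (left_perp_pos C P) \<and>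
     contravariantly_finite C P (right_perp_neg C P)"

definition condP2 :: "('o, 'm, 'z) shifted_scheme \<Rightarrow> 'o set \<Rightarrow> bool" where
  "condP2 C P \<longleftrightarrow> (\<forall>X\<in>Obj C. \<exists>n. \<forall>l\<ge>n. \<forall>Y\<in>P.
     hom_zero C X (shift C l Y) \<and> hom_zero C Y (shift C l X))"

section \<open>Triangle quotients\<close>

text \<open>
  The Verdier quotient of \<open>C\<close> by a thick subcategory \<open>N\<close>, built by right fractions. A roof
  \<open>X \<leftarrow> Z \<rightarrow> Y\<close> with legs \<open>s\<close> and \<open>f\<close>, the cone of \<open>s\<close> lying in \<open>N\<close>, is
  the pair \<open>(s, f)\<close>; it stands for \<open>f s\<^sup>-\<^sup>1\<close>. Morphisms of the quotient are equivalence
  classes of roofs. Operations on classes are written as unions of the resulting classes over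
  all choices of representatives (and of Ore squares); these classes all coincide when \<open>C\<close> is
  triangulated.
\<close>

definition denominators :: "('o, 'm, 'z) triangulated_scheme \<Rightarrow> 'o set \<Rightarrow> 'o \<Rightarrow> 'o \<Rightarrow> 'm set" where
  "denominators C N X Y = {s. \<exists>Z\<in>N. \<exists>g h. triangle C X Y Z s g h}"

definition roofs :: "('o, 'm, 'z) triangulated_scheme \<Rightarrow> 'o set \<Rightarrow> 'o \<Rightarrow> 'o \<Rightarrow> ('m \<times> 'm) set" where
  "roofs C N X Y = {(s, f). X \<in> Obj C \<and> Y \<in> Obj C \<and>
     (\<exists>Z\<in>Obj C. s \<in> denominators C N Z X \<and> f \<in> Hom C Z Y)}"

definition roof_rel ::
  "('o, 'm, 'z) triangulated_scheme \<Rightarrow> 'o set \<Rightarrow> (('m \<times> 'm) \<times> ('m \<times> 'm)) set" where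
  "roof_rel C N = {((s, f), (s', f')).
     \<exists>X\<in>Obj C. \<exists>Y\<in>Obj C. \<exists>Z\<in>Obj C. \<exists>Z'\<in>Obj C. \<exists>W\<in>Obj C.
       s \<in> denominators C N Z X \<and> f \<in> Hom C Z Y \<and>
       s' \<in> denominators C N Z' X \<and> f' \<in> Hom C Z' Y \<and>
       (\<exists>a\<in>Hom C W Z. \<exists>b\<in>Hom C W Z'.
          s \<cdot>\<^bsub>C\<^esub> a = s' \<cdot>\<^bsub>C\<^esub> b \<and> f \<cdot>\<^bsub>C\<^esub> a = f' \<cdot>\<^bsub>C\<^esub> b \<and>
          s \<cdot>\<^bsub>C\<^esub> a \<in> denominators C N W X)}"

definition roof_class ::
  "('o, 'm, 'z) triangulated_scheme \<Rightarrow> 'o set \<Rightarrow> 'm \<times> 'm \<Rightarrow> ('m \<times> 'm) set" where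
  "roof_class C N r = roof_rel C N `` {r}"

text \<open>\<open>ore_square C N f t t' f'\<close>: the square \<open>f t' = t f'\<close> with \<open>t\<close> and \<open>t'\<close> denominators,
  used to rewrite \<open>t\<^sup>-\<^sup>1 f\<close> as \<open>f' t'\<^sup>-\<^sup>1\<close>.\<close>

definition ore_square ::
  "('o, 'm, 'z) triangulated_scheme \<Rightarrow> 'o set \<Rightarrow> 'm \<Rightarrow> 'm \<Rightarrow> 'm \<Rightarrow> 'm \<Rightarrow> bool" where
  "ore_square C N f t t' f' \<longleftrightarrow>
     (\<exists>W\<in>Obj C. \<exists>Z\<in>Obj C. \<exists>Z'\<in>Obj C. \<exists>Y\<in>Obj C.
        f \<in> Hom C Z Y \<and> t \<in> denominators C N Z' Y \<and>
        t' \<in> denominators C N W Z \<and> f' \<in> Hom C W Z' \<and>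
        f \<cdot>\<^bsub>C\<^esub> t' = t \<cdot>\<^bsub>C\<^esub> f')"

definition quotient_shifted ::
  "('o, 'm, 'z) triangulated_scheme \<Rightarrow> 'o set \<Rightarrow> ('o, ('m \<times> 'm) set) shifted" where
  "quotient_shifted C N = \<lparr>
     Obj = Obj C,
     Hom = (\<lambda>X Y. roofs C N X Y // roof_rel C N),
     Ident = (\<lambda>X. roof_class C N (Ident C X, Ident C X)),
     Comp = (\<lambda>\<beta> \<alpha>. \<Union>{roof_class C N (s \<cdot>\<^bsub>C\<^esub> t', g \<cdot>\<^bsub>C\<^esub> f') |s f t g t' f'.
                (s, f) \<in> \<alpha> \<and> (t, g) \<in> \<beta> \<and> ore_square C N f t t' f'}),
     Zero = (\<lambda>X Y. roof_class C N (Ident C X, Zero C X Y)),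
     Plus = (\<lambda>\<alpha> \<beta>. \<Union>{roof_class C N (s, f \<boxplus>\<^bsub>C\<^esub> g) |s f g. (s, f) \<in> \<alpha> \<and> (s, g) \<in> \<beta>}),
     ShO = ShO C,
     ShM = (\<lambda>\<alpha>. \<Union>{roof_class C N (ShM C s, ShM C f) |s f. (s, f) \<in> \<alpha>})\<rparr>"

record ('o, 'm, 'p, 'n) functor_data =
  on_Obj :: "'o \<Rightarrow> 'p"
  on_Mor :: "'m \<Rightarrow> 'n"

text \<open>The union below ranges over at most one object \<open>X\<close>, the source of \<open>f\<close>.\<close>

definition quotient_functor ::
  "('o, 'm, 'z) triangulated_scheme \<Rightarrow> 'o set \<Rightarrow> ('o, 'm, 'o, ('m \<times> 'm) set) functor_data" where
  "quotient_functor C N = \<lparr>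
     on_Obj = (\<lambda>X. X),
     on_Mor = (\<lambda>f. \<Union>{roof_class C N (Ident C X, f) |X. X \<in> Obj C \<and> (\<exists>Y\<in>Obj C. f \<in> Hom C X Y)})\<rparr>"

definition quotient_triangles ::
  "('o, 'm, 'z) triangulated_scheme \<Rightarrow> 'o set \<Rightarrow>
     (('m \<times> 'm) set \<times> ('m \<times> 'm) set \<times> ('m \<times> 'm) set) set" where
  "quotient_triangles C N =
     (let \<rho> = quotient_functor C N in
      {(u, v, w). \<exists>X Y Z f g h X' Y' Z'. triangle C X Y Z f g h \<and>
         triangle_isomorphic (quotient_shifted C N)
           (on_Obj \<rho> X) (on_Obj \<rho> Y) (on_Obj \<rho> Z) (on_Mor \<rho> f) (on_Mor \<rho> g) (on_Mor \<rho> h)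
           X' Y' Z' u v w})"

definition triangle_quotient ::
  "('o, 'm, 'z) triangulated_scheme \<Rightarrow> 'o set \<Rightarrow> ('o, ('m \<times> 'm) set) triangulated" where
  "triangle_quotient C N =
     shifted.extend (quotient_shifted C N) (triangulated.fields (quotient_triangles C N))"

text \<open>\<open>A\<close> and \<open>B\<close> are sets of equivalence classes of subcategories. As the classes in \<open>B\<close>
  are disjoint, \<open>F c\<close> has to be the class of the image of \<open>M\<close>, for every representative
  \<open>M\<close> of \<open>c\<close>; so well-definedness is part of the condition and \<open>F\<close> is unique on \<open>A\<close>.\<close>

definition induces_bijection ::
  "('o, 'm, 'p, 'n) functor_data \<Rightarrow> 'o set set set \<Rightarrow> 'p set set set \<Rightarrow> bool" where
  "induces_bijection \<rho> A B \<longleftrightarrow>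
     (\<exists>F. bij_betw F A B \<and> (\<forall>c\<in>A. \<forall>M\<in>c. on_Obj \<rho> ` M \<in> F c))"

end

theory Submission
  imports Defs
begin

text \<open>
  Let \<open>N = thick P\<close>, and let the core consist of the objects of \<open>\<^sup>\<bottom>P[>0] \<inter> P[<0]\<^sup>\<bottom>\<close>. Condition (P2)
  allows one to reach the core from any object in finitely many steps: taking left approximations
  from (P1) and passing to cocones gives a triangle \<open>X' \<rightarrow> X \<rightarrow> A\<close> with \<open>X'\<close> in \<open>\<^sup>\<bottom>P[>0]\<close> and \<open>A \<in> N\<close>
  receiving no morphisms from \<open>\<^sup>\<bottom>P[>0]\<close>, and dually on the other side. So every object is isomorphic in
  the quotient to one of the core. The same triangles, applied to the cone of a denominator, show that
  \<open>Hom(X, Y[i])\<close> maps onto the \<open>Hom\<close> set of the quotient for \<open>X\<close>, \<open>Y\<close> in the core and \<open>i \<ge> 0\<close>, the kernel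
  being the morphisms that factor through \<open>P\<close>; for \<open>i > 0\<close> these are zero. Hence presilting
  subcategories containing \<open>P\<close>, which lie in the core, descend, and those of the quotient lift. As
  \<open>P\<close> vanishes in the quotient, a retraction there lifts to one in \<open>T\<close> after adding a summand
  from \<open>P\<close>, which gives injectivity. Finally, thick subcategories of the quotient are the thick
  subcategories of \<open>T\<close> that contain \<open>N\<close>.
\<close>

section \<open>Preadditive categories\<close>

context preadditive_category
begin

text \<open>Only the preadditive structure of the quotient is developed; statements about its
  triangles, its shift and its zero morphisms are pulled back to \<open>C\<close>. A vanishing
  morphism becomes a factorization through \<open>N\<close>, a retraction becomes a roof, and
  isomorphisms in all degrees come from shifting triangles of \<open>C\<close>. The decisive fact is
  that an object of \<open>N\<close> in the core belongs to \<open>P\<close>. It cuts every object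
  of \<open>N\<close> into three layers: an outer one that receives only zero morphisms from the
  left perpendicular class, an object of \<open>P\<close>, and an inner one that has only zero
  morphisms to the right perpendicular class. Morphisms from the first class to the second see the
  middle layer alone, which is why \<open>P\<close> instead of \<open>N\<close> governs the kernel.
  Additive closures are compared by retracts: these are easy to lift, and in \<open>C\<close> a
  retract acquires its complement from a triangle.\<close>

definition mor :: "'b \<Rightarrow> 'a \<Rightarrow> 'a \<Rightarrow> bool" where
  "mor f X Y \<longleftrightarrow> X \<in> Obj C \<and> Y \<in> Obj C \<and> f \<in> Hom C X Y"

definition arr :: "'b \<Rightarrow> bool" where
  "arr f \<longleftrightarrow> (\<exists>X Y. mor f X Y)"

text \<open>Morphism sets are disjoint, so a morphism determines its source and target. Typing
  conditions then become equations between objects, which simplification can discharge without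
  annotations.\<close>

definition src :: "'b \<Rightarrow> 'a" where
  "src f = (THE X. \<exists>Y. mor f X Y)"

definition tgt :: "'b \<Rightarrow> 'a" where
  "tgt f = (THE Y. \<exists>X. mor f X Y)"

definition neg :: "'b \<Rightarrow> 'b" where
  "neg f = Neg C (src f) (tgt f) f"

abbreviation zr :: "'a \<Rightarrow> 'a \<Rightarrow> 'b" where "zr \<equiv> Zero C"
abbreviation idn :: "'a \<Rightarrow> 'b" where "idn \<equiv> Ident C"

lemma mor_unique:
  assumes "mor f X Y" "mor f X' Y'"
  shows "X = X'" "Y = Y'"
  using assms Hom_disjoint unfolding mor_def by blast+

lemma mor_src_tgt:
  assumes "mor f X Y"
  shows "src f = X" "tgt f = Y"
  unfolding src_def tgt_def by (rule the_equality; use assms mor_unique in blast)+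

lemma mor_iff [simp]:
  "mor f X Y \<longleftrightarrow> arr f \<and> src f = X \<and> tgt f = Y \<and> X \<in> Obj C \<and> Y \<in> Obj C"
proof
  assume "mor f X Y"
  then show "arr f \<and> src f = X \<and> tgt f = Y \<and> X \<in> Obj C \<and> Y \<in> Obj C"
    using mor_src_tgt[of f X Y] unfolding arr_def mor_def by blast
next
  assume a: "arr f \<and> src f = X \<and> tgt f = Y \<and> X \<in> Obj C \<and> Y \<in> Obj C"
  then obtain X' Y' where "mor f X' Y'" unfolding arr_def by blast
  with a mor_src_tgt[of f X' Y'] show "mor f X Y" by simp
qed

lemma arr_mor: "arr f \<Longrightarrow> mor f (src f) (tgt f)"
  unfolding arr_def using mor_src_tgt by blast

lemma Hom_eq: "\<lbrakk>X \<in> Obj C; Y \<in> Obj C\<rbrakk> \<Longrightarrow> f \<in> Hom C X Y \<longleftrightarrow> mor f X Y"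
  unfolding mor_def by blast

lemma arr_Obj [simp]: "arr f \<Longrightarrow> src f \<in> Obj C" "arr f \<Longrightarrow> tgt f \<in> Obj C"
  using arr_mor by auto

lemma arr_Ident [simp]:
  "X \<in> Obj C \<Longrightarrow> arr (idn X)" "X \<in> Obj C \<Longrightarrow> src (idn X) = X" "X \<in> Obj C \<Longrightarrow> tgt (idn X) = X"
  using Ident_in_Hom[of X] Hom_eq[of X X "idn X"] by auto

lemma mor_Comp: "\<lbrakk>mor f X Y; mor g Y Z\<rbrakk> \<Longrightarrow> mor (g \<cdot> f) X Z"
  using Comp_in_Hom unfolding mor_def by blast

lemma arr_Comp [simp]:
  assumes "arr f" "arr g" "tgt f = src g"
  shows "arr (g \<cdot> f)" "src (g \<cdot> f) = src f" "tgt (g \<cdot> f) = tgt g"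
  using mor_Comp[of f "src f" "src g" g "tgt g"] assms by auto

lemma Comp_Ident' [simp]: "\<lbrakk>arr f; src f = X\<rbrakk> \<Longrightarrow> f \<cdot> idn X = f"
  using Comp_Ident arr_mor unfolding mor_def by blast

lemma Ident_Comp' [simp]: "\<lbrakk>arr f; tgt f = X\<rbrakk> \<Longrightarrow> idn X \<cdot> f = f"
  using Ident_Comp arr_mor unfolding mor_def by blast

lemma Comp_assoc' [simp]:
  "\<lbrakk>arr f; arr g; arr h; tgt f = src g; tgt g = src h\<rbrakk> \<Longrightarrow> (h \<cdot> g) \<cdot> f = h \<cdot> (g \<cdot> f)"
  using Comp_assoc[of "src f" "src g" "src h" "tgt h" f g h] arr_mor[of f] arr_mor[of g] arr_mor[of h]
  unfolding mor_def by auto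

text \<open>Compositions are normalised with brackets to the right, so a known equation for
  \<open>g \<cdot> f\<close> no longer matches inside \<open>g \<cdot> (f \<cdot> k)\<close>; this
  form brings it back.\<close>

lemma Comp_reassoc:
  "\<lbrakk>g \<cdot> f = e; arr f; arr g; arr k; tgt f = src g; tgt k = src f\<rbrakk> \<Longrightarrow> g \<cdot> (f \<cdot> k) = e \<cdot> k"
  using Comp_assoc'[of k f g] by simp

section \<open>The additive structure of the Hom sets\<close>

lemma comm_group_facts:
  assumes "X \<in> Obj C" "Y \<in> Obj C"
  shows "mor (zr X Y) X Y"
    and "\<lbrakk>mor f X Y; mor g X Y\<rbrakk> \<Longrightarrow> mor (f \<boxplus> g) X Y"
    and "\<lbrakk>mor f X Y; mor g X Y\<rbrakk> \<Longrightarrow> f \<boxplus> g = g \<boxplus> f"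
    and "\<lbrakk>mor f X Y; mor g X Y; mor h X Y\<rbrakk> \<Longrightarrow> (f \<boxplus> g) \<boxplus> h = f \<boxplus> (g \<boxplus> h)"
    and "mor f X Y \<Longrightarrow> zr X Y \<boxplus> f = f"
    and "mor f X Y \<Longrightarrow> mor (neg f) X Y"
    and "mor f X Y \<Longrightarrow> f \<boxplus> neg f = zr X Y"
proof -
  interpret G: comm_group "hom_group C X Y" by (rule hom_comm_group[OF assms])
  have c: "f \<in> carrier (hom_group C X Y) \<longleftrightarrow> mor f X Y" for f
    using assms by (simp add: hom_group_def mor_def del: mor_iff)
  have s: "f \<otimes>\<^bsub>hom_group C X Y\<^esub> g = f \<boxplus> g" "\<one>\<^bsub>hom_group C X Y\<^esub> = zr X Y" for f g
    by (simp_all add: hom_group_def)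
  have n: "neg f = inv\<^bsub>hom_group C X Y\<^esub> f" if "mor f X Y" for f
    by (simp only: neg_def Neg_def mor_src_tgt[OF that])
  show "mor (zr X Y) X Y"
    using G.one_closed unfolding c s .
  show "mor (f \<boxplus> g) X Y" if "mor f X Y" "mor g X Y"
    using G.m_closed[of f g] that unfolding c s by blast
  show "f \<boxplus> g = g \<boxplus> f" if "mor f X Y" "mor g X Y"
    using G.m_comm[of f g] that unfolding c s by blast
  show "(f \<boxplus> g) \<boxplus> h = f \<boxplus> (g \<boxplus> h)" if "mor f X Y" "mor g X Y" "mor h X Y"
    using G.m_assoc[of f g h] that unfolding c s by blast
  show "zr X Y \<boxplus> f = f" if "mor f X Y"
    using G.l_one[of f] that unfolding c s by blast
  show "mor (neg f) X Y" if "mor f X Y"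
    using G.inv_closed[of f] n[OF that] that unfolding c by metis
  show "f \<boxplus> neg f = zr X Y" if "mor f X Y"
    using G.r_inv[of f] n[OF that] that unfolding c s by metis
qed

lemma arr_Zero [simp]:
  assumes "X \<in> Obj C" "Y \<in> Obj C"
  shows "arr (zr X Y)" "src (zr X Y) = X" "tgt (zr X Y) = Y"
  using comm_group_facts(1)[OF assms] by auto

lemma arr_Plus [simp]:
  assumes "arr f" "arr g" "src f = src g" "tgt f = tgt g"
  shows "arr (f \<boxplus> g)" "src (f \<boxplus> g) = src g" "tgt (f \<boxplus> g) = tgt g"
  using comm_group_facts(2)[of "src f" "tgt f" f g] assms by auto

lemma arr_neg [simp]:
  assumes "arr f"
  shows "arr (neg f)" "src (neg f) = src f" "tgt (neg f) = tgt f"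
  using comm_group_facts(6)[of "src f" "tgt f" f] assms by auto

lemma Plus_comm:
  "\<lbrakk>arr f; arr g; src f = src g; tgt f = tgt g\<rbrakk> \<Longrightarrow> f \<boxplus> g = g \<boxplus> f"
  using comm_group_facts(3)[of "src f" "tgt f" f g] by auto

lemma Plus_assoc:
  "\<lbrakk>arr f; arr g; arr h; src f = src g; src g = src h; tgt f = tgt g; tgt g = tgt h\<rbrakk>
    \<Longrightarrow> (f \<boxplus> g) \<boxplus> h = f \<boxplus> (g \<boxplus> h)"
  using comm_group_facts(4)[of "src f" "tgt f" f g h] by auto

lemma Plus_lcomm:
  "\<lbrakk>arr f; arr g; arr h; src f = src g; src g = src h; tgt f = tgt g; tgt g = tgt h\<rbrakk>
    \<Longrightarrow> f \<boxplus> (g \<boxplus> h) = g \<boxplus> (f \<boxplus> h)"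
  using Plus_assoc[of f g h] Plus_assoc[of g f h] Plus_comm[of f g] by simp

lemma Zero_Plus [simp]: "\<lbrakk>arr f; src f = X; tgt f = Y\<rbrakk> \<Longrightarrow> zr X Y \<boxplus> f = f"
  using comm_group_facts(5)[of X Y f] by auto

lemma Plus_Zero [simp]: "\<lbrakk>arr f; src f = X; tgt f = Y\<rbrakk> \<Longrightarrow> f \<boxplus> zr X Y = f"
  using Plus_comm[of f "zr X Y"] by auto

lemma Plus_neg [simp]: "arr f \<Longrightarrow> f \<boxplus> neg f = zr (src f) (tgt f)"
  using comm_group_facts(7)[of "src f" "tgt f" f] by auto

lemma neg_Plus [simp]: "arr f \<Longrightarrow> neg f \<boxplus> f = zr (src f) (tgt f)"
  using Plus_comm[of f "neg f"] by auto

lemma Plus_left_cancel: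
  assumes "arr f" "arr g" "arr h" "src f = src g" "src g = src h" "tgt f = tgt g" "tgt g = tgt h"
    "f \<boxplus> g = f \<boxplus> h"
  shows "g = h"
proof -
  have "g = (neg f \<boxplus> f) \<boxplus> g" using assms(1-7) by simp
  also have "\<dots> = neg f \<boxplus> (f \<boxplus> g)" using assms(1-7) by (intro Plus_assoc) auto
  also have "\<dots> = neg f \<boxplus> (f \<boxplus> h)" by (simp only: assms(8))
  also have "\<dots> = (neg f \<boxplus> f) \<boxplus> h" using assms(1-7) by (intro Plus_assoc[symmetric]) auto
  also have "\<dots> = h" using assms(1-7) by simp
  finally show ?thesis .
qed

lemma neg_unique:
  assumes "arr f" "arr g" "src f = src g" "tgt f = tgt g" "f \<boxplus> g = zr (src g) (tgt g)"
  shows "g = neg f"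
  by (rule Plus_left_cancel[of f]) (use assms in auto)

lemma neg_neg [simp]: "arr f \<Longrightarrow> neg (neg f) = f"
  by (rule neg_unique[symmetric]) auto

lemma eq_if_Plus_neg_Zero:
  assumes "arr f" "arr g" "src f = src g" "tgt f = tgt g" "f \<boxplus> neg g = zr (src g) (tgt g)"
  shows "f = g"
proof -
  have "neg g \<boxplus> f = neg g \<boxplus> g" using Plus_comm[of f "neg g"] assms by simp
  then show ?thesis using assms(1-4) by (intro Plus_left_cancel[of "neg g" f g]) auto
qed

lemma Comp_Plus' [simp]:
  "\<lbrakk>arr f; arr f'; arr g; src f = src f'; tgt f = tgt f'; tgt f' = src g\<rbrakk>
    \<Longrightarrow> g \<cdot> (f \<boxplus> f') = (g \<cdot> f) \<boxplus> (g \<cdot> f')"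
  using Comp_Plus[of "src f" "src g" "tgt g" f f' g] Hom_eq[of "src f" "src g"] Hom_eq[of "src g" "tgt g"]
  by auto

lemma Plus_Comp' [simp]:
  "\<lbrakk>arr f; arr g; arr g'; src g = src g'; tgt g = tgt g'; tgt f = src g'\<rbrakk>
    \<Longrightarrow> (g \<boxplus> g') \<cdot> f = (g \<cdot> f) \<boxplus> (g' \<cdot> f)"
  using Plus_Comp[of "src f" "src g" "tgt g" f g g'] Hom_eq[of "src f" "src g"] Hom_eq[of "src g" "tgt g"]
  by auto

text \<open>Cancel one copy of \<open>f\<close>. An additive map sends zero to such an element, so
  this yields the preservation of zero by composition and by the shift.\<close>

lemma Zero_if_idem:
  assumes "arr f" "f \<boxplus> f = f" shows "f = zr (src f) (tgt f)"
  by (rule Plus_left_cancel[of f]) (use assms in auto)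

lemma Comp_Zero [simp]:
  assumes "arr g" "X \<in> Obj C" "src g = Y"
  shows "g \<cdot> zr X Y = zr X (tgt g)"
proof -
  have [simp]: "Y \<in> Obj C" using assms by auto
  have "g \<cdot> (zr X Y \<boxplus> zr X Y) = (g \<cdot> zr X Y) \<boxplus> (g \<cdot> zr X Y)"
    by (rule Comp_Plus') (use assms in auto)
  then show ?thesis using Zero_if_idem[of "g \<cdot> zr X Y"] assms by simp
qed

lemma Zero_Comp [simp]:
  assumes "arr f" "Z \<in> Obj C" "tgt f = Y"
  shows "zr Y Z \<cdot> f = zr (src f) Z"
proof -
  have [simp]: "Y \<in> Obj C" using assms by auto
  have "(zr Y Z \<boxplus> zr Y Z) \<cdot> f = (zr Y Z \<cdot> f) \<boxplus> (zr Y Z \<cdot> f)"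
    by (rule Plus_Comp') (use assms in auto)
  then show ?thesis using Zero_if_idem[of "zr Y Z \<cdot> f"] assms by simp
qed

lemma Comp_neg [simp]:
  assumes "arr f" "arr g" "tgt f = src g"
  shows "g \<cdot> neg f = neg (g \<cdot> f)"
proof (rule neg_unique)
  show "(g \<cdot> f) \<boxplus> (g \<cdot> neg f) = zr (src (g \<cdot> neg f)) (tgt (g \<cdot> neg f))"
    using assms Comp_Plus'[of f "neg f" g] by simp
qed (use assms in auto)

lemma neg_Comp [simp]:
  assumes "arr f" "arr g" "tgt f = src g"
  shows "neg g \<cdot> f = neg (g \<cdot> f)"
proof (rule neg_unique)
  show "(g \<cdot> f) \<boxplus> (neg g \<cdot> f) = zr (src (neg g \<cdot> f)) (tgt (neg g \<cdot> f))"
    using assms Plus_Comp'[of f g "neg g"] by simp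
qed (use assms in auto)

lemma neg_Zero [simp]: "\<lbrakk>X \<in> Obj C; Y \<in> Obj C\<rbrakk> \<Longrightarrow> neg (zr X Y) = zr X Y"
  by (rule neg_unique[symmetric]) auto

lemma Neg_eq: "mor f X Y \<Longrightarrow> Neg C X Y f = neg f"
  by (simp add: neg_def)

section \<open>Vanishing Hom sets, isomorphisms, sums and zero objects\<close>

lemma hom_zeroD: "\<lbrakk>hom_zero C X Y; mor f X Y\<rbrakk> \<Longrightarrow> f = zr X Y"
  unfolding hom_zero_def mor_def by blast

lemma hom_zeroI:
  assumes "X \<in> Obj C" "Y \<in> Obj C" "\<And>f. mor f X Y \<Longrightarrow> f = zr X Y"
  shows "hom_zero C X Y"
  using assms(3) comm_group_facts(1)[OF assms(1,2)] Hom_eq[OF assms(1,2)]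
  unfolding hom_zero_def by blast

lemma is_iso_iff:
  assumes "X \<in> Obj C" "Y \<in> Obj C"
  shows "is_iso C X Y f \<longleftrightarrow> mor f X Y \<and> (\<exists>g. mor g Y X \<and> g \<cdot> f = idn X \<and> f \<cdot> g = idn Y)"
  unfolding is_iso_def Bex_def using Hom_eq[OF assms] Hom_eq[OF assms(2,1)] by auto

lemma direct_sum_iff:
  "direct_sum C X Y S \<longleftrightarrow> (\<exists>i j p q. mor i X S \<and> mor j Y S \<and> mor p S X \<and> mor q S Y \<and>
     p \<cdot> i = idn X \<and> q \<cdot> j = idn Y \<and> q \<cdot> i = zr X Y \<and> p \<cdot> j = zr Y X \<and>
     (i \<cdot> p) \<boxplus> (j \<cdot> q) = idn S)" (is "?l = ?r")
proof
  assume ?l then show ?r unfolding direct_sum_def mor_def by blast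
next
  assume ?r then show ?l unfolding direct_sum_def mor_def by blast
qed

text \<open>Every morphism into or out of \<open>Z\<close> factors through the identity of
  \<open>Z\<close>, so the vanishing of this one morphism suffices.\<close>

lemma zero_object_iff:
  "zero_object C Z \<longleftrightarrow> Z \<in> Obj C \<and> idn Z = zr Z Z"
proof
  assume "zero_object C Z"
  then show "Z \<in> Obj C \<and> idn Z = zr Z Z"
    unfolding zero_object_def using hom_zeroD[of Z Z "idn Z"] by auto
next
  assume Z: "Z \<in> Obj C \<and> idn Z = zr Z Z"
  have "hom_zero C Z X \<and> hom_zero C X Z" if "X \<in> Obj C" for X
  proof (intro conjI hom_zeroI)
    fix f assume "mor f Z X"
    then have "f = f \<cdot> idn Z" by simp
    then show "f = zr Z X" using Z \<open>mor f Z X\<close> by simp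
  next
    fix f assume "mor f X Z"
    then have "f = idn Z \<cdot> f" by simp
    then show "f = zr X Z" using Z \<open>mor f X Z\<close> by simp
  qed (use Z that in auto)
  then show "zero_object C Z" using Z unfolding zero_object_def by blast
qed

end

section \<open>Shifts and triangles\<close>

context shifted_category
begin

lemma ShO_Obj [simp]: "X \<in> Obj C \<Longrightarrow> ShO C X \<in> Obj C"
  using ShO_bij bij_betwE by blast

lemma mor_ShM: "mor f X Y \<Longrightarrow> mor (ShM C f) (ShO C X) (ShO C Y)"
  using ShM_bij[of X Y] ShO_Obj unfolding mor_def bij_betw_def by blast

lemma arr_ShM [simp]:
  assumes "arr f"
  shows "arr (ShM C f)" "src (ShM C f) = ShO C (src f)" "tgt (ShM C f) = ShO C (tgt f)"
  using mor_ShM[OF arr_mor[OF assms]] by auto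

lemma ShM_surj:
  assumes "mor g (ShO C X) (ShO C Y)" "X \<in> Obj C" "Y \<in> Obj C"
  obtains f where "mor f X Y" "g = ShM C f"
  using ShM_bij[OF assms(2,3)] assms unfolding mor_def bij_betw_def by blast

lemma ShM_inj:
  assumes "mor f X Y" "mor g X Y" "ShM C f = ShM C g"
  shows "f = g"
  using ShM_bij[of X Y] assms unfolding mor_def bij_betw_def inj_on_def by blast

declare ShM_Ident [simp]

lemma ShM_Comp' [simp]:
  "\<lbrakk>arr f; arr g; tgt f = src g\<rbrakk> \<Longrightarrow> ShM C (g \<cdot> f) = ShM C g \<cdot> ShM C f"
  using ShM_Comp[of "src f" "src g" "tgt g" f g] arr_mor[of f] arr_mor[of g] unfolding mor_def by auto

lemma ShM_Plus' [simp]: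
  "\<lbrakk>arr f; arr g; src f = src g; tgt f = tgt g\<rbrakk> \<Longrightarrow> ShM C (f \<boxplus> g) = ShM C f \<boxplus> ShM C g"
  using ShM_Plus[of "src g" "tgt g" f g] arr_mor[of f] arr_mor[of g] unfolding mor_def by auto

lemma ShM_Zero [simp]:
  assumes "X \<in> Obj C" "Y \<in> Obj C"
  shows "ShM C (zr X Y) = zr (ShO C X) (ShO C Y)"
proof -
  have "ShM C (zr X Y) \<boxplus> ShM C (zr X Y) = ShM C (zr X Y \<boxplus> zr X Y)"
    by (rule ShM_Plus'[symmetric]) (use assms in auto)
  also have "\<dots> = ShM C (zr X Y)" using assms by simp
  finally show ?thesis using Zero_if_idem[of "ShM C (zr X Y)"] assms by simp
qed

lemma ShM_neg [simp]:
  assumes "arr f" shows "ShM C (neg f) = neg (ShM C f)"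
proof (rule neg_unique)
  have "ShM C f \<boxplus> ShM C (neg f) = ShM C (f \<boxplus> neg f)"
    by (rule ShM_Plus'[symmetric]) (use assms in auto)
  then show "ShM C f \<boxplus> ShM C (neg f) = zr (src (ShM C (neg f))) (tgt (ShM C (neg f)))"
    using assms by simp
qed (use assms in auto)

section \<open>Integer powers of the shift\<close>

lemma shift_0 [simp]: "shift C 0 X = X"
  by (simp add: shift_def)

lemma shift_1 [simp]: "shift C 1 X = ShO C X"
  by (simp add: shift_def)

lemma inv_ShO_Obj: "X \<in> Obj C \<Longrightarrow> inv_into (Obj C) (ShO C) X \<in> Obj C"
  using ShO_bij by (metis bij_betw_imp_surj_on inv_into_into)

lemma shift_Obj [simp]: "X \<in> Obj C \<Longrightarrow> shift C n X \<in> Obj C"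
proof -
  assume X: "X \<in> Obj C"
  have "(ShO C ^^ k) X \<in> Obj C" "(inv_into (Obj C) (ShO C) ^^ k) X \<in> Obj C" for k
    using X by (induction k) (auto simp: inv_ShO_Obj)
  then show ?thesis unfolding shift_def by simp
qed

lemma ShO_shift: "X \<in> Obj C \<Longrightarrow> ShO C (shift C n X) = shift C (n + 1) X"
proof -
  assume X: "X \<in> Obj C"
  have inv: "ShO C (inv_into (Obj C) (ShO C) Y) = Y" if "Y \<in> Obj C" for Y
    using ShO_bij that by (metis bij_betw_imp_surj_on f_inv_into_f)
  show ?thesis
  proof (cases "0 \<le> n")
    case True
    then have "nat (n + 1) = Suc (nat n)" by simp
    then show ?thesis using True by (simp add: shift_def)
  next
    case False
    then have "nat (- n) = Suc (nat (- (n + 1)))" by simp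
    then have "ShO C (shift C n X) =
        ShO C (inv_into (Obj C) (ShO C) ((inv_into (Obj C) (ShO C) ^^ nat (- (n + 1))) X))"
      using False by (simp add: shift_def)
    moreover have "(inv_into (Obj C) (ShO C) ^^ k) X \<in> Obj C" for k
      using X by (induction k) (auto simp: inv_ShO_Obj)
    ultimately have "ShO C (shift C n X) = (inv_into (Obj C) (ShO C) ^^ nat (- (n + 1))) X"
      using inv by simp
    then show ?thesis using False by (auto simp: shift_def)
  qed
qed

lemma ShO_inj: "\<lbrakk>ShO C X = ShO C Y; X \<in> Obj C; Y \<in> Obj C\<rbrakk> \<Longrightarrow> X = Y"
  using ShO_bij unfolding bij_betw_def inj_on_def by blast

text \<open>\<open>ShO_shift\<close> raises the degree, so the downward step compares both sides
  after one application of \<open>ShO\<close> and then uses injectivity.\<close>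

lemma shift_shift [simp]:
  assumes "X \<in> Obj C"
  shows "shift C m (shift C n X) = shift C (m + n) X"
proof (induction m rule: int_induct[where k = 0])
  case base
  show ?case by simp
next
  case (step1 i)
  then show ?case using ShO_shift[of "shift C n X" i] ShO_shift[of X "i + n"] assms
    by (simp add: ac_simps)
next
  case (step2 i)
  have "ShO C (shift C (i - 1) (shift C n X)) = shift C (i - 1 + 1) (shift C n X)"
    using assms by (intro ShO_shift) auto
  also have "\<dots> = shift C (i - 1 + n + 1) X" using step2(2) by (simp add: algebra_simps)
  also have "\<dots> = ShO C (shift C (i - 1 + n) X)" using assms by (intro ShO_shift[symmetric]) auto
  finally show ?case by (rule ShO_inj) (use assms in auto)
qed

lemma shift_ShO [simp]: "X \<in> Obj C \<Longrightarrow> shift C n (ShO C X) = shift C (n + 1) X"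
  using shift_shift[of X n 1] by simp

lemma hom_zero_ShO:
  assumes "X \<in> Obj C" "Y \<in> Obj C"
  shows "hom_zero C (ShO C X) (ShO C Y) \<longleftrightarrow> hom_zero C X Y"
proof
  assume z: "hom_zero C (ShO C X) (ShO C Y)"
  show "hom_zero C X Y"
  proof (rule hom_zeroI[OF assms])
    fix f assume f: "mor f X Y"
    then have "ShM C f = zr (ShO C X) (ShO C Y)" using hom_zeroD[OF z] mor_ShM by blast
    then show "f = zr X Y" using ShM_inj[of f X Y "zr X Y"] f assms by simp
  qed
next
  assume z: "hom_zero C X Y"
  show "hom_zero C (ShO C X) (ShO C Y)"
  proof (rule hom_zeroI)
    fix g assume "mor g (ShO C X) (ShO C Y)"
    then obtain f where f: "mor f X Y" "g = ShM C f" using ShM_surj assms by blast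
    with hom_zeroD[OF z f(1)] assms show "g = zr (ShO C X) (ShO C Y)" by simp
  qed (use assms in auto)
qed

lemma hom_zero_shift:
  assumes "X \<in> Obj C" "Y \<in> Obj C"
  shows "hom_zero C (shift C n X) (shift C n Y) \<longleftrightarrow> hom_zero C X Y"
proof (induction n rule: int_induct[where k = 0])
  case base
  show ?case by simp
next
  case (step1 i)
  then show ?case
    using hom_zero_ShO[of "shift C i X" "shift C i Y"] assms by (simp add: ShO_shift)
next
  case (step2 i)
  then show ?case
    using hom_zero_ShO[of "shift C (i - 1) X" "shift C (i - 1) Y"] assms by (simp add: ShO_shift)
qed

lemma hom_zero_shift_iff:
  assumes "X \<in> Obj C" "Y \<in> Obj C"
  shows "hom_zero C (shift C m X) (shift C n Y) \<longleftrightarrow> hom_zero C X (shift C (n - m) Y)"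
  using hom_zero_shift[of X "shift C (n - m) Y" m] assms by simp

end

context triangulated_category
begin

section \<open>Rotation, exactness and splitting of triangles\<close>

lemma triD:
  assumes "triangle C X Y Z f g h"
  shows "mor f X Y" "mor g Y Z" "mor h Z (ShO C X)"
  using assms ShO_Obj unfolding triangle_def candidate_triangle_def mor_def by blast+

lemma candI: "\<lbrakk>mor f X Y; mor g Y Z; mor h Z (ShO C X)\<rbrakk> \<Longrightarrow> candidate_triangle C X Y Z f g h"
  unfolding candidate_triangle_def mor_def by blast

lemma tri_rotate:
  assumes "triangle C X Y Z f g h"
  shows "triangle C Y Z (ShO C X) g h (neg (ShM C f))"
proof -
  have "candidate_triangle C X Y Z f g h" using assms unfolding triangle_def by blast
  from TR2_rotate[OF this] assms Neg_eq[OF mor_ShM[OF triD(1)[OF assms]]] show ?thesis by simp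
qed

lemma tri_unrotate:
  assumes t: "triangle C X Y Z f g h" and W: "W \<in> Obj C" "ShO C W = Z"
  obtains k where "triangle C W X Y k f g" "h = neg (ShM C k)"
proof -
  note m = triD[OF t]
  have "mor h (ShO C W) (ShO C X)" using m W by simp
  then obtain k0 where k0: "mor k0 W X" "h = ShM C k0" using ShM_surj[of h W X] W m by auto
  \<comment> \<open>Rotating \<open>k\<close> forward produces the negative of its shift, which has
    to be \<open>h\<close>; hence the sign.\<close>
  define k where "k = neg k0"
  have k: "mor k W X" "h = neg (ShM C k)" using k0 unfolding k_def by auto
  have "candidate_triangle C W X Y k f g" using k m W by (intro candI) auto
  from TR2_rotate[OF this] t Neg_eq[OF mor_ShM[OF k(1)]] k W have "triangle C W X Y k f g" by simp
  with k that show ?thesis by blast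
qed

lemma zero_obj_ex: obtains K where "K \<in> Obj C" "idn K = zr K K"
  using zero_object_exists zero_object_iff by blast

lemma into_zero: "\<lbrakk>idn K = zr K K; mor f X K\<rbrakk> \<Longrightarrow> f = zr X K"
  using hom_zeroD[of X K f] zero_object_iff[of K] unfolding zero_object_def by auto

lemma from_zero: "\<lbrakk>idn K = zr K K; mor f K X\<rbrakk> \<Longrightarrow> f = zr K X"
  using hom_zeroD[of K X f] zero_object_iff[of K] unfolding zero_object_def by auto

lemma tri_Ident:
  assumes "X \<in> Obj C" "K \<in> Obj C" "idn K = zr K K"
  shows "triangle C X X K (idn X) (zr X K) (zr K (ShO C X))"
  using TR1_Ident[of X K] assms zero_object_iff by blast

text \<open>Map the triangle on the identity of \<open>X\<close>, whose third object is zero, into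
  the given one: the composite then factors through that zero object.\<close>

lemma tri_comp_zero:
  assumes t: "triangle C X Y Z f g h"
  shows "g \<cdot> f = zr X Z"
proof -
  note m = triD[OF t]
  obtain K where K: "K \<in> Obj C" "idn K = zr K K" by (rule zero_obj_ex)
  have XO: "X \<in> Obj C" using m by auto
  have "f \<cdot> idn X = f \<cdot> idn X" ..
  with TR3_complete[OF tri_Ident[OF XO K] t, of "idn X" f] m XO
  obtain c where c: "c \<in> Hom C K Z" "c \<cdot> zr X K = g \<cdot> f"
    using Hom_eq[of X X "idn X"] Hom_eq[of X Y f] by auto
  then have "mor c K Z" using K m Hom_eq[of K Z] by auto
  with c(2) XO show ?thesis by simp
qed

lemma tri_comp_zero':
  assumes t: "triangle C X Y Z f g h"
  shows "h \<cdot> g = zr Y (ShO C X)" "ShM C f \<cdot> h = zr Z (ShO C Y)"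
proof -
  note m = triD[OF t]
  show "h \<cdot> g = zr Y (ShO C X)" using tri_comp_zero[OF tri_rotate[OF t]] .
  have "neg (ShM C f) \<cdot> h = zr Z (ShO C Y)" using tri_comp_zero[OF tri_rotate[OF tri_rotate[OF t]]] .
  then have "neg (neg (ShM C f) \<cdot> h) = zr Z (ShO C Y)" using m by simp
  then show "ShM C f \<cdot> h = zr Z (ShO C Y)" using m by simp
qed

lemma ShO_zero_obj: "\<lbrakk>K \<in> Obj C; idn K = zr K K\<rbrakk> \<Longrightarrow> idn (ShO C K) = zr (ShO C K) (ShO C K)"
  using ShM_Ident[of K] ShM_Zero[of K K] by simp

text \<open>Exactness of Hom(W, -) at \<open>Y\<close>. The desired morphism is the first component
  of a map out of the triangle on the identity of \<open>W\<close>, whereas TR3 supplies third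
  components; so both triangles are rotated once and the result is desuspended.\<close>

lemma tri_lift:
  assumes t: "triangle C X Y Z f g h" and u: "mor u W Y" "g \<cdot> u = zr W Z"
  obtains v where "mor v W X" "u = f \<cdot> v"
proof -
  note m = triD[OF t]
  obtain K where K: "K \<in> Obj C" "idn K = zr K K" by (rule zero_obj_ex)
  have WO: "W \<in> Obj C" using u by auto
  have "zr K Z \<cdot> zr W K = g \<cdot> u" using u m K WO by simp
  with TR3_complete[OF tri_rotate[OF tri_Ident[OF WO K]] tri_rotate[OF t], of u "zr K Z"] m u K WO
  obtain c where c: "c \<in> Hom C (ShO C W) (ShO C X)"
      "ShM C u \<cdot> neg (ShM C (idn W)) = neg (ShM C f) \<cdot> c"
    using Hom_eq[of W Y u] Hom_eq[of K Z "zr K Z"] by auto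
  then have mc: "mor c (ShO C W) (ShO C X)" using WO m Hom_eq[of "ShO C W" "ShO C X"] by auto
  then obtain v where v: "mor v W X" "c = ShM C v" using ShM_surj WO m by (metis mor_iff)
  have "neg (ShM C u) = neg (ShM C f \<cdot> c)" using c(2) mc u m WO by simp
  then have "neg (neg (ShM C u)) = neg (neg (ShM C f \<cdot> c))" by simp
  then have "ShM C u = ShM C f \<cdot> c" using u m mc by simp
  then have "ShM C u = ShM C (f \<cdot> v)" using v m by simp
  then have "u = f \<cdot> v" using ShM_inj[of u W Y "f \<cdot> v"] u v m by simp
  with v that show ?thesis by blast
qed

lemma shift_minus1: "X \<in> Obj C \<Longrightarrow> ShO C (shift C (- 1) X) = X"
  by (simp add: ShO_shift)

text \<open>Exactness of Hom(-, W) at \<open>Y\<close>, by comparison with a triangle K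
  \<rightarrow> W \<rightarrow> W for a zero object \<open>K\<close>. It is obtained by rotating
  back the triangle on the identity of \<open>W\<close> whose zero object is the shift of
  \<open>K\<close>.\<close>

lemma tri_extend:
  assumes t: "triangle C X Y Z f g h" and u: "mor u Y W" "u \<cdot> f = zr X W"
  obtains v where "mor v Z W" "u = v \<cdot> g"
proof -
  note m = triD[OF t]
  obtain K where K: "K \<in> Obj C" "idn K = zr K K" by (rule zero_obj_ex)
  have WO: "W \<in> Obj C" using u by auto
  define K' where "K' = ShO C K"
  have K': "K' \<in> Obj C" "idn K' = zr K' K'"
    using K ShO_zero_obj[OF K] unfolding K'_def by auto
  obtain k where k: "triangle C K W W k (idn W) (zr W K')"
    using tri_unrotate[OF tri_Ident[OF WO K'] K(1)] unfolding K'_def by blast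
  have k0: "k = zr K W" using triD(1)[OF k] from_zero[OF K(2)] by blast
  have "u \<cdot> f = k \<cdot> zr X K" using u m K WO unfolding k0 by simp
  with TR3_complete[OF t k, of "zr X K" u] m u K WO
  obtain c where "c \<in> Hom C Z W" "c \<cdot> g = idn W \<cdot> u"
    using Hom_eq[of X K "zr X K"] Hom_eq[of Y W u] by auto
  then have "mor c Z W" "u = c \<cdot> g" using m u WO Hom_eq[of Z W c] by auto
  with that show ?thesis by blast
qed

text \<open>Forgetting the morphisms removes all signs, while closure properties and vanishing
  arguments refer to the three objects only.\<close>

definition dtri :: "'a \<Rightarrow> 'a \<Rightarrow> 'a \<Rightarrow> bool" where
  "dtri X Y Z \<longleftrightarrow> (\<exists>f g h. triangle C X Y Z f g h)"

lemma dtri_Obj: "dtri X Y Z \<Longrightarrow> X \<in> Obj C \<and> Y \<in> Obj C \<and> Z \<in> Obj C"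
  unfolding dtri_def using triD by (metis mor_iff)

lemma dtri_rotate: "dtri X Y Z \<Longrightarrow> dtri Y Z (shift C 1 X)"
  unfolding dtri_def shift_1 using tri_rotate by blast

lemma dtri_unrotate: "dtri X Y Z \<Longrightarrow> dtri (shift C (- 1) Z) X Y"
  using tri_unrotate shift_minus1 dtri_Obj shift_Obj unfolding dtri_def by metis

text \<open>Three rotations shift a triangle by one; the signs they introduce are invisible to
  \<open>dtri\<close>.\<close>

lemma dtri_shift: "dtri X Y Z \<Longrightarrow> dtri (shift C n X) (shift C n Y) (shift C n Z)"
proof (induction n rule: int_induct[where k = 0])
  case base
  then show ?case by simp
next
  case (step1 i)
  then show ?case
    using dtri_rotate[OF dtri_rotate[OF dtri_rotate[OF step1(2)]]] dtri_Obj[of X Y Z]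
    by (simp add: ShO_shift)
next
  case (step2 i)
  then show ?case
    using dtri_unrotate[OF dtri_unrotate[OF dtri_unrotate[OF step2(2)]]] dtri_Obj[of X Y Z]
    by simp
qed

lemma dtri_octahedral:
  assumes "dtri X Y A" "dtri Y Z B"
  obtains D where "dtri X Z D" "dtri A D B"
proof -
  obtain f f1 f2 where f: "triangle C X Y A f f1 f2" using assms unfolding dtri_def by blast
  obtain g g1 g2 where g: "triangle C Y Z B g g1 g2" using assms unfolding dtri_def by blast
  have "mor (g \<cdot> f) X Z" using triD[OF f] triD[OF g] by simp
  then obtain D h1 h2 where h: "triangle C X Z D (g \<cdot> f) h1 h2"
    using TR1_cone[of X Z "g \<cdot> f"] unfolding mor_def by blast
  from TR4_octahedral[OF f g h] h that show ?thesis unfolding dtri_def by blast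
qed

lemma dtri_hom_zero_from:
  assumes "dtri X Y Z" "hom_zero C X W" "hom_zero C Z W" "W \<in> Obj C"
  shows "hom_zero C Y W"
proof (rule hom_zeroI)
  fix u assume u: "mor u Y W"
  obtain f g h where t: "triangle C X Y Z f g h" using assms unfolding dtri_def by blast
  note m = triD[OF t]
  have "u \<cdot> f = zr X W" using hom_zeroD[OF assms(2), of "u \<cdot> f"] u m by simp
  with tri_extend[OF t u] obtain v where v: "mor v Z W" "u = v \<cdot> g" by blast
  then show "u = zr Y W" using hom_zeroD[OF assms(3) v(1)] m by auto
qed (use assms dtri_Obj in auto)

lemma dtri_hom_zero_to:
  assumes "dtri X Y Z" "hom_zero C W X" "hom_zero C W Z" "W \<in> Obj C"
  shows "hom_zero C W Y"
proof (rule hom_zeroI)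
  fix u assume u: "mor u W Y"
  obtain f g h where t: "triangle C X Y Z f g h" using assms unfolding dtri_def by blast
  note m = triD[OF t]
  have "g \<cdot> u = zr W Z" using hom_zeroD[OF assms(3), of "g \<cdot> u"] u m by simp
  with tri_lift[OF t u] obtain v where v: "mor v W X" "u = f \<cdot> v" by blast
  then show "u = zr W Y" using hom_zeroD[OF assms(2) v(1)] m by auto
qed (use assms dtri_Obj in auto)

lemma cone_ex:
  assumes "mor f X Y"
  obtains Z g h where "triangle C X Y Z f g h"
  using TR1_cone assms unfolding mor_def by blast

lemma cocone_ex:
  assumes "mor g Y Z"
  obtains X f h where "triangle C X Y Z f g h"
proof -
  obtain W a b where t: "triangle C Y Z W g a b" using cone_ex assms by blast
  have W: "W \<in> Obj C" using triD[OF t] by auto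
  show ?thesis by (rule tri_unrotate[OF t shift_Obj[OF W] shift_minus1[OF W]]) (rule that)
qed

lemma retract_direct_sum:
  assumes i: "mor i X S" and p: "mor p S X" and pi: "p \<cdot> i = idn X"
  obtains Y where "direct_sum C X Y S"
proof -
  obtain Y g h where t: "triangle C X S Y i g h" using cone_ex[OF i] by blast
  note m = triD[OF t]
  have "ShM C p \<cdot> (ShM C i \<cdot> h) = zr Y (ShO C X)"
    using tri_comp_zero'(2)[OF t] p m by simp
  then have "ShM C (p \<cdot> i) \<cdot> h = zr Y (ShO C X)" using p m by simp
  \<comment> \<open>The composite of \<open>h\<close> with i[1] is zero, and i[1] has the left
    inverse p[1]. Once \<open>h\<close> vanishes, \<open>g\<close> has a section.\<close>
  then have h0: "h = zr Y (ShO C X)" unfolding pi using m by simp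
  obtain j0 where j0: "mor j0 Y S" "idn Y = g \<cdot> j0"
    using tri_lift[OF tri_rotate[OF t], of "idn Y" Y] h0 m by auto
  have gi: "g \<cdot> i = zr X Y" by (rule tri_comp_zero[OF t])
  \<comment> \<open>Subtracting its component along \<open>i\<close> from \<open>j0\<close> leaves a
    section of \<open>g\<close> and makes \<open>p\<close> annihilate it.\<close>
  define j where "j = j0 \<boxplus> neg (i \<cdot> (p \<cdot> j0))"
  have j: "mor j Y S" using j0 i p m unfolding j_def by simp
  have gj: "g \<cdot> j = idn Y"
    using j0 i p m Comp_reassoc[OF gi, of "p \<cdot> j0"] unfolding j_def by simp
  have pj: "p \<cdot> j = zr Y X"
    using j0 i p m Comp_reassoc[OF pi, of "p \<cdot> j0"] unfolding j_def by simp
  \<comment> \<open>\<open>e\<close> is the defect of the decomposition. It factors through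
    \<open>i\<close> because \<open>g\<close> kills it, and the factor is
    \<open>p \<cdot> e\<close>, which vanishes too.\<close>
  define e where "e = idn S \<boxplus> neg ((i \<cdot> p) \<boxplus> (j \<cdot> g))"
  have e: "mor e S S" using i p j m unfolding e_def by simp
  have "g \<cdot> ((i \<cdot> p) \<boxplus> (j \<cdot> g)) = g"
    using i p j m Comp_reassoc[OF gi, of p] Comp_reassoc[OF gj, of g] by simp
  then have "g \<cdot> e = zr S Y" using i p j m unfolding e_def by simp
  then obtain v where v: "mor v S X" "e = i \<cdot> v" using tri_lift[OF t e] by blast
  have "p \<cdot> ((i \<cdot> p) \<boxplus> (j \<cdot> g)) = p"
    using i p j m Comp_reassoc[OF pi, of p] Comp_reassoc[OF pj, of g] by simp
  then have "p \<cdot> e = zr S X" using i p j m unfolding e_def by simp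
  then have "v = zr S X" using v p i Comp_reassoc[OF pi, of v] by simp
  then have e0: "e = zr S S" using v i by simp
  have "idn S = (i \<cdot> p) \<boxplus> (j \<cdot> g)"
    by (rule eq_if_Plus_neg_Zero) (use i p j m e0 in \<open>simp_all add: e_def\<close>)
  note sum = this[symmetric]
  have g: "mor g S Y" by (rule m(2))
  have "direct_sum C X Y S"
    unfolding direct_sum_iff
    by (intro exI[of _ i] exI[of _ j] exI[of _ p] exI[of _ g] conjI i p j g pi gj gi pj sum)
  with that show ?thesis by blast
qed

end

section \<open>Thick subcategories\<close>

context triangulated_category
begin

definition thick_sub :: "'a set \<Rightarrow> bool" where
  "thick_sub D \<longleftrightarrow> triangulated_subcategory C D \<and> closed_under_summands C D"

lemma thick_sub_Obj: "\<lbrakk>thick_sub D; X \<in> D\<rbrakk> \<Longrightarrow> X \<in> Obj C"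
  unfolding thick_sub_def triangulated_subcategory_def by blast

lemma thick_sub_cone: "\<lbrakk>thick_sub D; dtri X Y Z; X \<in> D; Y \<in> D\<rbrakk> \<Longrightarrow> Z \<in> D"
  unfolding thick_sub_def triangulated_subcategory_def dtri_def by blast

lemma thick_sub_shift:
  assumes "thick_sub D" "X \<in> D" shows "shift C n X \<in> D"
proof -
  note O = thick_sub_Obj[OF assms]
  have s: "shift C 1 Y \<in> D" "shift C (- 1) Y \<in> D" if "Y \<in> D" for Y
    using assms that unfolding thick_sub_def triangulated_subcategory_def by blast+
  show ?thesis
  proof (induction n rule: int_induct[where k = 0])
    case base
    then show ?case using assms by simp
  next
    case (step1 i)
    then show ?case using s(1)[OF step1(2)] O by (simp add: ShO_shift)
  next
    case (step2 i)
    then show ?case using s(2)[OF step2(2)] O by simp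
  qed
qed

lemma thick_sub_middle: "\<lbrakk>thick_sub D; dtri X Y Z; X \<in> D; Z \<in> D\<rbrakk> \<Longrightarrow> Y \<in> D"
  using thick_sub_cone[OF _ dtri_unrotate] thick_sub_shift by blast

lemma thick_sub_cocone: "\<lbrakk>thick_sub D; dtri X Y Z; Y \<in> D; Z \<in> D\<rbrakk> \<Longrightarrow> X \<in> D"
  using thick_sub_middle[OF _ dtri_unrotate] thick_sub_shift by blast

lemma thick_sub_retract:
  assumes "thick_sub D" "mor i X S" "mor p S X" "p \<cdot> i = idn X" "S \<in> D"
  shows "X \<in> D"
proof -
  obtain Y where "direct_sum C X Y S" using retract_direct_sum[OF assms(2-4)] .
  with assms show ?thesis unfolding thick_sub_def closed_under_summands_def by blast
qed

lemma dtri_Ident: "\<lbrakk>X \<in> Obj C; K \<in> Obj C; idn K = zr K K\<rbrakk> \<Longrightarrow> dtri X X K"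
  unfolding dtri_def using tri_Ident by blast

lemma dtri_Ident': "\<lbrakk>X \<in> Obj C; K \<in> Obj C; idn K = zr K K\<rbrakk> \<Longrightarrow> dtri K X X"
proof -
  assume X: "X \<in> Obj C" and K: "K \<in> Obj C" "idn K = zr K K"
  have "dtri X X (ShO C K)" using dtri_Ident[OF X _ ShO_zero_obj[OF K]] K by simp
  from dtri_unrotate[OF this] show ?thesis using shift_shift[OF K(1), of "- 1" 1] by simp
qed

lemma thick_sub_zero:
  assumes "thick_sub D" "K \<in> Obj C" "idn K = zr K K"
  shows "K \<in> D"
proof -
  obtain X where "X \<in> D" using assms unfolding thick_sub_def triangulated_subcategory_def by blast
  with dtri_Ident[of X K] thick_sub_cone[of D X X K] thick_sub_Obj[of D X] assms show ?thesis by blast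
qed

lemma thick_subI:
  assumes "D \<subseteq> Obj C" "\<And>K. zero_object C K \<Longrightarrow> K \<in> D"
    "\<And>X. X \<in> D \<Longrightarrow> shift C 1 X \<in> D" "\<And>X. X \<in> D \<Longrightarrow> shift C (- 1) X \<in> D"
    "\<And>X Y Z. \<lbrakk>dtri X Y Z; X \<in> D; Y \<in> D\<rbrakk> \<Longrightarrow> Z \<in> D"
    "\<And>X S i p. \<lbrakk>S \<in> D; mor i X S; mor p S X; p \<cdot> i = idn X\<rbrakk> \<Longrightarrow> X \<in> D"
  shows "thick_sub D"
proof -
  have "D \<noteq> {}" using zero_object_exists assms(2) by blast
  moreover have "closed_under_summands C D"
    unfolding closed_under_summands_def direct_sum_iff using assms(6) by blast
  moreover have "\<forall>X\<in>D. shift C 1 X \<in> D \<and> shift C (- 1) X \<in> D" using assms(3,4) by blast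
  moreover have "\<forall>X Y Z f g h. triangle C X Y Z f g h \<and> X \<in> D \<and> Y \<in> D \<longrightarrow> Z \<in> D"
    using assms(5) unfolding dtri_def by blast
  ultimately show ?thesis
    unfolding thick_sub_def triangulated_subcategory_def using assms(1) by blast
qed

lemma thick_sub_Obj_set: "thick_sub (Obj C)"
proof (rule thick_subI)
  show "K \<in> Obj C" if "zero_object C K" for K using that unfolding zero_object_def by blast
qed (use dtri_Obj in auto)

lemma thick_eq: "thick C M = \<Inter>{D. M \<subseteq> D \<and> thick_sub D}"
  unfolding thick_def thick_sub_def by blast

lemma thick_subset: "M \<subseteq> thick C M"
  unfolding thick_eq by blast

lemma thick_least: "\<lbrakk>thick_sub D; M \<subseteq> D\<rbrakk> \<Longrightarrow> thick C M \<subseteq> D"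
  unfolding thick_eq by blast

lemma thick_sub_thick:
  assumes "M \<subseteq> Obj C" shows "thick_sub (thick C M)"
proof (rule thick_subI)
  show "thick C M \<subseteq> Obj C" using thick_least[OF thick_sub_Obj_set assms] .
  show "K \<in> thick C M" if "zero_object C K" for K
    using thick_sub_zero that unfolding thick_eq zero_object_iff by blast
  show "shift C 1 X \<in> thick C M" "shift C (- 1) X \<in> thick C M" if "X \<in> thick C M" for X
    using that thick_sub_shift unfolding thick_eq by blast+
  show "Z \<in> thick C M" if "dtri X Y Z" "X \<in> thick C M" "Y \<in> thick C M" for X Y Z
    using that thick_sub_cone unfolding thick_eq by blast
  show "X \<in> thick C M" if "S \<in> thick C M" "mor i X S" "mor p S X" "p \<cdot> i = idn X" for X S i p
    using that(1) thick_sub_retract[OF _ that(2-4)] unfolding thick_eq by blast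
qed

text \<open>If \<open>0 : W \<rightarrow> B\<close> has its cone in \<open>D\<close>, then \<open>W[1]\<close> is a retract of that cone.\<close>

lemma thick_sub_zero_cone:
  assumes D: "thick_sub D" and t: "triangle C W B E (zr W B) g h" and E: "E \<in> D"
  shows "W \<in> D"
proof -
  note m = triD[OF t]
  have W: "W \<in> Obj C" using m by auto
  have "neg (ShM C (zr W B)) \<cdot> idn (ShO C W) = zr (ShO C W) (ShO C B)" using m W by simp
  then obtain k where k: "mor k (ShO C W) E" "idn (ShO C W) = h \<cdot> k"
    using tri_lift[OF tri_rotate[OF tri_rotate[OF t]], of "idn (ShO C W)" "ShO C W"] W by auto
  have "shift C 1 W \<in> D" using thick_sub_retract[OF D k(1) m(3) k(2)[symmetric] E] by simp
  then have "shift C (- 1) (shift C 1 W) \<in> D" by (rule thick_sub_shift[OF D])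
  then show ?thesis using shift_shift[OF W, of "- 1" 1] by simp
qed

text \<open>If a morphism whose cone lies in \<open>D\<close> factors through an object of \<open>D\<close>, then it vanishes in
  the quotient by \<open>D\<close>, although it is invertible there; so its target lies in \<open>D\<close>.\<close>

lemma thick_sub_factor:
  assumes D: "thick_sub D" and s: "triangle C W X A (g \<cdot> k) s1 s2" "A \<in> D"
    and k: "mor k W V" and g: "mor g V X" and V: "V \<in> D"
  shows "X \<in> D"
proof -
  obtain B m n where t: "triangle C V X B g m n" using cone_ex[OF g] .
  note mm = triD[OF t]
  have "m \<cdot> g = zr V B" by (rule tri_comp_zero[OF t])
  then have z: "m \<cdot> (g \<cdot> k) = zr W B" using Comp_reassoc[of m g "zr V B" k] mm k by simp
  obtain E e1 e2 where e: "triangle C W B E (zr W B) e1 e2"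
    using cone_ex[of "zr W B" W B] mm k by auto
  have "\<exists>a b. triangle C A E (ShO C V) a b (ShM C s1 \<cdot> neg (ShM C g))"
    using TR4_octahedral[OF s(1) tri_rotate[OF t] e[folded z]] by blast
  then have "dtri A E (ShO C V)" unfolding dtri_def by blast
  moreover have "ShO C V \<in> D" using thick_sub_shift[OF D V, of 1] by simp
  ultimately have "E \<in> D" using thick_sub_middle[OF D] s(2) by blast
  then have "W \<in> D" by (rule thick_sub_zero_cone[OF D e])
  then show ?thesis using thick_sub_middle[OF D] s unfolding dtri_def by blast
qed

end

section \<open>Approximation by a presilting subcategory\<close>

locale presilting_reduction = triangulated_category +
  fixes P
  assumes presilting: "presilting C P"
    and P_add: "P = add_closure C P"
    and P1: "condP1 C P"
    and P2: "condP2 C P"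
begin

text \<open>\<open>lp 0\<close> and \<open>rp 0\<close> describe \<open>\<^sup>\<bottom>P[>0]\<close> and \<open>P[<0]\<^sup>\<bottom>\<close>; the index is what the truncations induct on.\<close>

definition lp :: "int \<Rightarrow> 'a \<Rightarrow> bool" where
  "lp n X \<longleftrightarrow> X \<in> Obj C \<and> (\<forall>l>n. \<forall>Q\<in>P. hom_zero C X (shift C l Q))"

definition rp :: "int \<Rightarrow> 'a \<Rightarrow> bool" where
  "rp n X \<longleftrightarrow> X \<in> Obj C \<and> (\<forall>l>n. \<forall>Q\<in>P. hom_zero C Q (shift C l X))"

abbreviation N :: "'a set" where "N \<equiv> thick C P"

section \<open>Perpendicular classes and their shifts\<close>

lemma P_Obj: "Q \<in> P \<Longrightarrow> Q \<in> Obj C"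
  using presilting unfolding presilting_def by blast

lemma P_Hom: "\<lbrakk>Q \<in> P; Q' \<in> P; 0 < i\<rbrakk> \<Longrightarrow> hom_zero C Q (shift C i Q')"
  using presilting unfolding presilting_def by blast

text \<open>The point at which \<open>P = add_closure C P\<close> enters: a retract splits off as a
  summand by \<open>retract_direct_sum\<close>.\<close>

lemma P_retract:
  assumes "mor i X S" "mor p S X" "p \<cdot> i = idn X" "S \<in> P"
  shows "X \<in> P"
proof -
  obtain Y where "direct_sum C X Y S" using retract_direct_sum[OF assms(1-3)] .
  with assms(4) have "X \<in> add_closure C P"
    using P_add unfolding add_closure_def closed_under_summands_def by blast
  then show ?thesis using P_add by simp
qed

lemma thick_N: "thick_sub N"
  using thick_sub_thick P_Obj by blast

lemma P_N: "Q \<in> P \<Longrightarrow> Q \<in> N"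
  using thick_subset by blast

lemma lp_Obj: "lp n X \<Longrightarrow> X \<in> Obj C" and rp_Obj: "rp n X \<Longrightarrow> X \<in> Obj C"
  unfolding lp_def rp_def by auto

lemma lpD: "\<lbrakk>lp n X; n < l; Q \<in> P\<rbrakk> \<Longrightarrow> hom_zero C X (shift C l Q)"
  unfolding lp_def by blast

lemma rpD: "\<lbrakk>rp n X; n < l; Q \<in> P\<rbrakk> \<Longrightarrow> hom_zero C Q (shift C l X)"
  unfolding rp_def by blast

lemma rp_mono: "\<lbrakk>rp n X; n \<le> m\<rbrakk> \<Longrightarrow> rp m X"
  unfolding rp_def by auto

lemma lp_shift: "X \<in> Obj C \<Longrightarrow> lp n (shift C m X) \<longleftrightarrow> lp (n - m) X"
proof -
  assume X: "X \<in> Obj C"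
  have "hom_zero C (shift C m X) (shift C l Q) \<longleftrightarrow> hom_zero C X (shift C (l - m) Q)" if "Q \<in> P" for l Q
    using hom_zero_shift_iff[OF X P_Obj[OF that]] .
  then show ?thesis unfolding lp_def using X
    by (auto simp: less_diff_eq diff_less_eq)
qed

lemma rp_shift: "X \<in> Obj C \<Longrightarrow> rp n (shift C m X) \<longleftrightarrow> rp (n + m) X"
proof -
  assume X: "X \<in> Obj C"
  have "rp n (shift C m X) \<longleftrightarrow> (\<forall>l>n. \<forall>Q\<in>P. hom_zero C Q (shift C (l + m) X))"
    unfolding rp_def using X by simp
  also have "\<dots> \<longleftrightarrow> (\<forall>l>n + m. \<forall>Q\<in>P. hom_zero C Q (shift C l X))"
    by (metis add_less_cancel_right diff_add_cancel)
  finally show ?thesis unfolding rp_def using X by simp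
qed

lemma lp_perp: "lp 0 X \<Longrightarrow> X \<in> left_perp_pos C P"
  unfolding lp_def left_perp_pos_def by blast

lemma rp_perp:
  assumes "rp 0 X" shows "X \<in> right_perp_neg C P"
proof -
  have X: "X \<in> Obj C" using rp_Obj assms by blast
  have "hom_zero C (shift C i Q) X" if "i < 0" "Q \<in> P" for i Q
    using hom_zero_shift_iff[OF P_Obj[OF that(2)] X, of i 0] rpD[OF assms, of "- i"] that by simp
  with X show ?thesis unfolding right_perp_neg_def by blast
qed

lemma P_lp: "Q \<in> P \<Longrightarrow> lp 0 Q" and P_rp: "Q \<in> P \<Longrightarrow> rp 0 Q"
  unfolding lp_def rp_def using P_Obj P_Hom by auto

text \<open>\<open>E\<close> is the cone of an approximation. A morphism E \<rightarrow> Q'[l] with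
  l > 0 vanishes on \<open>Q\<close> since \<open>P\<close> is presilting, so it comes from V[1],
  that is, from a morphism V \<rightarrow> Q'[l-1].\<close>

lemma left_approx:
  assumes "lp 0 V"
  obtains Q E where "Q \<in> P" "dtri V Q E" "lp 0 E"
proof -
  have V: "V \<in> Obj C" using lp_Obj[OF assms] .
  from P1 lp_perp[OF assms] obtain Q f where Q: "Q \<in> P" and f: "f \<in> Hom C V Q"
    and ap: "\<And>Q'. Q' \<in> P \<Longrightarrow> (\<lambda>g. g \<cdot> f) ` Hom C Q Q' = Hom C V Q'"
    unfolding condP1_def covariantly_finite_def by blast
  have QO: "Q \<in> Obj C" using P_Obj Q by blast
  have mf: "mor f V Q" using Hom_eq[OF V QO] f by blast
  obtain E g h where t: "triangle C V Q E f g h" using cone_ex[OF mf] .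
  note m = triD[OF t]
  have E: "E \<in> Obj C" using m by auto
  have "hom_zero C E (shift C l Q')" if l: "0 < l" "Q' \<in> P" for l Q'
  proof (rule hom_zeroI)
    have Q': "Q' \<in> Obj C" using P_Obj l by blast
    let ?R = "shift C l Q'"
    fix u assume u: "mor u E ?R"
    have "u \<cdot> g = zr Q ?R" using hom_zeroD[OF P_Hom[OF Q l(2,1)], of "u \<cdot> g"] u m by simp
    with tri_extend[OF tri_rotate[OF t] u] obtain v where v: "mor v (ShO C V) ?R" "u = v \<cdot> h" by blast
    have R: "?R = ShO C (shift C (l - 1) Q')" using ShO_shift[OF Q', of "l - 1"] by simp
    have "mor v (ShO C V) (ShO C (shift C (l - 1) Q'))" using v R by simp
    then obtain w where w: "mor w V (shift C (l - 1) Q')" "v = ShM C w"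
      using ShM_surj[of v V "shift C (l - 1) Q'"] V Q' shift_Obj by blast
    show "u = zr E ?R"
    proof (cases "l = 1")
      \<comment> \<open>In degree 1 the desuspended morphism extends along \<open>f\<close> by the
        approximation property, and consecutive maps of the triangle compose to zero. In the other
        case l - 1 > 0, and \<open>lp 0 V\<close> applies.\<close>
      case True
      then have "w \<in> Hom C V Q'" using w Hom_eq[OF V Q'] by simp
      then obtain x where x: "x \<in> Hom C Q Q'" "w = x \<cdot> f" using ap[OF l(2)] by blast
      then have mx: "mor x Q Q'" using Hom_eq[OF QO Q'] by blast
      have "u = ShM C x \<cdot> (ShM C f \<cdot> h)" using v w x mx m by simp
      then show ?thesis unfolding tri_comp_zero'(2)[OF t] using mx E True by simp
    next
      case False
      then have "w = zr V (shift C (l - 1) Q')"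
        using hom_zeroD[OF lpD[OF assms _ l(2)] w(1)] l(1) by simp
      then have "v = zr (ShO C V) ?R" using w V Q' R by simp
      then show ?thesis using v m Q' by simp
    qed
  qed (use E P_Obj l in auto)
  then have "lp 0 E" unfolding lp_def using E by blast
  with that Q t show ?thesis unfolding dtri_def by blast
qed

text \<open>Dual to \<open>left_approx\<close>, with the cocone. Degree 1 uses the approximation;
  for l > 1 the object E[l] is an extension of Q[l] by Y[l-1], neither of which receives nonzero
  morphisms from \<open>P\<close>.\<close>

lemma right_approx:
  assumes "rp 0 Y"
  obtains Q E where "Q \<in> P" "dtri E Q Y" "rp 0 E"
proof -
  have Y: "Y \<in> Obj C" using rp_Obj[OF assms] .
  from P1 rp_perp[OF assms] obtain Q g where Q: "Q \<in> P" and g: "g \<in> Hom C Q Y"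
    and ap: "\<And>Q'. Q' \<in> P \<Longrightarrow> (\<lambda>k. g \<cdot> k) ` Hom C Q' Q = Hom C Q' Y"
    unfolding condP1_def contravariantly_finite_def by blast
  have QO: "Q \<in> Obj C" using P_Obj Q by blast
  have mg: "mor g Q Y" using Hom_eq[OF QO Y] g by blast
  obtain E f h where t: "triangle C E Q Y f g h" using cocone_ex[OF mg] .
  note m = triD[OF t]
  have E: "E \<in> Obj C" using m by auto
  have d: "dtri Y (shift C 1 E) (shift C 1 Q)"
    using t dtri_rotate[OF dtri_rotate] unfolding dtri_def by blast
  have "hom_zero C Q' (shift C l E)" if l: "0 < l" "Q' \<in> P" for l Q'
  proof (cases "l = 1")
    case True
    show ?thesis
    proof (rule hom_zeroI)
      have Q': "Q' \<in> Obj C" using P_Obj l by blast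
      fix u assume u: "mor u Q' (shift C l E)"
      then have u': "mor u Q' (ShO C E)" using True by simp
      have "neg (ShM C f) \<cdot> u = zr Q' (ShO C Q)"
        using hom_zeroD[OF P_Hom[OF l(2) Q, of 1], of "neg (ShM C f) \<cdot> u"] u' m by simp
      with tri_lift[OF tri_rotate[OF tri_rotate[OF t]] u']
      obtain w where w: "mor w Q' Y" "u = h \<cdot> w" by blast
      then obtain x where x: "x \<in> Hom C Q' Q" "w = g \<cdot> x" using ap[OF l(2)] Hom_eq[OF Q' Y] by blast
      then have mx: "mor x Q' Q" using Hom_eq[OF Q' QO] by blast
      show "u = zr Q' (shift C l E)"
        using w x mx m True Comp_reassoc[OF tri_comp_zero'(1)[OF t], of x] by simp
    qed (use E P_Obj l in auto)
  next
    case False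
    have "dtri (shift C (l - 1) Y) (shift C l E) (shift C l Q)"
      using dtri_shift[OF d, of "l - 1"] Y E QO by simp
    then show ?thesis
      using dtri_hom_zero_to rpD[OF assms _ l(2), of "l - 1"] P_Hom[OF l(2) Q l(1)] False l P_Obj by simp
  qed
  then have "rp 0 E" unfolding rp_def using E by blast
  with that Q t show ?thesis unfolding dtri_def by blast
qed

text \<open>Each step removes the highest degree in which \<open>X\<close> may still map to shifts
  of \<open>P\<close>. The part split off is some Q[n] with n > 0, to which objects of
  \<open>lp 0\<close> have no nonzero morphisms, and the octahedral axiom stacks these parts into
  \<open>A\<close>.\<close>

lemma left_truncation:
  assumes "lp (int k) X"
  shows "\<exists>X' A. dtri X' X A \<and> lp 0 X' \<and> A \<in> N \<and> (\<forall>W. lp 0 W \<longrightarrow> hom_zero C W A)"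
  using assms
proof (induction k arbitrary: X)
  case 0
  obtain K where K: "K \<in> Obj C" "idn K = zr K K" by (rule zero_obj_ex)
  have "hom_zero C W K" if "lp 0 W" for W
    by (rule hom_zeroI[OF lp_Obj[OF that] K(1) into_zero[OF K(2)]])
  moreover have "dtri X X K" using dtri_Ident[OF _ K] lp_Obj[OF 0] by blast
  moreover have "K \<in> N" using thick_sub_zero[OF thick_N K] .
  moreover have "lp 0 X" using 0 by simp
  ultimately show ?case by blast
next
  case (Suc k)
  define n where "n = int (Suc k)"
  have X: "X \<in> Obj C" using lp_Obj Suc by blast
  \<comment> \<open>Approximations are available on \<open>lp 0\<close>, so the critical degree n =
    k + 1 is shifted to 0. The cocone E[n-1] of X \<rightarrow> Q[n] then satisfies
    \<open>lp\<close> with bound k.\<close>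
  have "lp 0 (shift C (- n) X)" using Suc(2) lp_shift[OF X, of 0 "- n"] unfolding n_def by (simp add: add.commute)
  then obtain Q E where Q: "Q \<in> P" "dtri (shift C (- n) X) Q E" "lp 0 E" by (rule left_approx)
  have E: "E \<in> Obj C" using lp_Obj Q by blast
  have "dtri X (shift C n Q) (shift C n E)" using dtri_shift[OF Q(2), of n] X by simp
  from dtri_unrotate[OF this] have d: "dtri (shift C (n - 1) E) X (shift C n Q)"
    using E by simp
  have "lp (int k) (shift C (n - 1) E)" using lp_shift[OF E, of "int k" "n - 1"] Q(3) unfolding n_def by simp
  from Suc(1)[OF this] obtain X' A where A: "dtri X' (shift C (n - 1) E) A" "lp 0 X'" "A \<in> N"
    "\<And>W. lp 0 W \<Longrightarrow> hom_zero C W A" by blast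
  from dtri_octahedral[OF A(1) d] obtain B where B: "dtri X' X B" "dtri A B (shift C n Q)" .
  have "B \<in> N" using thick_sub_middle[OF thick_N B(2) A(3)] thick_sub_shift[OF thick_N P_N[OF Q(1)]] by blast
  moreover have "hom_zero C W B" if "lp 0 W" for W
    using dtri_hom_zero_to[OF B(2) A(4)[OF that] lpD[OF that _ Q(1)] lp_Obj[OF that]] unfolding n_def by simp
  ultimately show ?case using B A by blast
qed

lemma right_truncation:
  assumes "rp (int k) X"
  shows "\<exists>X' A. dtri A X X' \<and> rp 0 X' \<and> A \<in> N \<and> (\<forall>W. rp 0 W \<longrightarrow> hom_zero C A W)"
  using assms
proof (induction k arbitrary: X)
  case 0
  obtain K where K: "K \<in> Obj C" "idn K = zr K K" by (rule zero_obj_ex)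
  have "hom_zero C K W" if "rp 0 W" for W
    by (rule hom_zeroI[OF K(1) rp_Obj[OF that] from_zero[OF K(2)]])
  moreover have "dtri K X X" using dtri_Ident'[OF _ K] rp_Obj[OF 0] by blast
  moreover have "K \<in> N" using thick_sub_zero[OF thick_N K] .
  moreover have "rp 0 X" using 0 by simp
  ultimately show ?case by blast
next
  case (Suc k)
  define n where "n = int (Suc k)"
  have X: "X \<in> Obj C" using rp_Obj Suc by blast
  have "rp 0 (shift C n X)" using Suc(2) rp_shift[OF X, of 0 n] unfolding n_def by simp
  then obtain Q E where Q: "Q \<in> P" "dtri E Q (shift C n X)" "rp 0 E" by (rule right_approx)
  have E: "E \<in> Obj C" and QO: "Q \<in> Obj C" using rp_Obj Q P_Obj by blast+
  have "dtri (shift C (- n) E) (shift C (- n) Q) X" using dtri_shift[OF Q(2), of "- n"] X by simp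
  from dtri_rotate[OF dtri_rotate[OF this]]
  have d: "dtri X (shift C (1 - n) E) (shift C (1 - n) Q)" using E QO by (simp add: ShO_shift)
  have "rp (int k) (shift C (1 - n) E)" using rp_shift[OF E, of "int k" "1 - n"] Q(3) unfolding n_def by simp
  from Suc(1)[OF this] obtain X' A where A: "dtri A (shift C (1 - n) E) X'" "rp 0 X'" "A \<in> N"
    "\<And>W. rp 0 W \<Longrightarrow> hom_zero C A W" by blast
  \<comment> \<open>The octahedral axiom speaks of cones, while here a cocone is wanted. So the
    composite X \<rightarrow> E[1-n] \<rightarrow> X' is formed, and its cone \<open>B\<close> is
    desuspended to give the part that is split off.\<close>
  from dtri_octahedral[OF d dtri_rotate[OF A(1)]] obtain B where
    B: "dtri X X' B" "dtri (shift C (1 - n) Q) B (shift C 1 A)" .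
  define B' where "B' = shift C (- 1) B"
  have AO: "A \<in> Obj C" and BO: "B \<in> Obj C" using dtri_Obj A B by blast+
  have B': "dtri B' X X'" using dtri_unrotate[OF B(1)] unfolding B'_def .
  have B'': "dtri (shift C (- n) Q) B' A" using dtri_shift[OF B(2), of "- 1"] QO AO BO unfolding B'_def by simp
  have "B' \<in> N" using thick_sub_middle[OF thick_N B''] A(3) thick_sub_shift[OF thick_N P_N[OF Q(1)]] by blast
  moreover have "hom_zero C B' W" if "rp 0 W" for W
  proof (rule dtri_hom_zero_from[OF B'' _ A(4)[OF that] rp_Obj[OF that]])
    show "hom_zero C (shift C (- n) Q) W"
      using hom_zero_shift_iff[OF QO rp_Obj[OF that], of "- n" 0] rpD[OF that _ Q(1), of n]
      unfolding n_def by (simp add: add.commute)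
  qed
  ultimately show ?case using B' A by blast
qed

section \<open>Truncations of arbitrary objects and the structure of \<open>N\<close>\<close>

lemma left_part:
  assumes "X \<in> Obj C"
  obtains X' A where "dtri X' X A" "lp 0 X'" "A \<in> N" "\<And>W. lp 0 W \<Longrightarrow> hom_zero C W A"
proof -
  obtain n where "\<forall>l\<ge>n. \<forall>Q\<in>P. hom_zero C X (shift C l Q)" using P2 assms unfolding condP2_def by blast
  then have "lp (int (nat n)) X" unfolding lp_def using assms by auto
  from left_truncation[OF this] that show ?thesis by blast
qed

lemma right_part:
  assumes "X \<in> Obj C"
  obtains X' A where "dtri A X X'" "rp 0 X'" "A \<in> N" "\<And>W. rp 0 W \<Longrightarrow> hom_zero C A W"
proof -
  obtain n where "\<forall>l\<ge>n. \<forall>Q\<in>P. hom_zero C Q (shift C l X)" using P2 assms unfolding condP2_def by blast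
  then have "rp (int (nat n)) X" unfolding rp_def using assms by auto
  from right_truncation[OF this] that show ?thesis by blast
qed

text \<open>The second truncation keeps what the first one achieved. A morphism from A[1] to Q[l] is
  one from \<open>A\<close> to Q[l-1], and Q[l-1] lies in \<open>rp 0\<close> as soon as l \<ge>
  1.\<close>

lemma lp_right_part:
  assumes X: "lp 0 X" and t: "dtri A X X'" and A: "\<And>W. rp 0 W \<Longrightarrow> hom_zero C A W"
  shows "lp 0 X'"
proof -
  have O: "A \<in> Obj C" "X' \<in> Obj C" using dtri_Obj[OF t] by auto
  have "hom_zero C X' (shift C l Q)" if l: "0 < l" "Q \<in> P" for l Q
  proof (rule dtri_hom_zero_from[OF dtri_rotate[OF t] lpD[OF X l]])
    have "rp 0 (shift C (l - 1) Q)"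
      using rp_shift[OF P_Obj[OF l(2)], of 0 "l - 1"] rp_mono[OF P_rp[OF l(2)], of "l - 1"] l by simp
    then show "hom_zero C (shift C 1 A) (shift C l Q)"
      using A hom_zero_shift_iff[OF O(1) P_Obj[OF l(2)], of 1 l] by blast
  qed (use P_Obj l in auto)
  then show ?thesis unfolding lp_def using O by blast
qed

text \<open>The bound may depend on \<open>D\<close> but not on \<open>E\<close>: a descending
  induction in which \<open>E\<close> changes at every step requires this uniformity.\<close>

definition bounded :: "'a set" where
  "bounded = {D \<in> Obj C. \<exists>k. \<forall>j\<ge>k. \<forall>E. lp 0 E \<longrightarrow> hom_zero C E (shift C j D)}"

lemma thick_sub_bounded: "thick_sub bounded"
proof (rule thick_subI)
  show "bounded \<subseteq> Obj C" unfolding bounded_def by blast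
  show "K \<in> bounded" if "zero_object C K" for K
  proof -
    have K: "K \<in> Obj C" using that zero_object_iff by blast
    have "hom_zero C E (shift C j K)" if E: "E \<in> Obj C" for E j
      using hom_zero_shift_iff[OF _ K, of "shift C (- j) E" j j] shift_Obj[OF E] E \<open>zero_object C K\<close>
      unfolding zero_object_def by simp
    then show ?thesis unfolding bounded_def using K lp_Obj by blast
  qed
  have s: "shift C n D \<in> bounded" if D: "D \<in> bounded" for n D
  proof -
    obtain k where k: "\<forall>j\<ge>k. \<forall>E. lp 0 E \<longrightarrow> hom_zero C E (shift C j D)" and O: "D \<in> Obj C"
      using D unfolding bounded_def by blast
    have "\<forall>j\<ge>k - n. \<forall>E. lp 0 E \<longrightarrow> hom_zero C E (shift C j (shift C n D))"
      using k O by (simp add: algebra_simps)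
    then show ?thesis unfolding bounded_def using O shift_Obj by blast
  qed
  then show "shift C 1 D \<in> bounded" "shift C (- 1) D \<in> bounded" if "D \<in> bounded" for D using that by blast+
  show "Z \<in> bounded" if t: "dtri X Y Z" and b: "X \<in> bounded" "Y \<in> bounded" for X Y Z
  proof -
    have O: "X \<in> Obj C" "Y \<in> Obj C" "Z \<in> Obj C" using dtri_Obj[OF t] by auto
    obtain k where k: "\<And>j E. \<lbrakk>j \<ge> k; lp 0 E\<rbrakk> \<Longrightarrow> hom_zero C E (shift C j Y)"
      using b(2) unfolding bounded_def by blast
    have "shift C 1 X \<in> bounded" using s b by blast
    then obtain k' where k': "\<And>j E. \<lbrakk>j \<ge> k'; lp 0 E\<rbrakk> \<Longrightarrow> hom_zero C E (shift C j (shift C 1 X))"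
      unfolding bounded_def by blast
    have "hom_zero C E (shift C j Z)" if "j \<ge> max k k'" "lp 0 E" for j E
      using dtri_hom_zero_to[OF dtri_shift[OF dtri_rotate[OF t]]] k k' that lp_Obj by auto
    then show ?thesis unfolding bounded_def using O by blast
  qed
  show "X \<in> bounded" if S: "S \<in> bounded" and i: "mor i X S" and p: "mor p S X" and pi: "p \<cdot> i = idn X" for X S i p
  proof -
    have O: "X \<in> Obj C" "S \<in> Obj C" using i by auto
    obtain k where k: "\<And>j E. \<lbrakk>j \<ge> k; lp 0 E\<rbrakk> \<Longrightarrow> hom_zero C E (shift C j S)"
      using S unfolding bounded_def by blast
    have "hom_zero C E (shift C j X)" if "j \<ge> k" "lp 0 E" for j E
    proof -
      \<comment> \<open>\<open>shift\<close> acts on objects only, so instead of shifting the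
        retraction \<open>i\<close>, \<open>p\<close> the test object \<open>E\<close> is moved back
        by j.\<close>
      define F where "F = shift C (- j) E"
      have E: "E = shift C j F" "F \<in> Obj C" "E \<in> Obj C" using lp_Obj[OF that(2)] unfolding F_def by auto
      have "hom_zero C F S" using k[OF that] hom_zero_shift[OF E(2) O(2), of j] E(1) by simp
      then have "hom_zero C F X"
      proof (intro hom_zeroI)
        fix u assume z: "hom_zero C F S" and u: "mor u F X"
        have "u = (p \<cdot> i) \<cdot> u" using u pi by simp
        also have "\<dots> = p \<cdot> (i \<cdot> u)" using u p i by (intro Comp_assoc') auto
        also have "i \<cdot> u = zr F S" using hom_zeroD[OF z, of "i \<cdot> u"] u i by simp
        finally show "u = zr F X" using p E by simp
      qed (use E O in auto)
      then show ?thesis using hom_zero_shift[OF E(2) O(1), of j] E(1) by simp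
    qed
    then show ?thesis unfolding bounded_def using O by blast
  qed
qed

text \<open>Boundedness replaces the description of \<open>N\<close> by iterated extensions of shifts of \<open>P\<close>, which would
  require closing those extensions under summands.\<close>

lemma N_bounded: "N \<subseteq> bounded"
proof (rule thick_least[OF thick_sub_bounded])
  have "\<forall>j\<ge>1. \<forall>E. lp 0 E \<longrightarrow> hom_zero C E (shift C j Q)" if "Q \<in> P" for Q
    using lpD that by simp
  then show "P \<subseteq> bounded" unfolding bounded_def using P_Obj by blast
qed

text \<open>By boundedness and descending induction along left approximations, no morphism \<open>E \<rightarrow> D[1]\<close> with
  \<open>lp 0 E\<close> is nonzero; so the left approximation of \<open>D\<close> splits.\<close>

lemma N_perp_in_P:
  assumes D: "D \<in> N" "lp 0 D" "rp 0 D"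
  shows "D \<in> P"
proof -
  have DO: "D \<in> Obj C" using lp_Obj D by blast
  obtain k where k: "\<And>j E. \<lbrakk>j \<ge> k; lp 0 E\<rbrakk> \<Longrightarrow> hom_zero C E (shift C j D)"
    using D(1) N_bounded unfolding bounded_def by blast
  \<comment> \<open>In the triangle E \<rightarrow> Q \<rightarrow> E2 given by an approximation,
    Hom(E, D[j]) lies between Hom(Q, D[j]), zero because D is in \<open>rp 0\<close> and j \<ge> 1,
    and Hom(E2, D[j+1]), zero by assumption.\<close>
  have down: "hom_zero C E (shift C j D)"
    if h: "\<And>E. lp 0 E \<Longrightarrow> hom_zero C E (shift C (j + 1) D)" and j: "1 \<le> j" and E: "lp 0 E" for j E
  proof -
    obtain Q E2 where Q: "Q \<in> P" "dtri E Q E2" "lp 0 E2" by (rule left_approx[OF E])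
    have "hom_zero C (shift C (- 1) E2) (shift C j D)"
      using hom_zero_shift_iff[OF lp_Obj[OF Q(3)] DO, of "- 1" j] h[OF Q(3)] by simp
    then show ?thesis
      using dtri_hom_zero_from[OF dtri_unrotate[OF Q(2)] _ rpD[OF D(3) _ Q(1)]] j DO by simp
  qed
  \<comment> \<open>The induction descends from max 1 k, where boundedness applies, to 1, the lowest
    degree that \<open>down\<close> delivers.\<close>
  have all: "hom_zero C E (shift C (max 1 k - int n) D)" if "int n \<le> max 1 k - 1" "lp 0 E" for n E
    using that
  proof (induction n arbitrary: E)
    case 0
    then show ?case using k by simp
  next
    case (Suc n)
    have "max 1 k - int (Suc n) + 1 = max 1 k - int n" by simp
    then show ?case using down[of "max 1 k - int (Suc n)"] Suc by (simp add: algebra_simps)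
  qed
  have one: "hom_zero C E (shift C 1 D)" if "lp 0 E" for E
  proof -
    have "int (nat (max 1 k - 1)) = max 1 k - 1" by simp
    then show ?thesis using all[of "nat (max 1 k - 1)" E] that by (simp only:) simp
  qed
  obtain Q E where Q: "Q \<in> P" "dtri D Q E" "lp 0 E" by (rule left_approx[OF D(2)])
  then obtain f g h where t: "triangle C D Q E f g h" unfolding dtri_def by blast
  note m = triD[OF t]
  have EO: "E \<in> Obj C" using m by auto
  obtain e where e: "triangle C (shift C (- 1) E) D Q e f g" "h = neg (ShM C e)"
    using tri_unrotate[OF t shift_Obj[OF EO] shift_minus1[OF EO]] .
  note me = triD[OF e(1)]
  have "hom_zero C (shift C (- 1) E) D"
    using one[OF Q(3)] hom_zero_shift_iff[OF EO DO, of "- 1" 0] by simp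
  \<comment> \<open>The connecting morphism into \<open>D\<close> vanishes, so the identity of
    \<open>D\<close> extends along \<open>f\<close>, and \<open>D\<close> is a retract of
    \<open>Q\<close>.\<close>
  then have "e = zr (shift C (- 1) E) D" using hom_zeroD me(1) by blast
  then have "idn D \<cdot> e = zr (shift C (- 1) E) D" using DO EO by simp
  then obtain r where "mor r Q D" "idn D = r \<cdot> f"
    using tri_extend[OF e(1), of "idn D" D] DO by auto
  then show ?thesis using P_retract[of f D Q r] Q(1) m by simp
qed

text \<open>\<open>Q\<close> arises from an object of \<open>N\<close> by both truncations, so it
  lies in \<open>N\<close>, in \<open>lp 0\<close> and in \<open>rp 0\<close>, hence in
  \<open>P\<close> by \<open>N_perp_in_P\<close>.\<close>

lemma N_filtration:
  assumes "X \<in> N"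
  obtains A X' B Q where "dtri X' X A" "A \<in> N" "X' \<in> N" "\<And>W. lp 0 W \<Longrightarrow> hom_zero C W A"
    "dtri B X' Q" "Q \<in> P" "\<And>W. rp 0 W \<Longrightarrow> hom_zero C B W"
proof -
  have X: "X \<in> Obj C" using thick_sub_Obj[OF thick_N assms] .
  obtain X' A where A: "dtri X' X A" "lp 0 X'" "A \<in> N" "\<And>W. lp 0 W \<Longrightarrow> hom_zero C W A"
    using left_part[OF X] by blast
  have X': "X' \<in> N" using thick_sub_cocone[OF thick_N A(1) assms A(3)] .
  obtain Q B where B: "dtri B X' Q" "rp 0 Q" "B \<in> N" "\<And>W. rp 0 W \<Longrightarrow> hom_zero C B W"
    using right_part[OF lp_Obj[OF A(2)]] by blast
  have "Q \<in> N" using thick_sub_cone[OF thick_N B(1) B(3) X'] .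
  moreover have "lp 0 Q" using lp_right_part[OF A(2) B(1) B(4)] .
  ultimately have "Q \<in> P" using N_perp_in_P B(2) by blast
  with that A B X' show ?thesis by blast
qed

text \<open>The morphism into \<open>A\<close> dies in the outer layer and so lifts to the inner
  part; the morphism out of \<open>A\<close> is zero on the innermost layer and so descends to the
  layer in \<open>P\<close>.\<close>

lemma factor_N_P:
  assumes X: "lp 0 X" and Y: "rp 0 Y" and A: "A \<in> N" and a: "mor a X A" and b: "mor b A Y"
  obtains Q a' b' where "Q \<in> P" "mor a' X Q" "mor b' Q Y" "b \<cdot> a = b' \<cdot> a'"
proof -
  obtain A2 A1 B Q where t: "dtri A1 A A2" "\<And>W. lp 0 W \<Longrightarrow> hom_zero C W A2"
    "dtri B A1 Q" "Q \<in> P" "\<And>W. rp 0 W \<Longrightarrow> hom_zero C B W"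
    using N_filtration[OF A] by metis
  obtain f g h where f: "triangle C A1 A A2 f g h" using t unfolding dtri_def by blast
  obtain f' g' h' where f': "triangle C B A1 Q f' g' h'" using t unfolding dtri_def by blast
  note m = triD[OF f] triD[OF f']
  have "g \<cdot> a = zr X A2" using hom_zeroD[OF t(2)[OF X], of "g \<cdot> a"] a m by simp
  then obtain v where v: "mor v X A1" "a = f \<cdot> v" using tri_lift[OF f a] by blast
  have bf: "mor (b \<cdot> f) A1 Y" using b m by simp
  have "(b \<cdot> f) \<cdot> f' = zr B Y" using hom_zeroD[OF t(5)[OF Y], of "(b \<cdot> f) \<cdot> f'"] b m by simp
  then obtain w where w: "mor w Q Y" "b \<cdot> f = w \<cdot> g'" using tri_extend[OF f' bf] by blast
  have "b \<cdot> a = w \<cdot> (g' \<cdot> v)" using Comp_reassoc[OF w(2), of v] v w b m by simp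
  then show ?thesis using that[of Q "g' \<cdot> v" w] t(4) v w m by simp
qed

end

section \<open>The Verdier quotient is preadditive\<close>

locale verdier_quotient = triangulated_category +
  fixes S
  assumes thick_S: "thick_sub S"
begin

section \<open>Denominators and the Ore conditions\<close>

definition den :: "'b \<Rightarrow> bool" where
  "den s \<longleftrightarrow> (\<exists>X Y Z g h. triangle C X Y Z s g h \<and> Z \<in> S)"

lemma denI: "\<lbrakk>triangle C X Y Z s g h; Z \<in> S\<rbrakk> \<Longrightarrow> den s"
  unfolding den_def by blast

lemma den_arr [simp]: "den s \<Longrightarrow> arr s"
  unfolding den_def using triD(1) by auto

lemma den_cone:
  assumes "den s" "mor s X Y"
  obtains Z g h where "triangle C X Y Z s g h" "Z \<in> S"
proof -
  obtain X' Y' Z g h where t: "triangle C X' Y' Z s g h" "Z \<in> S" using assms unfolding den_def by blast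
  then show ?thesis using that mor_unique[OF assms(2) triD(1)[OF t(1)]] by blast
qed

lemma denominators_iff: "s \<in> denominators C S X Y \<longleftrightarrow> mor s X Y \<and> den s"
proof
  assume "s \<in> denominators C S X Y"
  then show "mor s X Y \<and> den s" unfolding denominators_def den_def using triD(1) by blast
next
  assume "mor s X Y \<and> den s"
  then have d: "den s" and m: "mor s X Y" by blast+
  obtain Z g h where "triangle C X Y Z s g h" "Z \<in> S" using den_cone[OF d m] .
  then show "s \<in> denominators C S X Y" unfolding denominators_def by blast
qed

lemma den_Ident [simp]: "X \<in> Obj C \<Longrightarrow> den (idn X)"
proof -
  assume X: "X \<in> Obj C"
  obtain K where K: "K \<in> Obj C" "idn K = zr K K" by (rule zero_obj_ex)
  show ?thesis using denI[OF tri_Ident[OF X K] thick_sub_zero[OF thick_S K]] .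
qed

lemma den_Comp [simp]:
  assumes "den s" "den t" "tgt s = src t"
  shows "den (t \<cdot> s)"
proof -
  have m: "mor s (src s) (src t)" "mor t (src t) (tgt t)" using assms by auto
  obtain A a a' where s: "triangle C (src s) (src t) A s a a'" "A \<in> S" using den_cone[OF assms(1) m(1)] .
  obtain B b b' where t: "triangle C (src t) (tgt t) B t b b'" "B \<in> S" using den_cone[OF assms(2) m(2)] .
  obtain D d d' where r: "triangle C (src s) (tgt t) D (t \<cdot> s) d d'" using cone_ex[OF mor_Comp[OF m]] .
  from TR4_octahedral[OF s(1) t(1) r] have "dtri A D B" unfolding dtri_def by blast
  then have "D \<in> S" using thick_sub_middle[OF thick_S] s t by blast
  then show ?thesis using denI r by blast
qed

text \<open>The octahedral axiom puts the cones of \<open>s\<close>, \<open>t \<cdot> s\<close> and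
  \<open>t\<close>, in this order, into one triangle.\<close>

lemma den_right_factor:
  assumes "den (t \<cdot> s)" "den t" "arr s" "tgt s = src t"
  shows "den s"
proof -
  have m: "mor s (src s) (src t)" "mor t (src t) (tgt t)" using assms by auto
  obtain B b b' where t: "triangle C (src t) (tgt t) B t b b'" "B \<in> S" using den_cone[OF assms(2) m(2)] .
  obtain D d d' where r: "triangle C (src s) (tgt t) D (t \<cdot> s) d d'" "D \<in> S"
    using den_cone[OF assms(1) mor_Comp[OF m]] .
  obtain A a a' where s: "triangle C (src s) (src t) A s a a'" using cone_ex[OF m(1)] .
  from TR4_octahedral[OF s t(1) r(1)] have "dtri A D B" unfolding dtri_def by blast
  then have "A \<in> S" using thick_sub_cocone[OF thick_S] r t by blast
  then show ?thesis using denI s by blast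
qed

lemma den_ShM:
  assumes "den s" shows "den (ShM C s)"
proof -
  have m: "mor s (src s) (tgt s)" using assms by simp
  obtain Z g h where t: "triangle C (src s) (tgt s) Z s g h" "Z \<in> S" using den_cone[OF assms m] .
  note mm = triD[OF t(1)]
  have Z: "Z \<in> Obj C" using mm by auto
  let ?X = "ShO C (src s)" and ?Y = "ShO C (tgt s)" and ?Z = "ShO C Z"
  have r: "triangle C ?X ?Y ?Z (neg (ShM C s)) (neg (ShM C g)) (neg (ShM C h))"
    using tri_rotate[OF tri_rotate[OF tri_rotate[OF t(1)]]] .
  have i1: "is_iso C ?X ?X (neg (idn ?X))"
    unfolding is_iso_iff[OF ShO_Obj[OF arr_Obj(1)[OF den_arr[OF assms]]] ShO_Obj[OF arr_Obj(1)[OF den_arr[OF assms]]]]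
    using assms by (auto intro!: exI[of _ "neg (idn ?X)"])
  have i2: "is_iso C W W (idn W)" if "W \<in> Obj C" for W
    unfolding is_iso_iff[OF that that] using that by (auto intro!: exI[of _ "idn W"])
  have mm': "mor (neg (ShM C s)) ?X ?Y" "mor (ShM C s) ?X ?Y" "mor (neg (ShM C g)) ?Y ?Z"
    "mor (neg (ShM C h)) ?Z (ShO C ?X)" "mor (ShM C h) ?Z (ShO C ?X)"
    using mm Z by auto
  \<comment> \<open>The triple rotation gives three minus signs. Changing the first object by -1
    cancels two of them and frees the shifted denominator from its sign.\<close>
  have "triangle_isomorphic C ?X ?Y ?Z (neg (ShM C s)) (neg (ShM C g)) (neg (ShM C h))
      ?X ?Y ?Z (ShM C s) (neg (ShM C g)) (ShM C h)"
    unfolding triangle_isomorphic_def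
    using i1 i2 mm mm' Z assms
    by (intro conjI candI exI[of _ "neg (idn ?X)"] exI[of _ "idn ?Y"] exI[of _ "idn ?Z"]) auto
  from TR1_iso[OF r this] have "triangle C ?X ?Y ?Z (ShM C s) (neg (ShM C g)) (ShM C h)" .
  moreover have "?Z \<in> S" using thick_sub_shift[OF thick_S t(2), of 1] by simp
  ultimately show ?thesis by (rule denI)
qed

text \<open>Take \<open>W\<close> to be the cocone of X \<rightarrow> Y \<rightarrow> A, where
  \<open>A\<close> is the cone of \<open>t\<close>. Then \<open>t'\<close> has the same cone
  \<open>A\<close>, and \<open>f \<cdot> t'\<close> lifts through \<open>t\<close> because it dies
  in \<open>A\<close>.\<close>

lemma ore:
  assumes f: "mor f X Y" and t: "mor t Z Y" "den t"
  obtains W t' f' where "mor t' W X" "den t'" "mor f' W Z" "f \<cdot> t' = t \<cdot> f'"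
proof -
  obtain A g h where tr: "triangle C Z Y A t g h" "A \<in> S" using den_cone[OF t(2,1)] .
  note m = triD[OF tr(1)]
  have "mor (g \<cdot> f) X A" using f m by simp
  then obtain W t' k where t': "triangle C W X A t' (g \<cdot> f) k" using cocone_ex by blast
  note m' = triD[OF t']
  have ft: "mor (f \<cdot> t') W Y" using f m' by simp
  have "g \<cdot> (f \<cdot> t') = zr W A" using tri_comp_zero[OF t'] f m m' by simp
  then obtain f' where "mor f' W Z" "f \<cdot> t' = t \<cdot> f'" using tri_lift[OF tr(1) ft] by blast
  then show ?thesis using that[OF m'(1)] denI[OF t' tr(2)] by blast
qed

text \<open>The difference of \<open>f\<close> and \<open>g\<close> is killed by \<open>t\<close>,
  hence factors through A[-1] with \<open>A\<close> the cone of \<open>t\<close>. The cocone of the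
  factor X \<rightarrow> A[-1] supplies \<open>z\<close>.\<close>

lemma cancel:
  assumes f: "mor f X Y" "mor g X Y" and t: "mor t Y Z" "den t" and e: "t \<cdot> f = t \<cdot> g"
  obtains W z where "mor z W X" "den z" "f \<cdot> z = g \<cdot> z"
proof -
  obtain A a b where tr: "triangle C Y Z A t a b" "A \<in> S" using den_cone[OF t(2,1)] .
  have A: "A \<in> Obj C" using thick_sub_Obj[OF thick_S tr(2)] .
  define A' where "A' = shift C (- 1) A"
  have A': "A' \<in> Obj C" "A' \<in> S" using A thick_sub_shift[OF thick_S tr(2)] unfolding A'_def by auto
  obtain k where k: "triangle C A' Y Z k t a"
    using tri_unrotate[OF tr(1) shift_Obj[OF A] shift_minus1[OF A]] unfolding A'_def by blast
  note m = triD[OF k]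
  define d where "d = f \<boxplus> neg g"
  have d: "mor d X Y" using f unfolding d_def by simp
  have "t \<cdot> d = zr X Z" using f t e unfolding d_def by simp
  then obtain v where v: "mor v X A'" "d = k \<cdot> v" using tri_lift[OF k d] by blast
  obtain W z w where z: "triangle C W X A' z v w" using cocone_ex[OF v(1)] .
  note m' = triD[OF z]
  have "d \<cdot> z = zr W Y" using v m m' tri_comp_zero[OF z] by simp
  then have "(f \<cdot> z) \<boxplus> neg (g \<cdot> z) = zr W Y" using f m' unfolding d_def by simp
  then have "f \<cdot> z = g \<cdot> z" using eq_if_Plus_neg_Zero[of "f \<cdot> z" "g \<cdot> z"] f m' by simp
  then show ?thesis using that[OF m'(1)] denI[OF z A'(2)] by blast
qed

lemma ore_den:
  assumes s: "mor s X Y" "den s" and t: "mor t Z Y" "den t"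
  obtains W a b where "mor a W X" "den a" "mor b W Z" "den b" "s \<cdot> a = t \<cdot> b"
proof -
  obtain W a b where w: "mor a W X" "den a" "mor b W Z" "s \<cdot> a = t \<cdot> b"
    using ore[OF s(1) t] .
  have "den (t \<cdot> b)" using w s by (simp flip: w(4))
  then have "den b" using den_right_factor[of t b] t w by simp
  with w that show ?thesis by blast
qed

section \<open>Roofs and their equivalence\<close>

definition roof :: "'b \<Rightarrow> 'b \<Rightarrow> 'a \<Rightarrow> 'a \<Rightarrow> 'a \<Rightarrow> bool" where
  "roof s f Z X Y \<longleftrightarrow> mor s Z X \<and> den s \<and> mor f Z Y"

lemma roofD: "roof s f Z X Y \<Longrightarrow> mor s Z X" "roof s f Z X Y \<Longrightarrow> den s" "roof s f Z X Y \<Longrightarrow> mor f Z Y"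
  unfolding roof_def by auto

lemma roofs_iff: "(s, f) \<in> roofs C S X Y \<longleftrightarrow> (\<exists>Z. roof s f Z X Y)"
proof
  assume "(s, f) \<in> roofs C S X Y"
  then show "\<exists>Z. roof s f Z X Y"
    unfolding roofs_def denominators_iff roof_def mor_def by blast
next
  assume "\<exists>Z. roof s f Z X Y"
  then show "(s, f) \<in> roofs C S X Y"
    unfolding roofs_def denominators_iff roof_def by (auto simp del: mor_iff simp: mor_def)
qed

definition rel :: "'b \<Rightarrow> 'b \<Rightarrow> 'b \<Rightarrow> 'b \<Rightarrow> bool" where
  "rel s f s' f' \<longleftrightarrow> (\<exists>X Y Z Z' W a b. roof s f Z X Y \<and> roof s' f' Z' X Y \<and>
     mor a W Z \<and> mor b W Z' \<and> s \<cdot> a = s' \<cdot> b \<and> f \<cdot> a = f' \<cdot> b \<and> den (s \<cdot> a))"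

lemma roof_rel_iff: "((s, f), (s', f')) \<in> roof_rel C S \<longleftrightarrow> rel s f s' f'"
proof
  assume "((s, f), (s', f')) \<in> roof_rel C S"
  then obtain X Y Z Z' W a b where O: "X \<in> Obj C" "Y \<in> Obj C" "Z \<in> Obj C" "Z' \<in> Obj C" "W \<in> Obj C"
    and h: "mor s Z X \<and> den s" "f \<in> Hom C Z Y" "mor s' Z' X \<and> den s'" "f' \<in> Hom C Z' Y"
      "a \<in> Hom C W Z" "b \<in> Hom C W Z'" "s \<cdot> a = s' \<cdot> b" "f \<cdot> a = f' \<cdot> b" "den (s \<cdot> a)"
    unfolding roof_rel_def denominators_iff by blast
  have "roof s f Z X Y" "roof s' f' Z' X Y" "mor a W Z" "mor b W Z'"
    unfolding roof_def using O h(1-6) by (simp_all only: Hom_eq)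
  with h(7-9) show "rel s f s' f'" unfolding rel_def by blast
next
  assume "rel s f s' f'"
  then obtain X Y Z Z' W a b where r: "roof s f Z X Y" "roof s' f' Z' X Y"
     "mor a W Z" "mor b W Z'" "s \<cdot> a = s' \<cdot> b" "f \<cdot> a = f' \<cdot> b" "den (s \<cdot> a)"
    unfolding rel_def by blast
  have O: "X \<in> Obj C" "Y \<in> Obj C" "Z \<in> Obj C" "Z' \<in> Obj C" "W \<in> Obj C"
    using r roofD[OF r(1)] roofD[OF r(2)] by auto
  have "s \<in> denominators C S Z X" "f \<in> Hom C Z Y" "s' \<in> denominators C S Z' X" "f' \<in> Hom C Z' Y"
    "a \<in> Hom C W Z" "b \<in> Hom C W Z'" "s \<cdot> a \<in> denominators C S W X"
    using r roofD[OF r(1)] roofD[OF r(2)] O by (simp_all only: denominators_iff Hom_eq) (simp_all add: mor_Comp)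
  then show "((s, f), (s', f')) \<in> roof_rel C S"
    unfolding roof_rel_def using O r(5,6) by blast
qed

lemma relI:
  assumes "roof s f Z X Y" "roof s' f' Z' X Y" "mor a W Z" "mor b W Z'"
    "s \<cdot> a = s' \<cdot> b" "f \<cdot> a = f' \<cdot> b" "den (s \<cdot> a)"
  shows "rel s f s' f'"
  using assms unfolding rel_def by blast

lemma relE:
  assumes "rel s f s' f'" "roof s f Z X Y"
  obtains Z' W a b where "roof s' f' Z' X Y"
     "mor a W Z" "mor b W Z'" "s \<cdot> a = s' \<cdot> b" "f \<cdot> a = f' \<cdot> b" "den (s \<cdot> a)"
proof -
  obtain X' Y' Z0 Z' W a b where r: "roof s f Z0 X' Y'" "roof s' f' Z' X' Y'"
     "mor a W Z0" "mor b W Z'" "s \<cdot> a = s' \<cdot> b" "f \<cdot> a = f' \<cdot> b" "den (s \<cdot> a)"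
    using assms unfolding rel_def by blast
  have "Z0 = Z" "X' = X" "Y' = Y" using roofD[OF r(1)] roofD[OF assms(2)] by auto
  with r that show ?thesis by blast
qed

lemma rel_refl: "roof s f Z X Y \<Longrightarrow> rel s f s f"
  using roofD[of s f Z X Y] by (intro relI[where a = "idn Z" and b = "idn Z"]) auto

lemma rel_sym: "rel s f s' f' \<Longrightarrow> rel s' f' s f"
  unfolding rel_def by metis

text \<open>An Ore square over \<open>X\<close> joins the two refinements. The resulting morphisms
  to the middle apex \<open>Z'\<close> agree after composition with \<open>s'\<close>, so
  \<open>cancel\<close> refines once more to make them equal.\<close>

lemma rel_trans:
  assumes "rel s f s' f'" "rel s' f' s'' f''"
  shows "rel s f s'' f''"
proof -
  obtain X Y Z where r: "roof s f Z X Y" using assms(1) unfolding rel_def by blast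
  obtain Z' W a b where r': "roof s' f' Z' X Y" and ab: "mor a W Z" "mor b W Z'"
    "s \<cdot> a = s' \<cdot> b" "f \<cdot> a = f' \<cdot> b" "den (s \<cdot> a)" using relE[OF assms(1) r] .
  obtain Z'' W' c d where r'': "roof s'' f'' Z'' X Y" and cd: "mor c W' Z'" "mor d W' Z''"
    "s' \<cdot> c = s'' \<cdot> d" "f' \<cdot> c = f'' \<cdot> d" "den (s' \<cdot> c)" using relE[OF assms(2) r'] .
  note m = roofD[OF r] roofD[OF r'] roofD[OF r''] ab(1,2) cd(1,2)
  have sc: "mor (s \<cdot> a) W X" "mor (s' \<cdot> c) W' X" using m by auto
  obtain V x y where xy: "mor x V W" "den x" "mor y V W'" "den y" "(s \<cdot> a) \<cdot> x = (s' \<cdot> c) \<cdot> y"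
    using ore_den[OF sc(1) ab(5) sc(2) cd(5)] .
  have e: "s' \<cdot> (b \<cdot> x) = s' \<cdot> (c \<cdot> y)"
    using xy m Comp_reassoc[OF ab(3)[symmetric], of x] by simp
  have bc: "mor (b \<cdot> x) V Z'" "mor (c \<cdot> y) V Z'" using m xy(1-4) by auto
  obtain V' z where z: "mor z V' V" "den z" "(b \<cdot> x) \<cdot> z = (c \<cdot> y) \<cdot> z"
    using cancel[OF bc roofD(1,2)[OF r'] e] .
  have bcz: "b \<cdot> (x \<cdot> z) = c \<cdot> (y \<cdot> z)" using z m xy by simp
  show ?thesis
  proof (rule relI[OF r r'', of "a \<cdot> (x \<cdot> z)" V' "d \<cdot> (y \<cdot> z)"])
    have "s \<cdot> (a \<cdot> (x \<cdot> z)) = s' \<cdot> (b \<cdot> (x \<cdot> z))"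
      using Comp_reassoc[OF ab(3), of "x \<cdot> z"] m xy z by simp
    also have "\<dots> = s'' \<cdot> (d \<cdot> (y \<cdot> z))"
      unfolding bcz using Comp_reassoc[OF cd(3), of "y \<cdot> z"] m xy z by simp
    finally show "s \<cdot> (a \<cdot> (x \<cdot> z)) = s'' \<cdot> (d \<cdot> (y \<cdot> z))" .
    have "f \<cdot> (a \<cdot> (x \<cdot> z)) = f' \<cdot> (b \<cdot> (x \<cdot> z))"
      using Comp_reassoc[OF ab(4), of "x \<cdot> z"] m xy z by simp
    also have "\<dots> = f'' \<cdot> (d \<cdot> (y \<cdot> z))"
      unfolding bcz using Comp_reassoc[OF cd(4), of "y \<cdot> z"] m xy z by simp
    finally show "f \<cdot> (a \<cdot> (x \<cdot> z)) = f'' \<cdot> (d \<cdot> (y \<cdot> z))" .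
    have "den ((s \<cdot> a) \<cdot> (x \<cdot> z))"
      by (rule den_Comp[OF _ ab(5)]) (use m xy(1-4) z(1,2) in auto)
    then show "den (s \<cdot> (a \<cdot> (x \<cdot> z)))" using m xy(1-4) z(1,2) by simp
  qed (use m xy z in auto)
qed

definition frac :: "'b \<Rightarrow> 'b \<Rightarrow> ('b \<times> 'b) set" where
  "frac s f = roof_class C S (s, f)"

lemma frac_mem: "(s', f') \<in> frac s f \<longleftrightarrow> rel s f s' f'"
  unfolding frac_def roof_class_def using roof_rel_iff by blast

lemma frac_eqI: "rel s f s' f' \<Longrightarrow> frac s f = frac s' f'"
proof -
  assume e: "rel s f s' f'"
  have "rel s f t g \<longleftrightarrow> rel s' f' t g" for t g
    using rel_trans[OF e] rel_trans[OF rel_sym[OF e]] by blast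
  then have "p \<in> frac s f \<longleftrightarrow> p \<in> frac s' f'" for p
    using frac_mem by (cases p) simp
  then show ?thesis by blast
qed

lemma frac_eq_iff:
  assumes "roof s f Z X Y"
  shows "frac s f = frac s' f' \<longleftrightarrow> rel s f s' f'"
proof
  assume "frac s f = frac s' f'"
  then have "rel s' f' s f" using frac_mem[of s f s f] frac_mem[of s f s' f'] rel_refl[OF assms] by simp
  then show "rel s f s' f'" by (rule rel_sym)
qed (rule frac_eqI)

lemma roof_expand:
  assumes "roof s f Z X Y" "mor a W Z" "den a"
  shows "roof (s \<cdot> a) (f \<cdot> a) W X Y" "frac (s \<cdot> a) (f \<cdot> a) = frac s f"
proof -
  note m = roofD[OF assms(1)]
  show r: "roof (s \<cdot> a) (f \<cdot> a) W X Y" unfolding roof_def using m assms by simp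
  show "frac (s \<cdot> a) (f \<cdot> a) = frac s f"
    by (rule frac_eqI, rule relI[OF r assms(1), of "idn W" W a]) (use m assms in auto)
qed

section \<open>Operations on fractions\<close>

abbreviation U where "U \<equiv> triangle_quotient C S"

lemma U_sel:
  "Obj U = Obj C" "Hom U X Y = roofs C S X Y // roof_rel C S"
  "Ident U X = frac (idn X) (idn X)" "Zero U X Y = frac (idn X) (zr X Y)" "ShO U = ShO C"
  "Comp U \<beta> \<alpha> = \<Union>{roof_class C S (s \<cdot> t', g \<cdot> f') |s f t g t' f'.
                (s, f) \<in> \<alpha> \<and> (t, g) \<in> \<beta> \<and> ore_square C S f t t' f'}"
  "Plus U \<alpha> \<gamma> = \<Union>{roof_class C S (s, f \<boxplus> g) |s f g. (s, f) \<in> \<alpha> \<and> (s, g) \<in> \<gamma>}"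
  "ShM U \<alpha> = \<Union>{roof_class C S (ShM C s, ShM C f) |s f. (s, f) \<in> \<alpha>}"
  "Tri U = quotient_triangles C S"
  by (simp_all add: triangle_quotient_def quotient_shifted_def shifted.extend_def
      triangulated.fields_def frac_def)

lemma U_Hom_iff: "\<alpha> \<in> Hom U X Y \<longleftrightarrow> (\<exists>s f Z. roof s f Z X Y \<and> \<alpha> = frac s f)"
proof -
  have "\<alpha> \<in> Hom U X Y \<longleftrightarrow> (\<exists>s f. (s, f) \<in> roofs C S X Y \<and> \<alpha> = frac s f)"
    unfolding U_sel quotient_def frac_def roof_class_def by auto
  then show ?thesis unfolding roofs_iff by blast
qed

lemma U_HomE:
  assumes "\<alpha> \<in> Hom U X Y"
  obtains s f Z where "roof s f Z X Y" "\<alpha> = frac s f"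
  using assms unfolding U_Hom_iff by blast

lemma frac_Hom: "roof s f Z X Y \<Longrightarrow> frac s f \<in> Hom U X Y"
  unfolding U_Hom_iff by blast

lemma roof_Obj: "roof s f Z X Y \<Longrightarrow> X \<in> Obj C \<and> Y \<in> Obj C \<and> Z \<in> Obj C"
  using roofD by (metis mor_iff)

lemma Union_const: "\<lbrakk>x \<in> A; \<And>y. y \<in> A \<Longrightarrow> y = x\<rbrakk> \<Longrightarrow> \<Union>A = x"
  by blast

text \<open>Covers at once the expansion of both roofs and a change of the Ore square.
  Well-definedness then follows because equivalent roofs have a common expansion.\<close>

lemma comp_expand:
  assumes r: "roof s f Z X Y" and q: "roof t g V Y Y'"
    and o: "mor t1 R Z" "den t1" "mor f1 R V" "f \<cdot> t1 = t \<cdot> f1"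
    and a: "mor a Z' Z" "den a" and c: "mor c V' V" "den c"
    and o': "mor t2 R' Z'" "den t2" "mor f2 R' V'" "(f \<cdot> a) \<cdot> t2 = (t \<cdot> c) \<cdot> f2"
  shows "rel (s \<cdot> t1) (g \<cdot> f1) ((s \<cdot> a) \<cdot> t2) ((g \<cdot> c) \<cdot> f2)"
proof -
  note m = roofD[OF r] roofD[OF q] o(1-3) a c o'(1-3)
  have at: "mor (a \<cdot> t2) R' Z" "den (a \<cdot> t2)" using m by auto
  obtain W x y where xy: "mor x W R" "den x" "mor y W R'" "den y" "t1 \<cdot> x = (a \<cdot> t2) \<cdot> y"
    using ore_den[OF o(1,2) at] .
  have e1: "t1 \<cdot> x = a \<cdot> (t2 \<cdot> y)" using xy m by simp
  have "t \<cdot> (f1 \<cdot> x) = f \<cdot> (t1 \<cdot> x)"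
    using Comp_reassoc[OF o(4)[symmetric], of x] m xy(1-4) by simp
  also have "\<dots> = ((f \<cdot> a) \<cdot> t2) \<cdot> y" unfolding e1 using m xy(1-4) by simp
  also have "\<dots> = t \<cdot> (c \<cdot> (f2 \<cdot> y))" unfolding o'(4) using m xy(1-4) by simp
  finally have e: "t \<cdot> (f1 \<cdot> x) = t \<cdot> (c \<cdot> (f2 \<cdot> y))" .
  have fc: "mor (f1 \<cdot> x) W V" "mor (c \<cdot> (f2 \<cdot> y)) W V" using m xy(1-4) by auto
  obtain W' z where z: "mor z W' W" "den z" "(f1 \<cdot> x) \<cdot> z = (c \<cdot> (f2 \<cdot> y)) \<cdot> z"
    using cancel[OF fc roofD(1,2)[OF q] e] .
  have e2: "f1 \<cdot> (x \<cdot> z) = c \<cdot> (f2 \<cdot> (y \<cdot> z))" using z m xy(1-4) by simp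
  have e3: "t1 \<cdot> (x \<cdot> z) = a \<cdot> (t2 \<cdot> (y \<cdot> z))"
    using Comp_reassoc[OF e1, of z] m xy(1-4) z(1,2) by simp
  have r1: "roof (s \<cdot> t1) (g \<cdot> f1) R X Y'" "roof ((s \<cdot> a) \<cdot> t2) ((g \<cdot> c) \<cdot> f2) R' X Y'"
    unfolding roof_def using m by auto
  show ?thesis
  proof (rule relI[OF r1, of "x \<cdot> z" W' "y \<cdot> z"])
    show "(s \<cdot> t1) \<cdot> (x \<cdot> z) = ((s \<cdot> a) \<cdot> t2) \<cdot> (y \<cdot> z)"
      using m xy(1-4) z(1,2) e3 by simp
    show "(g \<cdot> f1) \<cdot> (x \<cdot> z) = ((g \<cdot> c) \<cdot> f2) \<cdot> (y \<cdot> z)"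
      using m xy(1-4) z(1,2) e2 by simp
    show "den ((s \<cdot> t1) \<cdot> (x \<cdot> z))" using m xy(1-4) z(1,2) by (intro den_Comp) auto
  qed (use xy z in auto)
qed

text \<open>\<open>rel\<close> demands that \<open>s \<cdot> a\<close> be a denominator; cancelling
  \<open>s\<close> and \<open>s'\<close> by \<open>den_right_factor\<close> yields the same for
  \<open>a\<close> and \<open>b\<close>.\<close>

lemma rel_common_expansion:
  assumes "rel s f s' f'" "roof s f Z X Y"
  obtains Z' W a b where "roof s' f' Z' X Y" "mor a W Z" "den a" "mor b W Z'" "den b"
    "s \<cdot> a = s' \<cdot> b" "f \<cdot> a = f' \<cdot> b"
proof -
  obtain Z' W a b where r: "roof s' f' Z' X Y"
     "mor a W Z" "mor b W Z'" "s \<cdot> a = s' \<cdot> b" "f \<cdot> a = f' \<cdot> b" "den (s \<cdot> a)"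
    using relE[OF assms] .
  have "den a" "den b" using den_right_factor[of s a] den_right_factor[of s' b] r(6) r(6)[unfolded r(4)]
      roofD[OF r(1)] roofD[OF assms(2)] r(2,3) by auto
  with that r show ?thesis by blast
qed

lemma comp_well_defined:
  assumes r: "roof s f Z X Y" "roof t g V Y Y'"
    and o: "mor t1 R Z" "den t1" "mor f1 R V" "f \<cdot> t1 = t \<cdot> f1"
    and e: "rel s f s' f'" "rel t g t' g'"
    and r': "roof s' f' Z' X Y" "roof t' g' V' Y Y'"
    and o': "mor t1' R' Z'" "den t1'" "mor f1' R' V'" "f' \<cdot> t1' = t' \<cdot> f1'"
  shows "rel (s \<cdot> t1) (g \<cdot> f1) (s' \<cdot> t1') (g' \<cdot> f1')"
proof -
  obtain Z1 W a b where ab0: "roof s' f' Z1 X Y" "mor a W Z" "den a" "mor b W Z1" "den b"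
    "s \<cdot> a = s' \<cdot> b" "f \<cdot> a = f' \<cdot> b" using rel_common_expansion[OF e(1) r(1)] .
  have "Z1 = Z'" using roofD(1)[OF ab0(1)] roofD(1)[OF r'(1)] by simp
  note ab = ab0(2-7)[unfolded this]
  obtain V1 W' c d where cd0: "roof t' g' V1 Y Y'" "mor c W' V" "den c" "mor d W' V1" "den d"
    "t \<cdot> c = t' \<cdot> d" "g \<cdot> c = g' \<cdot> d" using rel_common_expansion[OF e(2) r(2)] .
  have "V1 = V'" using roofD(1)[OF cd0(1)] roofD(1)[OF r'(2)] by simp
  note cd = cd0(2-7)[unfolded this]
  have "mor (f \<cdot> a) W Y" "mor (t \<cdot> c) W' Y" "den (t \<cdot> c)"
    using roofD[OF r(1)] roofD[OF r(2)] ab(1-4) cd(1-4) by auto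
  then obtain Q t2 f2 where o2: "mor t2 Q W" "den t2" "mor f2 Q W'" "(f \<cdot> a) \<cdot> t2 = (t \<cdot> c) \<cdot> f2"
    by (rule ore)
  have "rel (s \<cdot> t1) (g \<cdot> f1) ((s \<cdot> a) \<cdot> t2) ((g \<cdot> c) \<cdot> f2)"
    by (rule comp_expand[OF r o ab(1,2) cd(1,2) o2])
  moreover have "rel (s' \<cdot> t1') (g' \<cdot> f1') ((s' \<cdot> b) \<cdot> t2) ((g' \<cdot> d) \<cdot> f2)"
    by (rule comp_expand[OF r' o' ab(3,4) cd(3,4) o2(1-3)])
      (use o2(4) in \<open>simp only: ab(6) cd(5)\<close>)
  ultimately show ?thesis using rel_trans rel_sym unfolding ab(5) cd(6) by blast
qed

lemma ore_square_iff:
  assumes "roof s f Z X Y" "roof t g V Y Y'"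
  shows "ore_square C S f t t1 f1 \<longleftrightarrow>
    (\<exists>R. mor t1 R Z \<and> den t1 \<and> mor f1 R V \<and> f \<cdot> t1 = t \<cdot> f1)"
proof
  assume "ore_square C S f t t1 f1"
  then obtain W Z' V' Y0 where o: "W \<in> Obj C" "Z' \<in> Obj C" "V' \<in> Obj C" "Y0 \<in> Obj C"
    "f \<in> Hom C Z' Y0" "mor t V' Y0" "mor t1 W Z'" "den t1" "f1 \<in> Hom C W V'" "f \<cdot> t1 = t \<cdot> f1"
    unfolding ore_square_def denominators_iff by blast
  then have "mor f Z' Y0" "mor f1 W V'" unfolding mor_def by auto
  then have "Z' = Z" "V' = V" using roofD[OF assms(1)] roofD[OF assms(2)] o(6) by auto
  with o \<open>mor f1 W V'\<close> show "\<exists>R. mor t1 R Z \<and> den t1 \<and> mor f1 R V \<and> f \<cdot> t1 = t \<cdot> f1" by blast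
next
  assume "\<exists>R. mor t1 R Z \<and> den t1 \<and> mor f1 R V \<and> f \<cdot> t1 = t \<cdot> f1"
  then obtain R where o: "mor t1 R Z" "den t1" "mor f1 R V" "f \<cdot> t1 = t \<cdot> f1" by blast
  have "f \<in> Hom C Z Y" "t \<in> denominators C S V Y" "t1 \<in> denominators C S R Z" "f1 \<in> Hom C R V"
    using roofD[OF assms(1)] roofD[OF assms(2)] o by (simp_all add: denominators_iff Hom_eq)
  moreover have "R \<in> Obj C" "Z \<in> Obj C" "V \<in> Obj C" "Y \<in> Obj C"
    using roof_Obj[OF assms(1)] roof_Obj[OF assms(2)] o by auto
  ultimately show "ore_square C S f t t1 f1" unfolding ore_square_def using o(4) by blast
qed

text \<open>The union defining \<open>Comp\<close> runs over classes that all coincide, so one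
  choice of representatives and of an Ore square computes it.\<close>

lemma frac_Comp:
  assumes r: "roof s f Z X Y" "roof t g V Y Y'"
    and o: "mor t1 R Z" "den t1" "mor f1 R V" "f \<cdot> t1 = t \<cdot> f1"
  shows "Comp U (frac t g) (frac s f) = frac (s \<cdot> t1) (g \<cdot> f1)"
  unfolding U_sel
proof (rule Union_const)
  have "ore_square C S f t t1 f1" unfolding ore_square_iff[OF r] using o by blast
  then show "frac (s \<cdot> t1) (g \<cdot> f1) \<in> {roof_class C S (s' \<cdot> t', g' \<cdot> f'') |s' f' t'' g' t' f''.
                (s', f') \<in> frac s f \<and> (t'', g') \<in> frac t g \<and> ore_square C S f' t'' t' f''}"
    unfolding frac_mem using rel_refl[OF r(1)] rel_refl[OF r(2)] unfolding frac_def by blast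
next
  fix y assume "y \<in> {roof_class C S (s' \<cdot> t', g' \<cdot> f'') |s' f' t'' g' t' f''.
                (s', f') \<in> frac s f \<and> (t'', g') \<in> frac t g \<and> ore_square C S f' t'' t' f''}"
  then obtain s' f' t'' g' t' f'' where y: "y = frac (s' \<cdot> t') (g' \<cdot> f'')"
    and e: "rel s f s' f'" "rel t g t'' g'" and q: "ore_square C S f' t'' t' f''"
    unfolding frac_mem unfolding frac_def by blast
  obtain Z' where r1: "roof s' f' Z' X Y" using relE[OF e(1) r(1)] by metis
  obtain V' where r2: "roof t'' g' V' Y Y'" using relE[OF e(2) r(2)] by metis
  from q obtain R' where o': "mor t' R' Z'" "den t'" "mor f'' R' V'" "f' \<cdot> t' = t'' \<cdot> f''"
    unfolding ore_square_iff[OF r1 r2] by blast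
  show "y = frac (s \<cdot> t1) (g \<cdot> f1)"
    unfolding y by (rule frac_eqI[symmetric], rule comp_well_defined[OF r o e r1 r2 o'])
qed

text \<open>The two equivalences come with unrelated refinements. They are joined over the apex
  \<open>Z\<close>, after which \<open>b \<cdot> x\<close> and \<open>d \<cdot> y\<close> agree up
  to the denominator \<open>s'\<close>, and \<open>cancel\<close> makes them equal.\<close>

lemma plus_well_defined:
  assumes r: "roof s f Z X Y" "roof s g Z X Y" and r': "roof s' f' Z' X Y" "roof s' g' Z' X Y"
    and e: "rel s f s' f'" "rel s g s' g'"
  shows "rel s (f \<boxplus> g) s' (f' \<boxplus> g')"
proof -
  obtain Z1 W a b where ab0: "roof s' f' Z1 X Y" "mor a W Z" "den a" "mor b W Z1" "den b"
    "s \<cdot> a = s' \<cdot> b" "f \<cdot> a = f' \<cdot> b" using rel_common_expansion[OF e(1) r(1)] .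
  have "Z1 = Z'" using roofD(1)[OF ab0(1)] roofD(1)[OF r'(1)] by simp
  note ab = ab0(2-7)[unfolded this]
  obtain Z2 W' c d where cd0: "roof s' g' Z2 X Y" "mor c W' Z" "den c" "mor d W' Z2" "den d"
    "s \<cdot> c = s' \<cdot> d" "g \<cdot> c = g' \<cdot> d" using rel_common_expansion[OF e(2) r(2)] .
  have "Z2 = Z'" using roofD(1)[OF cd0(1)] roofD(1)[OF r'(2)] by simp
  note cd = cd0(2-7)[unfolded this]
  note m = roofD[OF r(1)] roofD[OF r(2)] roofD[OF r'(1)] roofD[OF r'(2)] ab(1-4) cd(1-4)
  obtain V x y where xy: "mor x V W" "den x" "mor y V W'" "den y" "a \<cdot> x = c \<cdot> y"
    using ore_den[OF ab(1,2) cd(1,2)] .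
  have "s' \<cdot> (b \<cdot> x) = s \<cdot> (a \<cdot> x)"
    using Comp_reassoc[OF ab(5)[symmetric], of x] m xy(1-4) by simp
  also have "\<dots> = s' \<cdot> (d \<cdot> y)"
    unfolding xy(5) using Comp_reassoc[OF cd(5), of y] m xy(1-4) by simp
  finally have e: "s' \<cdot> (b \<cdot> x) = s' \<cdot> (d \<cdot> y)" .
  have bd0: "mor (b \<cdot> x) V Z'" "mor (d \<cdot> y) V Z'" using m xy(1-4) by auto
  obtain V' z where z: "mor z V' V" "den z" "(b \<cdot> x) \<cdot> z = (d \<cdot> y) \<cdot> z"
    using cancel[OF bd0 roofD(1,2)[OF r'(1)] e] .
  have bd: "b \<cdot> (x \<cdot> z) = d \<cdot> (y \<cdot> z)" using z m xy(1-4) by simp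
  have ac: "a \<cdot> (x \<cdot> z) = c \<cdot> (y \<cdot> z)" using Comp_reassoc[OF xy(5), of z] z(1,2) m xy(1-4) by simp
  note mm = m xy(1-4) z(1,2)
  have r1: "roof s (f \<boxplus> g) Z X Y" "roof s' (f' \<boxplus> g') Z' X Y" unfolding roof_def using m by auto
  show ?thesis
  proof (rule relI[OF r1, of "a \<cdot> (x \<cdot> z)" V' "b \<cdot> (x \<cdot> z)"])
    show "s \<cdot> (a \<cdot> (x \<cdot> z)) = s' \<cdot> (b \<cdot> (x \<cdot> z))"
      using Comp_reassoc[OF ab(5), of "x \<cdot> z"] mm by simp
    have "f \<cdot> (a \<cdot> (x \<cdot> z)) = f' \<cdot> (b \<cdot> (x \<cdot> z))"
      using Comp_reassoc[OF ab(6), of "x \<cdot> z"] mm by simp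
    moreover have "g \<cdot> (a \<cdot> (x \<cdot> z)) = g' \<cdot> (b \<cdot> (x \<cdot> z))"
      unfolding ac bd using Comp_reassoc[OF cd(6), of "y \<cdot> z"] mm by simp
    ultimately show "(f \<boxplus> g) \<cdot> (a \<cdot> (x \<cdot> z)) = (f' \<boxplus> g') \<cdot> (b \<cdot> (x \<cdot> z))"
      using mm by simp
    show "den (s \<cdot> (a \<cdot> (x \<cdot> z)))" using mm by (intro den_Comp) auto
  qed (use mm in auto)
qed

lemma frac_Plus:
  assumes r: "roof s f Z X Y" "roof s g Z X Y"
  shows "Plus U (frac s f) (frac s g) = frac s (f \<boxplus> g)"
  unfolding U_sel
proof (rule Union_const)
  show "frac s (f \<boxplus> g) \<in> {roof_class C S (s', f' \<boxplus> g') |s' f' g'.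
      (s', f') \<in> frac s f \<and> (s', g') \<in> frac s g}"
    unfolding frac_mem using rel_refl[OF r(1)] rel_refl[OF r(2)] unfolding frac_def by blast
next
  fix y assume "y \<in> {roof_class C S (s', f' \<boxplus> g') |s' f' g'. (s', f') \<in> frac s f \<and> (s', g') \<in> frac s g}"
  then obtain s' f' g' where y: "y = frac s' (f' \<boxplus> g')" and e: "rel s f s' f'" "rel s g s' g'"
    unfolding frac_mem unfolding frac_def by blast
  obtain Z' where r1: "roof s' f' Z' X Y" using relE[OF e(1) r(1)] by metis
  obtain Z'' where r2: "roof s' g' Z'' X Y" using relE[OF e(2) r(2)] by metis
  have "Z'' = Z'" using roofD(1)[OF r1] roofD(1)[OF r2] by simp
  then show "y = frac s (f \<boxplus> g)"
    unfolding y using frac_eqI[OF plus_well_defined[OF r r1 _ e]] r2 by simp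
qed

lemma frac_Zero:
  assumes "mor s Z X" "den s" "Y \<in> Obj C"
  shows "frac s (zr Z Y) = Zero U X Y"
proof -
  have "roof (idn X) (zr X Y) X X Y" unfolding roof_def using assms by auto
  from roof_expand(2)[OF this assms(1,2)] show ?thesis unfolding U_sel using assms by simp
qed

section \<open>Common denominators and the axioms of a preadditive category\<close>

lemma common_den:
  assumes "\<alpha> \<in> Hom U X Y" "\<beta> \<in> Hom U X Y'"
  obtains s f g Z where "roof s f Z X Y" "roof s g Z X Y'" "\<alpha> = frac s f" "\<beta> = frac s g"
proof -
  obtain s f Z where a: "roof s f Z X Y" "\<alpha> = frac s f" using U_HomE[OF assms(1)] .
  obtain t g V where b: "roof t g V X Y'" "\<beta> = frac t g" using U_HomE[OF assms(2)] .
  obtain W x y where xy: "mor x W Z" "den x" "mor y W V" "den y" "s \<cdot> x = t \<cdot> y"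
    using ore_den[OF roofD(1,2)[OF a(1)] roofD(1,2)[OF b(1)]] .
  show ?thesis
    using that[of "s \<cdot> x" "f \<cdot> x" W "g \<cdot> y"] roof_expand[OF a(1) xy(1,2)] roof_expand[OF b(1) xy(3,4)]
      a(2) b(2) unfolding xy(5) by simp
qed

lemma common_den3:
  assumes "\<alpha> \<in> Hom U X Y" "\<beta> \<in> Hom U X Y" "\<gamma> \<in> Hom U X Y"
  obtains s f g h Z where "roof s f Z X Y" "roof s g Z X Y" "roof s h Z X Y"
    "\<alpha> = frac s f" "\<beta> = frac s g" "\<gamma> = frac s h"
proof -
  obtain s f g Z where a: "roof s f Z X Y" "roof s g Z X Y" "\<alpha> = frac s f" "\<beta> = frac s g"
    using common_den[OF assms(1,2)] .
  obtain t h V where b: "roof t h V X Y" "\<gamma> = frac t h" using U_HomE[OF assms(3)] .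
  obtain W x y where xy: "mor x W Z" "den x" "mor y W V" "den y" "s \<cdot> x = t \<cdot> y"
    using ore_den[OF roofD(1,2)[OF a(1)] roofD(1,2)[OF b(1)]] .
  show ?thesis
    using that[of "s \<cdot> x" "f \<cdot> x" W "g \<cdot> x" "h \<cdot> y"] roof_expand[OF a(1) xy(1,2)]
      roof_expand[OF a(2) xy(1,2)] roof_expand[OF b(1) xy(3,4)] a(3,4) b(2) unfolding xy(5) by simp
qed

lemma U_hom_group:
  assumes O: "X \<in> Obj C" "Y \<in> Obj C"
  shows "comm_group (hom_group U X Y)"
proof (rule comm_groupI)
  have z: "roof (idn X) (zr X Y) X X Y" unfolding roof_def using O by auto
  have sel: "carrier (hom_group U X Y) = Hom U X Y" "\<one>\<^bsub>hom_group U X Y\<^esub> = Zero U X Y"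
    "\<alpha> \<otimes>\<^bsub>hom_group U X Y\<^esub> \<beta> = Plus U \<alpha> \<beta>" for \<alpha> \<beta>
    unfolding hom_group_def by simp_all
  have pl: "roof s (f \<boxplus> g) Z X Y" if "roof s f Z X Y" "roof s g Z X Y" for s f g Z
    unfolding roof_def using roofD[OF that(1)] roofD[OF that(2)] by simp
  show "\<one>\<^bsub>hom_group U X Y\<^esub> \<in> carrier (hom_group U X Y)"
    unfolding sel unfolding U_sel(4) by (rule frac_Hom[OF z])
  fix \<alpha> assume "\<alpha> \<in> carrier (hom_group U X Y)"
  then have A: "\<alpha> \<in> Hom U X Y" unfolding sel .
  obtain s f Z where a: "roof s f Z X Y" "\<alpha> = frac s f" using U_HomE[OF A] .
  note m = roofD[OF a(1)]
  have zz: "roof s (zr Z Y) Z X Y" unfolding roof_def using m by simp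
  show "\<one>\<^bsub>hom_group U X Y\<^esub> \<otimes>\<^bsub>hom_group U X Y\<^esub> \<alpha> = \<alpha>"
    unfolding sel a(2) using frac_Plus[OF zz a(1)] frac_Zero[OF m(1,2) O(2)] m by simp
  have n: "roof s (neg f) Z X Y" unfolding roof_def using m by simp
  have "Plus U (frac s (neg f)) \<alpha> = Zero U X Y"
    unfolding a(2) using frac_Plus[OF n a(1)] frac_Zero[OF m(1,2) O(2)] m by simp
  then show "\<exists>y\<in>carrier (hom_group U X Y). y \<otimes>\<^bsub>hom_group U X Y\<^esub> \<alpha> = \<one>\<^bsub>hom_group U X Y\<^esub>"
    unfolding sel using frac_Hom[OF n] by blast
  fix \<beta> assume "\<beta> \<in> carrier (hom_group U X Y)"
  then have B: "\<beta> \<in> Hom U X Y" unfolding sel .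
  obtain s f g Z where ab: "roof s f Z X Y" "roof s g Z X Y" "\<alpha> = frac s f" "\<beta> = frac s g"
    using common_den[OF A B] .
  show "\<alpha> \<otimes>\<^bsub>hom_group U X Y\<^esub> \<beta> \<in> carrier (hom_group U X Y)"
    unfolding sel ab(3,4) frac_Plus[OF ab(1,2)] by (rule frac_Hom[OF pl[OF ab(1,2)]])
  show "\<alpha> \<otimes>\<^bsub>hom_group U X Y\<^esub> \<beta> = \<beta> \<otimes>\<^bsub>hom_group U X Y\<^esub> \<alpha>"
    unfolding sel ab(3,4) frac_Plus[OF ab(1,2)] frac_Plus[OF ab(2,1)]
    using Plus_comm[of f g] roofD[OF ab(1)] roofD[OF ab(2)] by simp
  fix \<gamma> assume "\<gamma> \<in> carrier (hom_group U X Y)"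
  then have G: "\<gamma> \<in> Hom U X Y" unfolding sel .
  obtain s f g h Z where abc: "roof s f Z X Y" "roof s g Z X Y" "roof s h Z X Y"
    "\<alpha> = frac s f" "\<beta> = frac s g" "\<gamma> = frac s h"
    using common_den3[OF A B G] .
  show "\<alpha> \<otimes>\<^bsub>hom_group U X Y\<^esub> \<beta> \<otimes>\<^bsub>hom_group U X Y\<^esub> \<gamma> =
      \<alpha> \<otimes>\<^bsub>hom_group U X Y\<^esub> (\<beta> \<otimes>\<^bsub>hom_group U X Y\<^esub> \<gamma>)"
    unfolding sel abc(4-6) frac_Plus[OF abc(1,2)] frac_Plus[OF abc(2,3)]
      frac_Plus[OF pl[OF abc(1,2)] abc(3)] frac_Plus[OF abc(1) pl[OF abc(2,3)]]
    using Plus_assoc[of f g h] roofD[OF abc(1)] roofD[OF abc(2)] roofD[OF abc(3)] by simp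
qed

lemma U_Comp_obtain:
  assumes "roof s f Z X Y" "roof t g V Y Y'"
  obtains R t1 f1 where "mor t1 R Z" "den t1" "mor f1 R V" "f \<cdot> t1 = t \<cdot> f1"
    "Comp U (frac t g) (frac s f) = frac (s \<cdot> t1) (g \<cdot> f1)" "roof (s \<cdot> t1) (g \<cdot> f1) R X Y'"
proof -
  note m = roofD[OF assms(1)] roofD[OF assms(2)]
  obtain R t1 f1 where o: "mor t1 R Z" "den t1" "mor f1 R V" "f \<cdot> t1 = t \<cdot> f1"
    using ore[OF m(3) m(4,5)] .
  have "roof (s \<cdot> t1) (g \<cdot> f1) R X Y'" unfolding roof_def using m o(1-3) by simp
  then show ?thesis using that[OF o frac_Comp[OF assms o]] by blast
qed

lemma preadditive_U: "preadditive_category U"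
proof (rule preadditive_category.intro)
  show "X = X' \<and> Y = Y'" if h: "\<alpha> \<in> Hom U X Y" "\<alpha> \<in> Hom U X' Y'" for X Y X' Y' \<alpha>
  proof -
    obtain s f Z where a: "roof s f Z X Y" "\<alpha> = frac s f" using U_HomE[OF h(1)] .
    obtain t g V where b: "roof t g V X' Y'" "\<alpha> = frac t g" using U_HomE[OF h(2)] .
    \<comment> \<open>Equivalent roofs have the same outer objects by the definition of
      \<open>rel\<close>, so the classes inherit disjointness.\<close>
    have "rel s f t g" unfolding frac_eq_iff[OF a(1), symmetric] using a(2) b(2) by simp
    then obtain V' where "roof t g V' X Y" using relE[OF _ a(1)] by metis
    then show ?thesis using roofD[OF b(1)] roofD by auto
  qed
  have id: "roof (idn X) (idn X) X X X" if "X \<in> Obj C" for X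
    unfolding roof_def using that by simp
  show "Ident U X \<in> Hom U X X" if "X \<in> Obj U" for X
    using frac_Hom[OF id] that unfolding U_sel(1,3) by blast
  show "Comp U \<beta> \<alpha> \<in> Hom U X Z" if h: "\<alpha> \<in> Hom U X Y" "\<beta> \<in> Hom U Y Z" for X Y Z \<alpha> \<beta>
  proof -
    obtain s f Z1 where a: "roof s f Z1 X Y" "\<alpha> = frac s f" using U_HomE[OF h(1)] .
    obtain t g Z2 where b: "roof t g Z2 Y Z" "\<beta> = frac t g" using U_HomE[OF h(2)] .
    show ?thesis using U_Comp_obtain[OF a(1) b(1)] frac_Hom unfolding a(2) b(2) by metis
  qed
  show "Comp U \<alpha> (Ident U X) = \<alpha>" if h: "\<alpha> \<in> Hom U X Y" for X Y \<alpha>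
  proof -
    obtain s f Z where a: "roof s f Z X Y" "\<alpha> = frac s f" using U_HomE[OF h] .
    note m = roofD[OF a(1)]
    have X: "X \<in> Obj C" using m by auto
    have "Comp U (frac s f) (frac (idn X) (idn X)) = frac (idn X \<cdot> s) (f \<cdot> idn Z)"
      by (rule frac_Comp[OF id[OF X] a(1), of s Z]) (use m in auto)
    then show ?thesis unfolding a(2) U_sel(3) using m by simp
  qed
  show "Comp U (Ident U Y) \<alpha> = \<alpha>" if h: "\<alpha> \<in> Hom U X Y" for X Y \<alpha>
  proof -
    obtain s f Z where a: "roof s f Z X Y" "\<alpha> = frac s f" using U_HomE[OF h] .
    note m = roofD[OF a(1)]
    have Y: "Y \<in> Obj C" using m by auto
    have "Comp U (frac (idn Y) (idn Y)) (frac s f) = frac (s \<cdot> idn Z) (idn Y \<cdot> f)"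
      by (rule frac_Comp[OF a(1) id[OF Y], of _ Z]) (use m in auto)
    then show ?thesis unfolding a(2) U_sel(3) using m by simp
  qed
  show "Comp U \<gamma> (Comp U \<beta> \<alpha>) = Comp U (Comp U \<gamma> \<beta>) \<alpha>"
    if h: "\<alpha> \<in> Hom U W X" "\<beta> \<in> Hom U X Y" "\<gamma> \<in> Hom U Y Z" for W X Y Z \<alpha> \<beta> \<gamma>
  proof -
    obtain s f A where a: "roof s f A W X" "\<alpha> = frac s f" using U_HomE[OF h(1)] .
    obtain t g B where b: "roof t g B X Y" "\<beta> = frac t g" using U_HomE[OF h(2)] .
    obtain u h D where c: "roof u h D Y Z" "\<gamma> = frac u h" using U_HomE[OF h(3)] .
    obtain R t1 f1 where ba: "mor t1 R A" "den t1" "mor f1 R B" "f \<cdot> t1 = t \<cdot> f1"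
      "Comp U (frac t g) (frac s f) = frac (s \<cdot> t1) (g \<cdot> f1)" "roof (s \<cdot> t1) (g \<cdot> f1) R W Y"
      using U_Comp_obtain[OF a(1) b(1)] .
    obtain Q u1 g1 where cb: "mor u1 Q B" "den u1" "mor g1 Q D" "g \<cdot> u1 = u \<cdot> g1"
      "Comp U (frac u h) (frac t g) = frac (t \<cdot> u1) (h \<cdot> g1)" "roof (t \<cdot> u1) (h \<cdot> g1) Q X Z"
      using U_Comp_obtain[OF b(1) c(1)] .
    \<comment> \<open>A third Ore square is put on top of the other two; both bracketings are then
      computed by roofs with the same apex \<open>V\<close>.\<close>
    obtain V u2 f2 where o: "mor u2 V R" "den u2" "mor f2 V Q" "f1 \<cdot> u2 = u1 \<cdot> f2"
      using ore[OF ba(3) cb(1,2)] .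
    note m = roofD[OF a(1)] roofD[OF b(1)] roofD[OF c(1)] ba(1-3) cb(1-3) o(1-3)
    have "(g \<cdot> f1) \<cdot> u2 = u \<cdot> (g1 \<cdot> f2)"
      using o(4) Comp_reassoc[OF cb(4), of f2] m by simp
    then have "Comp U (frac u h) (frac (s \<cdot> t1) (g \<cdot> f1)) = frac ((s \<cdot> t1) \<cdot> u2) (h \<cdot> (g1 \<cdot> f2))"
      using m by (intro frac_Comp[OF ba(6) c(1), of u2 V]) auto
    moreover have "f \<cdot> (t1 \<cdot> u2) = (t \<cdot> u1) \<cdot> f2"
      using o(4) Comp_reassoc[OF ba(4), of u2] m by simp
    then have "Comp U (frac (t \<cdot> u1) (h \<cdot> g1)) (frac s f) = frac (s \<cdot> (t1 \<cdot> u2)) ((h \<cdot> g1) \<cdot> f2)"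
      using m by (intro frac_Comp[OF a(1) cb(6), of "t1 \<cdot> u2" V]) auto
    ultimately show ?thesis unfolding a(2) b(2) c(2) ba(5) cb(5) using m by simp
  qed
  show "comm_group (hom_group U X Y)" if "X \<in> Obj U" "Y \<in> Obj U" for X Y
    using U_hom_group that unfolding U_sel(1) by blast
  show "Comp U \<gamma> (Plus U \<alpha> \<beta>) = Plus U (Comp U \<gamma> \<alpha>) (Comp U \<gamma> \<beta>)"
    if h: "\<alpha> \<in> Hom U X Y" "\<beta> \<in> Hom U X Y" "\<gamma> \<in> Hom U Y Z" for X Y Z \<alpha> \<beta> \<gamma>
  proof -
    obtain s f g A where ab: "roof s f A X Y" "roof s g A X Y" "\<alpha> = frac s f" "\<beta> = frac s g"
      using common_den[OF h(1,2)] .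
    obtain t h B where c: "roof t h B Y Z" "\<gamma> = frac t h" using U_HomE[OF h(3)] .
    note m = roofD[OF ab(1)] roofD[OF ab(2)] roofD[OF c(1)]
    obtain R t1 f1 where o1: "mor t1 R A" "den t1" "mor f1 R B" "f \<cdot> t1 = t \<cdot> f1"
      using ore[OF m(3) m(7,8)] .
    have "mor (g \<cdot> t1) R Y" using m o1 by simp
    \<comment> \<open>The second square is built over the first, so that both composites receive the
      common left leg \<open>s \<cdot> \<tau>\<close> and can be added.\<close>
    then obtain Q t2 g1 where o2: "mor t2 Q R" "den t2" "mor g1 Q B" "(g \<cdot> t1) \<cdot> t2 = t \<cdot> g1"
      using ore[OF _ m(7,8)] by metis
    note mm = m o1(1-3) o2(1-3)
    define \<tau> \<phi> where "\<tau> = t1 \<cdot> t2" and "\<phi> = f1 \<cdot> t2"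
    have t: "mor \<tau> Q A" "den \<tau>" "mor \<phi> Q B" unfolding \<tau>_def \<phi>_def using mm by auto
    have e: "f \<cdot> \<tau> = t \<cdot> \<phi>" "g \<cdot> \<tau> = t \<cdot> g1"
      unfolding \<tau>_def \<phi>_def using mm Comp_reassoc[OF o1(4), of t2] o2(4) by simp_all
    have p: "roof s (f \<boxplus> g) A X Y" unfolding roof_def using m by simp
    have "Comp U (frac t h) (frac s (f \<boxplus> g)) = frac (s \<cdot> \<tau>) (h \<cdot> (\<phi> \<boxplus> g1))"
      using mm t e by (intro frac_Comp[OF p c(1), of \<tau> Q]) auto
    moreover have "Comp U (frac t h) (frac s f) = frac (s \<cdot> \<tau>) (h \<cdot> \<phi>)"
      by (rule frac_Comp[OF ab(1) c(1) t e(1)])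
    moreover have "Comp U (frac t h) (frac s g) = frac (s \<cdot> \<tau>) (h \<cdot> g1)"
      by (rule frac_Comp[OF ab(2) c(1) t(1,2) o2(3) e(2)])
    moreover have "Plus U (frac (s \<cdot> \<tau>) (h \<cdot> \<phi>)) (frac (s \<cdot> \<tau>) (h \<cdot> g1)) =
        frac (s \<cdot> \<tau>) ((h \<cdot> \<phi>) \<boxplus> (h \<cdot> g1))"
      by (rule frac_Plus[of _ _ Q X Z]) (use mm t in \<open>auto simp: roof_def\<close>)
    ultimately show ?thesis unfolding ab(3,4) c(2) frac_Plus[OF ab(1,2)] using mm t by simp
  qed
  show "Comp U (Plus U \<beta> \<gamma>) \<alpha> = Plus U (Comp U \<beta> \<alpha>) (Comp U \<gamma> \<alpha>)"
    if h: "\<alpha> \<in> Hom U X Y" "\<beta> \<in> Hom U Y Z" "\<gamma> \<in> Hom U Y Z" for X Y Z \<alpha> \<beta> \<gamma>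
  proof -
    obtain s f A where a: "roof s f A X Y" "\<alpha> = frac s f" using U_HomE[OF h(1)] .
    obtain t g h B where bc: "roof t g B Y Z" "roof t h B Y Z" "\<beta> = frac t g" "\<gamma> = frac t h"
      using common_den[OF h(2,3)] .
    note m = roofD[OF a(1)] roofD[OF bc(1)] roofD[OF bc(2)]
    obtain R t1 f1 where o: "mor t1 R A" "den t1" "mor f1 R B" "f \<cdot> t1 = t \<cdot> f1"
      using ore[OF m(3) m(4,5)] .
    have p: "roof t (g \<boxplus> h) B Y Z" unfolding roof_def using m by simp
    have "Plus U (frac (s \<cdot> t1) (g \<cdot> f1)) (frac (s \<cdot> t1) (h \<cdot> f1)) =
        frac (s \<cdot> t1) ((g \<cdot> f1) \<boxplus> (h \<cdot> f1))"
      by (rule frac_Plus[of _ _ R X Z]) (use m o in \<open>auto simp: roof_def\<close>)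
    then show ?thesis
      unfolding a(2) bc(3,4) frac_Plus[OF bc(1,2)] frac_Comp[OF a(1) bc(1) o] frac_Comp[OF a(1) bc(2) o]
        frac_Comp[OF a(1) p o] using m o(1-3) by simp
  qed
qed

end

section \<open>Additive closures\<close>

context preadditive_category
begin

definition add_closed :: "'a set \<Rightarrow> bool" where
  "add_closed D \<longleftrightarrow> D \<subseteq> Obj C \<and>
     (\<forall>X Y. X \<in> D \<and> isomorphic C X Y \<longrightarrow> Y \<in> D) \<and>
     (\<forall>Z. zero_object C Z \<longrightarrow> Z \<in> D) \<and>
     (\<forall>X Y S. X \<in> D \<and> Y \<in> D \<and> direct_sum C X Y S \<longrightarrow> S \<in> D) \<and>
     closed_under_summands C D"

lemma add_closure_eq: "add_closure C M = \<Inter>{D. M \<subseteq> D \<and> add_closed D}"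
  unfolding add_closure_def add_closed_def by blast

lemma add_closure_subset: "M \<subseteq> add_closure C M"
  unfolding add_closure_eq by blast

lemma add_closure_least: "\<lbrakk>add_closed D; M \<subseteq> D\<rbrakk> \<Longrightarrow> add_closure C M \<subseteq> D"
  unfolding add_closure_eq by blast

lemma add_closed_Obj: "add_closed (Obj C)"
  unfolding add_closed_def isomorphic_def direct_sum_def closed_under_summands_def zero_object_def
  by blast

lemma add_closedD:
  assumes "add_closed D"
  shows "D \<subseteq> Obj C" "\<lbrakk>X \<in> D; isomorphic C X Y\<rbrakk> \<Longrightarrow> Y \<in> D" "zero_object C X \<Longrightarrow> X \<in> D"
    "\<lbrakk>X \<in> D; Y \<in> D; direct_sum C X Y S\<rbrakk> \<Longrightarrow> S \<in> D" "\<lbrakk>direct_sum C X Y S; S \<in> D\<rbrakk> \<Longrightarrow> X \<in> D"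
  using assms unfolding add_closed_def closed_under_summands_def by blast+

lemma add_closed_closure:
  assumes "M \<subseteq> Obj C" shows "add_closed (add_closure C M)"
  unfolding add_closed_def closed_under_summands_def
proof (intro conjI allI impI)
  show "add_closure C M \<subseteq> Obj C" using add_closure_least[OF add_closed_Obj assms] .
  show "Y \<in> add_closure C M" if "X \<in> add_closure C M \<and> isomorphic C X Y" for X Y
    using that add_closedD(2)[where X = X and Y = Y] unfolding add_closure_eq by blast
  show "Z \<in> add_closure C M" if "zero_object C Z" for Z
    using that add_closedD(3)[where X = Z] unfolding add_closure_eq by blast
  show "S \<in> add_closure C M" if "X \<in> add_closure C M \<and> Y \<in> add_closure C M \<and> direct_sum C X Y S" for X Y S
    using that add_closedD(4)[where X = X and Y = Y and S = S] unfolding add_closure_eq by blast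
  show "X \<in> add_closure C M" if "direct_sum C X Y S \<and> S \<in> add_closure C M" for X Y S
    using that add_closedD(5)[where X = X and Y = Y and S = S] unfolding add_closure_eq by blast
qed

lemma isomorphic_iff:
  "isomorphic C X Y \<longleftrightarrow> (\<exists>u v. mor u X Y \<and> mor v Y X \<and> v \<cdot> u = idn X \<and> u \<cdot> v = idn Y)"
proof
  assume "isomorphic C X Y"
  then show "\<exists>u v. mor u X Y \<and> mor v Y X \<and> v \<cdot> u = idn X \<and> u \<cdot> v = idn Y"
    unfolding isomorphic_def using is_iso_iff by blast
next
  assume a: "\<exists>u v. mor u X Y \<and> mor v Y X \<and> v \<cdot> u = idn X \<and> u \<cdot> v = idn Y"
  then have "X \<in> Obj C" "Y \<in> Obj C" by auto
  with a show "isomorphic C X Y" unfolding isomorphic_def using is_iso_iff by blast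
qed

lemma isomorphic_sym: "isomorphic C X Y \<Longrightarrow> isomorphic C Y X"
  unfolding isomorphic_iff by blast

lemma isomorphic_trans:
  assumes "isomorphic C X Y" "isomorphic C Y Z" shows "isomorphic C X Z"
proof -
  obtain u v where u: "mor u X Y" "mor v Y X" "v \<cdot> u = idn X" "u \<cdot> v = idn Y"
    using assms(1) unfolding isomorphic_iff by blast
  obtain w x where w: "mor w Y Z" "mor x Z Y" "x \<cdot> w = idn Y" "w \<cdot> x = idn Z"
    using assms(2) unfolding isomorphic_iff by blast
  have "(v \<cdot> x) \<cdot> (w \<cdot> u) = idn X" using u w Comp_reassoc[OF w(3), of u] by simp
  moreover have "(w \<cdot> u) \<cdot> (v \<cdot> x) = idn Z" using u w Comp_reassoc[OF u(4), of x] by simp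
  moreover have "mor (w \<cdot> u) X Z" "mor (v \<cdot> x) Z X" using u w by auto
  ultimately show ?thesis unfolding isomorphic_iff by blast
qed

lemma hom_zero_retract_left:
  assumes "mor i X X'" "mor p X' X" "p \<cdot> i = idn X" "hom_zero C X' Y" "Y \<in> Obj C"
  shows "hom_zero C X Y"
proof (rule hom_zeroI)
  fix f assume f: "mor f X Y"
  have "f = f \<cdot> (p \<cdot> i)" using f assms(3) by simp
  also have "\<dots> = (f \<cdot> p) \<cdot> i" using f assms(1,2) by simp
  also have "f \<cdot> p = zr X' Y" using hom_zeroD[OF assms(4), of "f \<cdot> p"] f assms(1,2) by simp
  finally show "f = zr X Y" using assms by simp
qed (use assms in auto)

lemma hom_zero_retract_right:
  assumes "mor i Y Y'" "mor p Y' Y" "p \<cdot> i = idn Y" "hom_zero C X Y'" "X \<in> Obj C"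
  shows "hom_zero C X Y"
proof (rule hom_zeroI)
  fix f assume f: "mor f X Y"
  have "f = (p \<cdot> i) \<cdot> f" using f assms(3) by simp
  also have "\<dots> = p \<cdot> (i \<cdot> f)" using f assms(1,2) by simp
  also have "i \<cdot> f = zr X Y'" using hom_zeroD[OF assms(4), of "i \<cdot> f"] f assms(1,2) by simp
  finally show "f = zr X Y" using assms by simp
qed (use assms in auto)

lemma hom_zero_isomorphic:
  assumes "isomorphic C X X'" "isomorphic C Y Y'" "hom_zero C X Y"
  shows "hom_zero C X' Y'"
proof -
  obtain u v where u: "mor u X X'" "mor v X' X" "u \<cdot> v = idn X'"
    using assms(1) unfolding isomorphic_iff by blast
  obtain w x where w: "mor w Y Y'" "mor x Y' Y" "w \<cdot> x = idn Y'"
    using assms(2) unfolding isomorphic_iff by blast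
  have "hom_zero C X' Y" using hom_zero_retract_left[OF u(2,1,3) assms(3)] w by auto
  then show ?thesis using hom_zero_retract_right[OF w(2,1,3)] u by auto
qed

lemma hom_zero_sum_left:
  assumes "direct_sum C X Y S" "hom_zero C X W" "hom_zero C Y W" "W \<in> Obj C"
  shows "hom_zero C S W"
proof (rule hom_zeroI)
  obtain i j p q where d: "mor i X S" "mor j Y S" "mor p S X" "mor q S Y"
    "(i \<cdot> p) \<boxplus> (j \<cdot> q) = idn S" using assms(1) unfolding direct_sum_iff by blast
  fix f assume f: "mor f S W"
  have z: "f \<cdot> i = zr X W" "f \<cdot> j = zr Y W"
    using hom_zeroD[OF assms(2), of "f \<cdot> i"] hom_zeroD[OF assms(3), of "f \<cdot> j"] f d(1-4) by auto
  have "f = f \<cdot> ((i \<cdot> p) \<boxplus> (j \<cdot> q))" unfolding d(5) using f by simp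
  also have "\<dots> = (f \<cdot> i) \<cdot> p \<boxplus> (f \<cdot> j) \<cdot> q" using f d(1-4) by simp
  also have "\<dots> = zr S W" unfolding z using f d(1-4) by simp
  finally show "f = zr S W" .
qed (use assms in \<open>auto simp: direct_sum_def\<close>)

lemma hom_zero_sum_right:
  assumes "direct_sum C X Y S" "hom_zero C W X" "hom_zero C W Y" "W \<in> Obj C"
  shows "hom_zero C W S"
proof (rule hom_zeroI)
  obtain i j p q where d: "mor i X S" "mor j Y S" "mor p S X" "mor q S Y"
    "(i \<cdot> p) \<boxplus> (j \<cdot> q) = idn S" using assms(1) unfolding direct_sum_iff by blast
  fix f assume f: "mor f W S"
  have z: "p \<cdot> f = zr W X" "q \<cdot> f = zr W Y"
    using hom_zeroD[OF assms(2), of "p \<cdot> f"] hom_zeroD[OF assms(3), of "q \<cdot> f"] f d(1-4) by auto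
  have "f = ((i \<cdot> p) \<boxplus> (j \<cdot> q)) \<cdot> f" unfolding d(5) using f by simp
  also have "\<dots> = i \<cdot> (p \<cdot> f) \<boxplus> j \<cdot> (q \<cdot> f)" using f d(1-4) by simp
  also have "\<dots> = zr W S" unfolding z using f d(1-4) by simp
  finally show "f = zr W S" .
qed (use assms in \<open>auto simp: direct_sum_def\<close>)

end

section \<open>The quotient functor\<close>

sublocale verdier_quotient \<subseteq> Q: preadditive_category "triangle_quotient C S"
  by (rule preadditive_U)

context verdier_quotient
begin

section \<open>The functor to the quotient and its kernel\<close>

lemma Q_mor_iff_Hom: "Q.mor \<alpha> X Y \<longleftrightarrow> X \<in> Obj C \<and> Y \<in> Obj C \<and> \<alpha> \<in> Hom U X Y"
  unfolding Q.mor_def U_sel(1) by blast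

lemma Q_mor_frac: "roof s f Z X Y \<Longrightarrow> Q.mor (frac s f) X Y"
  using frac_Hom roof_Obj unfolding Q_mor_iff_Hom by blast

lemma Q_morE:
  assumes "Q.mor \<alpha> X Y"
  obtains s f Z where "roof s f Z X Y" "\<alpha> = frac s f"
  using assms U_HomE unfolding Q_mor_iff_Hom by blast

lemma Obj_U [simp]: "Obj U = Obj C"
  by (rule U_sel(1))

definition rho :: "'b \<Rightarrow> ('b \<times> 'b) set" where
  "rho f = frac (idn (src f)) f"

lemma roof_Ident: "mor f X Y \<Longrightarrow> roof (idn X) f X X Y"
  unfolding roof_def by simp

lemma rho_eq: "mor f X Y \<Longrightarrow> rho f = frac (idn X) f"
  unfolding rho_def by simp

lemma mor_rho:
  assumes "mor f X Y" shows "Q.mor (rho f) X Y"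
  unfolding rho_eq[OF assms] by (rule Q_mor_frac[OF roof_Ident[OF assms]])

lemma arr_rho [simp]:
  assumes "arr f" shows "Q.arr (rho f)" "Q.src (rho f) = src f" "Q.tgt (rho f) = tgt f"
  using mor_rho[OF arr_mor[OF assms]] by auto

lemma on_Obj_eq: "on_Obj (quotient_functor C S) X = X"
  unfolding quotient_functor_def by simp

lemma on_Mor_eq:
  assumes f: "mor f X Y" shows "on_Mor (quotient_functor C S) f = rho f"
proof -
  have "\<Union>{roof_class C S (idn X, f) |X. X \<in> Obj C \<and> (\<exists>Y\<in>Obj C. f \<in> Hom C X Y)} = rho f"
  proof (rule Union_const)
    show "rho f \<in> {roof_class C S (idn X, f) |X. X \<in> Obj C \<and> (\<exists>Y\<in>Obj C. f \<in> Hom C X Y)}"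
      using f unfolding rho_eq[OF f] frac_def unfolding mor_def by blast
  next
    fix y assume "y \<in> {roof_class C S (idn X, f) |X. X \<in> Obj C \<and> (\<exists>Y\<in>Obj C. f \<in> Hom C X Y)}"
    then obtain X' Y' where y: "y = frac (idn X') f" "mor f X' Y'"
      unfolding frac_def mor_def by blast
    then show "y = rho f" using rho_eq by blast
  qed
  then show ?thesis unfolding quotient_functor_def by simp
qed

lemma rho_Ident: "X \<in> Obj C \<Longrightarrow> rho (idn X) = Ident U X"
  unfolding rho_def U_sel by simp

lemma rho_Zero: "\<lbrakk>X \<in> Obj C; Y \<in> Obj C\<rbrakk> \<Longrightarrow> rho (zr X Y) = Zero U X Y"
  unfolding rho_def U_sel by simp

lemma rho_Comp:
  assumes f: "mor f X Y" and g: "mor g Y Z"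
  shows "rho (g \<cdot> f) = rho g \<cdot>\<^bsub>U\<^esub> rho f"
proof -
  have "rho g \<cdot>\<^bsub>U\<^esub> rho f = frac (idn X \<cdot> idn X) (g \<cdot> f)"
    unfolding rho_eq[OF f] rho_eq[OF g]
    by (rule frac_Comp[OF roof_Ident[OF f] roof_Ident[OF g], of _ X]) (use f in auto)
  then show ?thesis using rho_eq[OF mor_Comp[OF f g]] f by simp
qed

lemma rho_Plus:
  assumes f: "mor f X Y" and g: "mor g X Y"
  shows "rho (f \<boxplus> g) = rho f \<boxplus>\<^bsub>U\<^esub> rho g"
proof -
  have "mor (f \<boxplus> g) X Y" using f g by simp
  then show ?thesis
    unfolding rho_eq[OF f] rho_eq[OF g] frac_Plus[OF roof_Ident[OF f] roof_Ident[OF g]] by (rule rho_eq)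
qed

lemma frac_rho:
  assumes r: "roof s f Z X Y" shows "frac s f \<cdot>\<^bsub>U\<^esub> rho s = rho f"
proof -
  note m = roofD[OF r]
  have "frac s f \<cdot>\<^bsub>U\<^esub> frac (idn Z) s = frac (idn Z \<cdot> idn Z) (f \<cdot> idn Z)"
    by (rule frac_Comp[OF roof_Ident[OF m(1)] r, of _ Z]) (use m in auto)
  then show ?thesis unfolding rho_eq[OF m(1)] rho_eq[OF m(3)] using m by simp
qed

text \<open>The inverse of \<open>rho s\<close> is the roof whose left leg is \<open>s\<close> and
  whose right leg is the identity.\<close>

lemma den_isomorphic:
  assumes s: "mor s Z X" "den s" shows "isomorphic U Z X"
proof -
  have ZX: "Z \<in> Obj C" "X \<in> Obj C" using s by auto
  have r: "roof s (idn Z) Z X Z" unfolding roof_def using s by simp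
  have "frac (idn Z) s \<cdot>\<^bsub>U\<^esub> frac s (idn Z) = frac (s \<cdot> idn Z) (s \<cdot> idn Z)"
    by (rule frac_Comp[OF r roof_Ident[OF s(1)], of _ Z]) (use s in auto)
  also have "\<dots> = frac (idn X \<cdot> s) (idn X \<cdot> s)" using s by simp
  also have "\<dots> = Ident U X"
    unfolding U_sel using roof_expand(2)[of "idn X" "idn X" X X X s Z] s unfolding roof_def by simp
  finally have "rho s \<cdot>\<^bsub>U\<^esub> frac s (idn Z) = Ident U X" unfolding rho_eq[OF s(1)] .
  moreover have "frac s (idn Z) \<cdot>\<^bsub>U\<^esub> rho s = Ident U Z" using frac_rho[OF r] rho_Ident[OF ZX(1)] by simp
  ultimately show ?thesis
    unfolding Q.isomorphic_iff using mor_rho[OF s(1)] Q_mor_frac[OF r] by blast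
qed

lemma dtri_isomorphic: "\<lbrakk>dtri X Y A; A \<in> S\<rbrakk> \<Longrightarrow> isomorphic U X Y"
  unfolding dtri_def using den_isomorphic denI triD(1) by blast

lemma dtri_isomorphic': "\<lbrakk>dtri A X Y; A \<in> S\<rbrakk> \<Longrightarrow> isomorphic U X Y"
  using dtri_isomorphic[OF dtri_rotate] thick_sub_shift[OF thick_S] by blast

lemma rho_zero_factor:
  assumes f: "mor f X Y" and z: "rho f = Zero U X Y"
  obtains A a b where "A \<in> S" "mor a X A" "mor b A Y" "f = b \<cdot> a"
proof -
  have O: "X \<in> Obj C" "Y \<in> Obj C" using f by auto
  have "frac (idn X) f = frac (idn X) (zr X Y)" using z rho_eq[OF f] U_sel(4) by simp
  then have "rel (idn X) f (idn X) (zr X Y)" unfolding frac_eq_iff[OF roof_Ident[OF f]] .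
  then obtain Z' W c d where r: "roof (idn X) (zr X Y) Z' X Y" "mor c W X" "den c" "mor d W Z'" "den d"
    "idn X \<cdot> c = idn X \<cdot> d" "f \<cdot> c = zr X Y \<cdot> d" by (rule rel_common_expansion[OF _ roof_Ident[OF f]])
  have "tgt d = X" using r(4) roofD(1)[OF r(1)] O by simp
  then have fc: "f \<cdot> c = zr W Y" using r(7,4) O by simp
  obtain A a h where t: "triangle C W X A c a h" "A \<in> S" using den_cone[OF r(3,2)] .
  obtain b where "mor b A Y" "f = b \<cdot> a" using tri_extend[OF t(1) f fc] .
  with that t triD(2)[OF t(1)] show ?thesis by blast
qed

text \<open>The cocone of \<open>a\<close> provides a denominator \<open>c\<close> with vanishing
  \<open>a \<cdot> c\<close>; expanding by it turns the class into a fraction with zero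
  numerator.\<close>

lemma rho_factor_zero:
  assumes A: "A \<in> S" and a: "mor a X A" and b: "mor b A Y"
  shows "rho (b \<cdot> a) = Zero U X Y"
proof -
  obtain W c h where t: "triangle C W X A c a h" using cocone_ex[OF a] .
  have d: "den c" "mor c W X" using denI[OF t A] triD(1)[OF t] by auto
  have ba: "mor (b \<cdot> a) X Y" using a b by simp
  have Y: "Y \<in> Obj C" using b by auto
  have "rho (b \<cdot> a) = frac (idn X \<cdot> c) ((b \<cdot> a) \<cdot> c)"
    using roof_expand(2)[OF roof_Ident[OF ba] d(2,1)] rho_eq[OF ba] by simp
  also have "\<dots> = frac c (zr W Y)" using tri_comp_zero[OF t] a b d by simp
  also have "\<dots> = Zero U X Y" using frac_Zero[OF d(2,1) Y] .
  finally show ?thesis .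
qed

lemma zero_object_U_S: "A \<in> S \<Longrightarrow> zero_object U A"
proof -
  assume A: "A \<in> S"
  have O: "A \<in> Obj C" using thick_sub_Obj[OF thick_S A] .
  have "rho (idn A \<cdot> idn A) = Zero U A A" by (rule rho_factor_zero[OF A]) (use O in auto)
  then show ?thesis unfolding Q.zero_object_iff using O rho_Ident[OF O] by simp
qed

lemma zero_object_U: "zero_object C K \<Longrightarrow> zero_object U K"
  using zero_object_U_S thick_sub_zero[OF thick_S] unfolding zero_object_iff by blast

lemma direct_sum_U:
  assumes "direct_sum C X Y D" shows "direct_sum U X Y D"
proof -
  obtain i j p q where d: "mor i X D" "mor j Y D" "mor p D X" "mor q D Y"
     "p \<cdot> i = idn X" "q \<cdot> j = idn Y" "q \<cdot> i = zr X Y" "p \<cdot> j = zr Y X" "(i \<cdot> p) \<boxplus> (j \<cdot> q) = idn D"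
    using assms unfolding direct_sum_iff by blast
  have O: "X \<in> Obj C" "Y \<in> Obj C" "D \<in> Obj C" using d by auto
  have "rho p \<cdot>\<^bsub>U\<^esub> rho i = Ident U X" using rho_Comp[OF d(1,3)] d(5) rho_Ident O by simp
  moreover have "rho q \<cdot>\<^bsub>U\<^esub> rho j = Ident U Y" using rho_Comp[OF d(2,4)] d(6) rho_Ident O by simp
  moreover have "rho q \<cdot>\<^bsub>U\<^esub> rho i = Zero U X Y" using rho_Comp[OF d(1,4)] d(7) rho_Zero O by simp
  moreover have "rho p \<cdot>\<^bsub>U\<^esub> rho j = Zero U Y X" using rho_Comp[OF d(2,3)] d(8) rho_Zero O by simp
  moreover have "(rho i \<cdot>\<^bsub>U\<^esub> rho p) \<boxplus>\<^bsub>U\<^esub> (rho j \<cdot>\<^bsub>U\<^esub> rho q) = Ident U D"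
    using rho_Plus[OF mor_Comp[OF d(3,1)] mor_Comp[OF d(4,2)]] rho_Comp[OF d(3,1)] rho_Comp[OF d(4,2)]
      d(9) rho_Ident O by simp
  ultimately show ?thesis
    unfolding Q.direct_sum_iff using mor_rho[OF d(1)] mor_rho[OF d(2)] mor_rho[OF d(3)] mor_rho[OF d(4)]
    by blast
qed

lemma isomorphic_U:
  assumes "isomorphic C X Y" shows "isomorphic U X Y"
proof -
  obtain u v where u: "mor u X Y" "mor v Y X" "v \<cdot> u = idn X" "u \<cdot> v = idn Y"
    using assms unfolding isomorphic_iff by blast
  have "rho v \<cdot>\<^bsub>U\<^esub> rho u = Ident U X" "rho u \<cdot>\<^bsub>U\<^esub> rho v = Ident U Y"
    using rho_Comp[OF u(1,2)] rho_Comp[OF u(2,1)] u rho_Ident by auto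
  then show ?thesis unfolding Q.isomorphic_iff using mor_rho[OF u(1)] mor_rho[OF u(2)] by blast
qed

section \<open>Additive closures in the quotient\<close>

lemma add_closed_U:
  assumes "Q.add_closed D" shows "add_closed D"
  unfolding add_closed_def closed_under_summands_def
proof (intro conjI allI impI)
  note D = Q.add_closedD[OF assms]
  show "D \<subseteq> Obj C" using D(1) by simp
  show "Y \<in> D" if "X \<in> D \<and> isomorphic C X Y" for X Y using D(2)[of X Y] isomorphic_U that by blast
  show "Z \<in> D" if "zero_object C Z" for Z using D(3)[of Z] zero_object_U that by blast
  show "E \<in> D" if "X \<in> D \<and> Y \<in> D \<and> direct_sum C X Y E" for X Y E
    using D(4)[of X Y E] direct_sum_U that by blast
  show "X \<in> D" if "direct_sum C X Y E \<and> E \<in> D" for X Y E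
    using D(5)[of X Y E] direct_sum_U that by blast
qed

lemma add_closure_U: "add_closure C M \<subseteq> add_closure U M"
  unfolding add_closure_eq Q.add_closure_eq using add_closed_U by blast

text \<open>An explicit upper bound for the additive closure in the quotient. Being a retract,
  unlike being a summand, can be stated and composed without a complement.\<close>

definition retracts :: "'a set \<Rightarrow> 'a set" where
  "retracts D = {X. \<exists>Y\<in>D. \<exists>i p. Q.mor i X Y \<and> Q.mor p Y X \<and> p \<cdot>\<^bsub>U\<^esub> i = Ident U X}"

lemma retractsI: "\<lbrakk>Y \<in> D; Q.mor i X Y; Q.mor p Y X; p \<cdot>\<^bsub>U\<^esub> i = Ident U X\<rbrakk> \<Longrightarrow> X \<in> retracts D"
  unfolding retracts_def by blast

lemma retracts_retract:
  assumes "Q.mor i X Y" "Q.mor p Y X" "p \<cdot>\<^bsub>U\<^esub> i = Ident U X" "Y \<in> retracts D"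
  shows "X \<in> retracts D"
proof -
  obtain Z j q where j: "Z \<in> D" "Q.mor j Y Z" "Q.mor q Z Y" "q \<cdot>\<^bsub>U\<^esub> j = Ident U Y"
    using assms(4) unfolding retracts_def by blast
  have "(p \<cdot>\<^bsub>U\<^esub> q) \<cdot>\<^bsub>U\<^esub> (j \<cdot>\<^bsub>U\<^esub> i) = Ident U X"
    using j(2-4) assms(1-3) Q.Comp_reassoc[OF j(4), of i] by simp
  moreover have "Q.mor (j \<cdot>\<^bsub>U\<^esub> i) X Z" "Q.mor (p \<cdot>\<^bsub>U\<^esub> q) Z X"
    using Q.mor_Comp[OF assms(1) j(2)] Q.mor_Comp[OF j(3) assms(2)] by blast+
  ultimately show ?thesis using retractsI[OF j(1)] by blast
qed

text \<open>The sum of the two ambient objects is formed in \<open>C\<close>, where \<open>D\<close>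
  is closed, and carried over by \<open>direct_sum_U\<close>; the retraction is then assembled
  componentwise.\<close>

lemma retracts_sum:
  assumes X: "X \<in> retracts D" and Y: "Y \<in> retracts D" and s: "direct_sum U X Y E"
    and D: "add_closed D"
  shows "E \<in> retracts D"
proof -
  obtain X' a b where a: "X' \<in> D" "Q.mor a X X'" "Q.mor b X' X" "b \<cdot>\<^bsub>U\<^esub> a = Ident U X"
    using X unfolding retracts_def by blast
  obtain Y' c d where c: "Y' \<in> D" "Q.mor c Y Y'" "Q.mor d Y' Y" "d \<cdot>\<^bsub>U\<^esub> c = Ident U Y"
    using Y unfolding retracts_def by blast
  have "X' \<in> Obj C" "Y' \<in> Obj C" using a c add_closedD(1)[OF D] by auto
  then obtain E' where E': "direct_sum C X' Y' E'" using direct_sum_exists by blast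
  then have D': "E' \<in> D" using add_closedD(4)[OF D] a c by blast
  obtain i j p q where e: "Q.mor i X E" "Q.mor j Y E" "Q.mor p E X" "Q.mor q E Y"
     "(i \<cdot>\<^bsub>U\<^esub> p) \<boxplus>\<^bsub>U\<^esub> (j \<cdot>\<^bsub>U\<^esub> q) = Ident U E" using s unfolding Q.direct_sum_iff by blast
  obtain i' j' p' q' where e': "Q.mor i' X' E'" "Q.mor j' Y' E'" "Q.mor p' E' X'" "Q.mor q' E' Y'"
     "p' \<cdot>\<^bsub>U\<^esub> i' = Ident U X'" "q' \<cdot>\<^bsub>U\<^esub> j' = Ident U Y'" "q' \<cdot>\<^bsub>U\<^esub> i' = Zero U X' Y'" "p' \<cdot>\<^bsub>U\<^esub> j' = Zero U Y' X'"
    using direct_sum_U[OF E'] unfolding Q.direct_sum_iff by blast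
  note m = a(2,3) c(2,3) e(1-4) e'(1-4)
  define \<iota> where "\<iota> = (i' \<cdot>\<^bsub>U\<^esub> (a \<cdot>\<^bsub>U\<^esub> p)) \<boxplus>\<^bsub>U\<^esub> (j' \<cdot>\<^bsub>U\<^esub> (c \<cdot>\<^bsub>U\<^esub> q))"
  define \<pi> where "\<pi> = (i \<cdot>\<^bsub>U\<^esub> (b \<cdot>\<^bsub>U\<^esub> p')) \<boxplus>\<^bsub>U\<^esub> (j \<cdot>\<^bsub>U\<^esub> (d \<cdot>\<^bsub>U\<^esub> q'))"
  have im: "Q.mor \<iota> E E'" "Q.mor \<pi> E' E" unfolding \<iota>_def \<pi>_def using m by auto
  have "p' \<cdot>\<^bsub>U\<^esub> \<iota> = a \<cdot>\<^bsub>U\<^esub> p"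
    unfolding \<iota>_def using m Q.Comp_reassoc[OF e'(5), of "a \<cdot>\<^bsub>U\<^esub> p"] Q.Comp_reassoc[OF e'(8), of "c \<cdot>\<^bsub>U\<^esub> q"]
    by simp
  moreover have "q' \<cdot>\<^bsub>U\<^esub> \<iota> = c \<cdot>\<^bsub>U\<^esub> q"
    unfolding \<iota>_def using m Q.Comp_reassoc[OF e'(7), of "a \<cdot>\<^bsub>U\<^esub> p"] Q.Comp_reassoc[OF e'(6), of "c \<cdot>\<^bsub>U\<^esub> q"]
    by simp
  ultimately have "\<pi> \<cdot>\<^bsub>U\<^esub> \<iota> = (i \<cdot>\<^bsub>U\<^esub> (b \<cdot>\<^bsub>U\<^esub> (a \<cdot>\<^bsub>U\<^esub> p))) \<boxplus>\<^bsub>U\<^esub> (j \<cdot>\<^bsub>U\<^esub> (d \<cdot>\<^bsub>U\<^esub> (c \<cdot>\<^bsub>U\<^esub> q)))"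
    unfolding \<pi>_def using m im(1) by simp
  also have "\<dots> = (i \<cdot>\<^bsub>U\<^esub> p) \<boxplus>\<^bsub>U\<^esub> (j \<cdot>\<^bsub>U\<^esub> q)"
    using m Q.Comp_reassoc[OF a(4), of p] Q.Comp_reassoc[OF c(4), of q] by simp
  finally show ?thesis using retractsI[OF D' im] e(5) by simp
qed

lemma add_closed_retracts:
  assumes D: "add_closed D" shows "Q.add_closed (retracts D)"
  unfolding Q.add_closed_def closed_under_summands_def
proof (intro conjI allI impI)
  show "retracts D \<subseteq> Obj U" unfolding retracts_def by auto
  show "Y \<in> retracts D" if h: "X \<in> retracts D \<and> isomorphic U X Y" for X Y
  proof -
    obtain u v where "Q.mor u X Y" "Q.mor v Y X" "u \<cdot>\<^bsub>U\<^esub> v = Ident U Y"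
      using h unfolding Q.isomorphic_iff by blast
    then show ?thesis using retracts_retract[of v Y X u D] h by blast
  qed
  show "Z \<in> retracts D" if z: "zero_object U Z" for Z
  proof -
    obtain K where K: "zero_object C K" using zero_object_exists by blast
    have KD: "K \<in> D" using add_closedD(3)[OF D K] .
    have O: "Z \<in> Obj U" "K \<in> Obj U" "Ident U Z = Zero U Z Z"
      using z zero_object_U[OF K] unfolding Q.zero_object_iff by auto
    then have "Zero U K Z \<cdot>\<^bsub>U\<^esub> Zero U Z K = Ident U Z" by simp
    then show ?thesis using retractsI[OF KD] Q.arr_Zero[OF O(1,2)] Q.arr_Zero[OF O(2,1)] O Q.mor_iff by blast
  qed
  show "E \<in> retracts D" if "X \<in> retracts D \<and> Y \<in> retracts D \<and> direct_sum U X Y E" for X Y E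
    using retracts_sum[OF _ _ _ D] that by blast
  show "X \<in> retracts D" if h: "direct_sum U X Y E \<and> E \<in> retracts D" for X Y E
  proof -
    obtain i p where "Q.mor i X E" "Q.mor p E X" "p \<cdot>\<^bsub>U\<^esub> i = Ident U X"
      using h unfolding Q.direct_sum_iff by blast
    then show ?thesis using retracts_retract h by blast
  qed
qed

lemma add_closure_U_retracts:
  assumes "M \<subseteq> Obj C" shows "add_closure U M \<subseteq> retracts (add_closure C M)"
proof (rule Q.add_closure_least[OF add_closed_retracts[OF add_closed_closure[OF assms]]])
  show "M \<subseteq> retracts (add_closure C M)"
  proof
    fix X assume X: "X \<in> M"
    then have "X \<in> Obj U" using assms by auto
    then have "Q.mor (Ident U X) X X" "Ident U X \<cdot>\<^bsub>U\<^esub> Ident U X = Ident U X" by auto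
    then show "X \<in> retracts (add_closure C M)" using retractsI add_closure_subset X by blast
  qed
qed

section \<open>Shift and triangles of the quotient\<close>

lemma rel_ShM:
  assumes "rel s f s' f'" shows "rel (ShM C s) (ShM C f) (ShM C s') (ShM C f')"
proof -
  obtain X Y Z Z' W a b where r: "roof s f Z X Y" "roof s' f' Z' X Y"
     "mor a W Z" "mor b W Z'" "s \<cdot> a = s' \<cdot> b" "f \<cdot> a = f' \<cdot> b" "den (s \<cdot> a)"
    using assms unfolding rel_def by blast
  note m = roofD[OF r(1)] roofD[OF r(2)] r(3,4)
  have R: "roof (ShM C s) (ShM C f) (ShO C Z) (ShO C X) (ShO C Y)"
    "roof (ShM C s') (ShM C f') (ShO C Z') (ShO C X) (ShO C Y)"
    unfolding roof_def using m mor_ShM den_ShM by blast+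
  have e: "ShM C (s \<cdot> a) = ShM C s \<cdot> ShM C a" "ShM C (s' \<cdot> b) = ShM C s' \<cdot> ShM C b"
    "ShM C (f \<cdot> a) = ShM C f \<cdot> ShM C a" "ShM C (f' \<cdot> b) = ShM C f' \<cdot> ShM C b"
    using m by auto
  show ?thesis
    by (rule relI[OF R mor_ShM[OF r(3)] mor_ShM[OF r(4)]])
      (use e r(5,6) den_ShM[OF r(7)] in \<open>simp_all only:\<close>)
qed

lemma ShM_U_frac:
  assumes "roof s f Z X Y" shows "ShM U (frac s f) = frac (ShM C s) (ShM C f)"
  unfolding U_sel
proof (rule Union_const)
  show "frac (ShM C s) (ShM C f) \<in> {roof_class C S (ShM C s', ShM C f') |s' f'. (s', f') \<in> frac s f}"
    unfolding frac_mem using rel_refl[OF assms] unfolding frac_def by blast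
  fix y assume "y \<in> {roof_class C S (ShM C s', ShM C f') |s' f'. (s', f') \<in> frac s f}"
  then obtain s' f' where "y = frac (ShM C s') (ShM C f')" "rel s f s' f'"
    unfolding frac_mem unfolding frac_def by blast
  then show "y = frac (ShM C s) (ShM C f)" using frac_eqI[OF rel_ShM] by blast
qed

lemma ShM_U_Ident: "X \<in> Obj C \<Longrightarrow> ShM U (Ident U X) = Ident U (ShO C X)"
  unfolding U_sel(3) using ShM_U_frac[OF roof_Ident, of "idn X" X X] by simp

lemma shift_U: "shift U n X = shift C n X"
  unfolding shift_def U_sel by simp

text \<open>The triangles of the quotient are specified before the record carrying them is complete,
  hence over \<open>quotient_shifted\<close>. Extending the record leaves the other fields
  unchanged.\<close>

lemma triangle_isomorphic_U:
  "triangle_isomorphic (quotient_shifted C S) = triangle_isomorphic U"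
  unfolding triangle_isomorphic_def candidate_triangle_def is_iso_def triangle_quotient_def
    shifted.extend_def fun_eq_iff by simp

lemma triangle_U:
  assumes t: "triangle C X Y Z f g h"
  shows "triangle U X Y Z (rho f) (rho g) (rho h)"
proof -
  note m = triD[OF t]
  have O: "X \<in> Obj C" "Y \<in> Obj C" "Z \<in> Obj C" using m by auto
  have c: "candidate_triangle U X Y Z (rho f) (rho g) (rho h)"
    using mor_rho[OF m(1)] mor_rho[OF m(2)] mor_rho[OF m(3)]
    unfolding candidate_triangle_def Q_mor_iff_Hom U_sel(1,5) by blast
  have i: "is_iso U W W (Ident U W)" if "W \<in> Obj C" for W
  proof -
    have W: "W \<in> Obj U" using that by simp
    then have "Q.mor (Ident U W) W W" "Ident U W \<cdot>\<^bsub>U\<^esub> Ident U W = Ident U W" by auto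
    then show ?thesis unfolding Q.is_iso_iff[OF W W] by blast
  qed
  have "triangle_isomorphic U X Y Z (rho f) (rho g) (rho h) X Y Z (rho f) (rho g) (rho h)"
    unfolding triangle_isomorphic_def
    using c i[OF O(1)] i[OF O(2)] i[OF O(3)] m O
    by (intro conjI exI[of _ "Ident U X"] exI[of _ "Ident U Y"] exI[of _ "Ident U Z"])
      (auto simp: ShM_U_Ident)
  then have "triangle_isomorphic U X Y Z (on_Mor (quotient_functor C S) f)
      (on_Mor (quotient_functor C S) g) (on_Mor (quotient_functor C S) h)
      X Y Z (rho f) (rho g) (rho h)"
    unfolding on_Mor_eq[OF m(1)] on_Mor_eq[OF m(2)] on_Mor_eq[OF m(3)] .
  then have "(rho f, rho g, rho h) \<in> quotient_triangles C S"
    unfolding quotient_triangles_def Let_def triangle_isomorphic_U on_Obj_eq using t by blast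
  then show ?thesis unfolding triangle_def U_sel using c by blast
qed

lemma triangle_U_E:
  assumes t: "triangle U X' Y' Z' u v w"
  obtains X Y Z where "dtri X Y Z" "isomorphic U X X'" "isomorphic U Y Y'" "isomorphic U Z Z'"
proof -
  have c: "candidate_triangle U X' Y' Z' u v w" and "(u, v, w) \<in> quotient_triangles C S"
    using t unfolding triangle_def U_sel by blast+
  then obtain X Y Z f g h X'' Y'' Z'' where r: "triangle C X Y Z f g h" and
    i: "triangle_isomorphic U X Y Z (on_Mor (quotient_functor C S) f) (on_Mor (quotient_functor C S) g)
      (on_Mor (quotient_functor C S) h) X'' Y'' Z'' u v w"
    unfolding quotient_triangles_def Let_def triangle_isomorphic_U on_Obj_eq by blast
  have c': "candidate_triangle U X'' Y'' Z'' u v w" using i unfolding triangle_isomorphic_def by blast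
  \<comment> \<open>Membership in \<open>quotient_triangles\<close> records morphisms only;
    disjointness of the Hom sets recovers their objects.\<close>
  have e: "X'' = X'" "Y'' = Y'" "Z'' = Z'"
    using c c' Q.Hom_disjoint unfolding candidate_triangle_def by blast+
  obtain a b d where iso: "is_iso U X X'' a" "is_iso U Y Y'' b" "is_iso U Z Z'' d"
    using i unfolding triangle_isomorphic_def by blast
  have O: "X \<in> Obj U" "Y \<in> Obj U" "Z \<in> Obj U" "X' \<in> Obj U" "Y' \<in> Obj U" "Z' \<in> Obj U"
    using triD[OF r] c unfolding candidate_triangle_def by auto
  show ?thesis
    using that[of X Y Z] r iso O unfolding e isomorphic_def dtri_def by blast
qed

section \<open>Thick subcategories of the quotient\<close>

lemma thick_sub_if_U:
  assumes "triangulated_subcategory U D" "closed_under_summands U D"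
  shows "thick_sub D"
  unfolding thick_sub_def
proof
  show "closed_under_summands C D"
    using assms(2) direct_sum_U unfolding closed_under_summands_def by blast
  show "triangulated_subcategory C D"
    using assms(1) triangle_U unfolding triangulated_subcategory_def shift_U Obj_U by blast
qed

text \<open>Write the composite as one roof. Since it equals the identity, some denominator
  \<open>d\<close> with target \<open>X'\<close> factors through the apex \<open>V\<close> of the
  roof for \<open>\<pi>\<close>. This apex lies in \<open>D\<close>, because the left leg has its
  cone in \<open>S\<close> and target \<open>X\<close>; so \<open>thick_sub_factor\<close>
  applies.\<close>

lemma thick_sub_U_retract:
  assumes D: "thick_sub D" "S \<subseteq> D" and X: "X \<in> D"
    and i: "Q.mor \<iota> X' X" and p: "Q.mor \<pi> X X'" and e: "\<pi> \<cdot>\<^bsub>U\<^esub> \<iota> = Ident U X'"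
  shows "X' \<in> D"
proof -
  obtain s f W where a: "roof s f W X' X" "\<iota> = frac s f" using Q_morE[OF i] .
  obtain t g V where b: "roof t g V X X'" "\<pi> = frac t g" using Q_morE[OF p] .
  obtain R t1 f1 where o: "mor t1 R W" "den t1" "mor f1 R V" "f \<cdot> t1 = t \<cdot> f1"
    "frac t g \<cdot>\<^bsub>U\<^esub> frac s f = frac (s \<cdot> t1) (g \<cdot> f1)" "roof (s \<cdot> t1) (g \<cdot> f1) R X' X'"
    using U_Comp_obtain[OF a(1) b(1)] .
  have X': "X' \<in> Obj C" using roof_Obj[OF a(1)] by blast
  have "frac (s \<cdot> t1) (g \<cdot> f1) = frac (idn X') (idn X')"
    using e o(5) unfolding a(2) b(2) U_sel(3) by simp
  then have "rel (s \<cdot> t1) (g \<cdot> f1) (idn X') (idn X')" unfolding frac_eq_iff[OF o(6)] .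
  then obtain Z' W' c d where r: "roof (idn X') (idn X') Z' X' X'" "mor c W' R" "den c" "mor d W' Z'" "den d"
    "(s \<cdot> t1) \<cdot> c = idn X' \<cdot> d" "(g \<cdot> f1) \<cdot> c = idn X' \<cdot> d" by (rule rel_common_expansion[OF _ o(6)])
  have "Z' = X'" using roofD(1)[OF r(1)] X' by simp
  then have d: "mor d W' X'" using r(4) by simp
  note m = roofD[OF a(1)] roofD[OF b(1)] o(1-3)
  have dg: "g \<cdot> (f1 \<cdot> c) = d" using r(7) m r(2) d by simp
  obtain A x y where A: "triangle C W' X' A d x y" "A \<in> S" using den_cone[OF r(5) d] .
  obtain B z w where B: "triangle C V X B t z w" "B \<in> S" using den_cone[OF m(5,4)] .
  have "V \<in> D" using thick_sub_cocone[OF D(1) _ X] B D(2) unfolding dtri_def by blast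
  moreover have "mor (f1 \<cdot> c) W' V" using m r(2) by simp
  ultimately show ?thesis
    using thick_sub_factor[OF D(1) A(1)[folded dg], of V] A(2) D(2) m(6) by blast
qed

lemma thick_sub_U_isomorphic:
  assumes "thick_sub D" "S \<subseteq> D" "X \<in> D" "isomorphic U X X'"
  shows "X' \<in> D"
  using thick_sub_U_retract[OF assms(1-3)] assms(4) unfolding Q.isomorphic_iff by blast

lemma U_thick_if_thick_sub:
  assumes D: "thick_sub D" "S \<subseteq> D"
  shows "triangulated_subcategory U D" "closed_under_summands U D"
proof -
  show "closed_under_summands U D"
    unfolding closed_under_summands_def Q.direct_sum_iff using thick_sub_U_retract[OF D] by blast
  have "Z \<in> D" if t: "triangle U X Y Z u v w" and XY: "X \<in> D" "Y \<in> D" for X Y Z u v w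
  proof -
    obtain X' Y' Z' where r: "dtri X' Y' Z'" "isomorphic U X' X" "isomorphic U Y' Y" "isomorphic U Z' Z"
      using triangle_U_E[OF t] .
    have "X' \<in> D" "Y' \<in> D"
      using thick_sub_U_isomorphic[OF D] XY Q.isomorphic_sym r(2,3) by blast+
    then have "Z' \<in> D" using thick_sub_cone[OF D(1) r(1)] by blast
    then show ?thesis using thick_sub_U_isomorphic[OF D] r(4) by blast
  qed
  then show "triangulated_subcategory U D"
    using D(1) unfolding thick_sub_def triangulated_subcategory_def shift_U Obj_U by blast
qed

lemma thick_U_eq:
  assumes M: "M \<subseteq> Obj C" and S: "S \<subseteq> thick C M"
  shows "thick U M = thick C M"
proof
  show "thick C M \<subseteq> thick U M"
    unfolding thick_eq thick_def[of U] using thick_sub_if_U by blast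
  have "thick_sub (thick C M)" using thick_sub_thick[OF M] .
  from U_thick_if_thick_sub[OF this S] show "thick U M \<subseteq> thick C M"
    unfolding thick_def[of U] using thick_subset by blast
qed

end

section \<open>Silting reduction\<close>

sublocale presilting_reduction \<subseteq> verdier_quotient C "thick C P"
  by unfold_locales (rule thick_N)

context presilting_reduction
begin

section \<open>The core and its morphisms in the quotient\<close>

definition core :: "'a set" where
  "core = {X. lp 0 X \<and> rp 0 X}"

lemma core_Obj: "core \<subseteq> Obj C"
  unfolding core_def using lp_Obj by blast

lemma P_core: "P \<subseteq> core"
  unfolding core_def using P_lp P_rp by blast

text \<open>Shifted Hom sets will be compared, so isomorphisms are wanted in all degrees. They come
  from shifting the truncation triangles in \<open>C\<close>, whose terms in \<open>N\<close> stay
  there.\<close>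

lemma dense:
  assumes "X \<in> Obj C"
  obtains Y where "Y \<in> core" "\<And>n. isomorphic U (shift C n X) (shift C n Y)"
proof -
  obtain X' A where A: "dtri X' X A" "lp 0 X'" "A \<in> N" using left_part[OF assms] by metis
  obtain Y B where B: "dtri B X' Y" "rp 0 Y" "B \<in> N" "\<And>W. rp 0 W \<Longrightarrow> hom_zero C B W"
    using right_part[OF lp_Obj[OF A(2)]] by metis
  have "Y \<in> core" unfolding core_def using lp_right_part[OF A(2) B(1) B(4)] B(2) by blast
  moreover have "isomorphic U (shift C n X) (shift C n Y)" for n
    using Q.isomorphic_trans[OF Q.isomorphic_sym[OF dtri_isomorphic[OF dtri_shift[OF A(1)]]]
        dtri_isomorphic'[OF dtri_shift[OF B(1)]]] thick_sub_shift[OF thick_N] A(3) B(3) by blast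
  ultimately show ?thesis using that by blast
qed

text \<open>A roof \<open>X \<leftarrow> W \<rightarrow> Y\<close> is first refined so that its cone lies in the part of \<open>N\<close> whose desuspension
  does not see \<open>Y\<close>; then the right leg extends along the left one.\<close>

lemma full:
  assumes X: "lp 0 X" and Y: "rp 0 Y" and \<alpha>: "Q.mor \<alpha> X Y"
  obtains h where "mor h X Y" "\<alpha> = rho h"
proof -
  obtain s f W where r: "roof s f W X Y" "\<alpha> = frac s f" using Q_morE[OF \<alpha>] .
  note m = roofD[OF r(1)]
  have O: "X \<in> Obj C" "Y \<in> Obj C" using m by auto
  obtain A c k where t: "triangle C W X A s c k" "A \<in> N" using den_cone[OF m(2,1)] .
  obtain A2 A1 B Q where F: "dtri A1 A A2" "A1 \<in> N" "\<And>W. lp 0 W \<Longrightarrow> hom_zero C W A2"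
    "dtri B A1 Q" "Q \<in> P" "\<And>W. rp 0 W \<Longrightarrow> hom_zero C B W"
    using N_filtration[OF t(2)] by metis
  obtain i g j where tF: "triangle C A1 A A2 i g j" using F(1) unfolding dtri_def by blast
  note mt = triD[OF t(1)] triD[OF tF]
  have "g \<cdot> c = zr X A2" using hom_zeroD[OF F(3)[OF X], of "g \<cdot> c"] mt by simp
  then obtain v where v: "mor v X A1" "c = i \<cdot> v" using tri_lift[OF tF mt(2)] by blast
  obtain W' p q where tv: "triangle C W' X A1 p v q" using cocone_ex[OF v(1)] .
  note mv = triD[OF tv]
  have p: "mor p W' X" "den p" using mv denI[OF tv F(2)] by auto
  have "c \<cdot> p = zr W' A" using v mt mv tri_comp_zero[OF tv] by simp
  then obtain w where w: "mor w W' W" "p = s \<cdot> w" using tri_lift[OF t(1) p(1)] by blast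
  have dw: "den w" using den_right_factor[of s w] p(2) w m by simp
  have \<alpha>': "\<alpha> = frac p (f \<cdot> w)" using roof_expand(2)[OF r(1) w(1) dw] r(2) w(2) by simp
  have A1: "A1 \<in> Obj C" "Q \<in> Obj C" "B \<in> Obj C" using dtri_Obj[OF F(4)] by auto
  obtain e where te: "triangle C (shift C (- 1) A1) W' X e p v"
    using tri_unrotate[OF tv shift_Obj[OF A1(1)] shift_minus1[OF A1(1)]] by blast
  have me: "mor e (shift C (- 1) A1) W'" using triD[OF te] by blast
  \<comment> \<open>Y[1] receives only zero morphisms from \<open>B\<close>, being in
    \<open>rp 0\<close>, and from \<open>Q\<close>, because 1 > 0; hence also from
    \<open>A1\<close>.\<close>
  have rp1: "rp 0 (shift C 1 Y)" using rp_shift[OF O(2), of 0 1] rp_mono[OF Y, of 1] by simp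
  have Q1: "hom_zero C Q (shift C 1 Y)" using rpD[OF Y _ F(5), of 1] by simp
  have "hom_zero C A1 (shift C 1 Y)"
    using dtri_hom_zero_from[OF F(4) F(6)[OF rp1] Q1] O by simp
  then have "hom_zero C (shift C (- 1) A1) Y"
    using hom_zero_shift_iff[OF A1(1) O(2), of "- 1" 0] by simp
  moreover have fw: "mor (f \<cdot> w) W' Y" using m w(1) by simp
  ultimately have "(f \<cdot> w) \<cdot> e = zr (shift C (- 1) A1) Y"
    using hom_zeroD mor_Comp[OF me fw] by blast
  then obtain h where h: "mor h X Y" "f \<cdot> w = h \<cdot> p" using tri_extend[OF te fw] by blast
  have "\<alpha> = rho h"
    unfolding \<alpha>' h(2) rho_eq[OF h(1)] using roof_expand(2)[OF roof_Ident[OF h(1)] p] p by simp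
  with h(1) that show ?thesis by blast
qed

lemma faithful:
  assumes X: "lp 0 X" and Y: "rp 0 Y" and f: "mor f X Y" and z: "rho f = Zero U X Y"
  obtains Q a b where "Q \<in> P" "mor a X Q" "mor b Q Y" "f = b \<cdot> a"
proof -
  obtain A a b where A: "A \<in> N" "mor a X A" "mor b A Y" "f = b \<cdot> a" using rho_zero_factor[OF f z] .
  show ?thesis using factor_N_P[OF X Y A(1-3)] A(4) that by metis
qed

text \<open>Both conditions are rewritten as vanishing of morphisms out of and into the unshifted
  \<open>X\<close>, the form to which closure under retracts and sums applies directly.\<close>

lemma core_iff:
  "X \<in> core \<longleftrightarrow> X \<in> Obj C \<and>
    (\<forall>l>0. \<forall>Q\<in>P. hom_zero C X (shift C l Q) \<and> hom_zero C (shift C (- l) Q) X)"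
proof -
  have "hom_zero C Q (shift C l X) \<longleftrightarrow> hom_zero C (shift C (- l) Q) X" if "X \<in> Obj C" "Q \<in> P" for l Q
    using hom_zero_shift_iff[OF P_Obj[OF that(2)] that(1), of "- l" 0] by simp
  then show ?thesis unfolding core_def lp_def rp_def by blast
qed

lemma core_retract:
  assumes "mor i X E" "mor p E X" "p \<cdot> i = idn X" "E \<in> core"
  shows "X \<in> core"
  using assms(4) hom_zero_retract_left[OF assms(1-3)] hom_zero_retract_right[OF assms(1-3)]
    assms(1) P_Obj unfolding core_iff by auto

lemma add_closed_core: "add_closed core"
  unfolding add_closed_def closed_under_summands_def
proof (intro conjI allI impI)
  show "core \<subseteq> Obj C" by (rule core_Obj)
  show "Y \<in> core" if "X \<in> core \<and> isomorphic C X Y" for X Y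
    using that core_retract unfolding isomorphic_iff by blast
  show "K \<in> core" if "zero_object C K" for K
    using that P_Obj shift_Obj unfolding core_iff zero_object_def by blast
  show "E \<in> core" if "X \<in> core \<and> Y \<in> core \<and> direct_sum C X Y E" for X Y E
  proof -
    have d: "direct_sum C X Y E" and XY: "X \<in> core" "Y \<in> core" using that by blast+
    have "E \<in> Obj C" using d unfolding direct_sum_def by blast
    then show ?thesis
      using XY hom_zero_sum_left[OF d] hom_zero_sum_right[OF d] P_Obj shift_Obj unfolding core_iff by blast
  qed
  show "X \<in> core" if "direct_sum C X Y E \<and> E \<in> core" for X Y E
    using that core_retract unfolding direct_sum_iff by blast
qed

section \<open>Transfer of presilting and silting subcategories\<close>

lemma presilting_U:
  assumes M: "presilting C M" "M \<subseteq> core"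
  shows "presilting U M"
  unfolding presilting_def
proof (intro conjI ballI allI impI)
  show "M \<subseteq> Obj U" using M(1) unfolding presilting_def by simp
  fix X Y and i :: int assume XY: "X \<in> M" "Y \<in> M" and i: "i > 0"
  have O: "X \<in> Obj C" "Y \<in> Obj C" using XY M core_Obj by blast+
  have X: "lp 0 X" and Y: "rp 0 Y" using XY M(2) unfolding core_def by blast+
  \<comment> \<open>A positive shift may leave the core but stays in \<open>rp 0\<close>, which is
    the condition \<open>full\<close> puts on the target.\<close>
  have Y': "rp 0 (shift C i Y)" using rp_shift[OF O(2), of 0 i] rp_mono[OF Y, of i] i by simp
  have z: "hom_zero C X (shift C i Y)" using M(1) XY i unfolding presilting_def by blast
  show "hom_zero U X (shift U i Y)"
    unfolding shift_U
  proof (rule Q.hom_zeroI)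
    fix \<alpha> assume \<alpha>: "Q.mor \<alpha> X (shift C i Y)"
    obtain h where h: "mor h X (shift C i Y)" "\<alpha> = rho h" using full[OF X Y' \<alpha>] .
    then show "\<alpha> = Zero U X (shift C i Y)" using hom_zeroD[OF z h(1)] rho_Zero O by simp
  qed (use O in auto)
qed

text \<open>A retraction in the quotient between objects of the core lifts to \<open>C\<close> up to a morphism through
  \<open>P\<close>, i.e. to a genuine retraction after adding a summand from \<open>P\<close>.\<close>

lemma add_closure_reflect:
  assumes M: "M \<subseteq> core" and M': "M' \<subseteq> core" and P: "P \<subseteq> add_closure C M'"
    and e: "add_closure U M \<subseteq> add_closure U M'"
  shows "add_closure C M \<subseteq> add_closure C M'"
proof (rule add_closure_least)
  have O: "M \<subseteq> Obj C" "M' \<subseteq> Obj C" using M M' core_Obj by blast+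
  show D: "add_closed (add_closure C M')" using add_closed_closure[OF O(2)] .
  show "M \<subseteq> add_closure C M'"
  proof
    fix X assume X: "X \<in> M"
    have "X \<in> retracts (add_closure C M')"
      using X Q.add_closure_subset e add_closure_U_retracts[OF O(2)] by blast
    then obtain Y \<iota> \<pi> where Y: "Y \<in> add_closure C M'" and
      i: "Q.mor \<iota> X Y" "Q.mor \<pi> Y X" "\<pi> \<cdot>\<^bsub>U\<^esub> \<iota> = Ident U X"
      unfolding retracts_def by blast
    have Xc: "X \<in> core" using X M by blast
    have Yc: "Y \<in> core" using Y add_closure_least[OF add_closed_core M'] by blast
    obtain a where a: "mor a X Y" "\<iota> = rho a" using full[OF _ _ i(1)] Xc Yc unfolding core_def by blast
    obtain b where b: "mor b Y X" "\<pi> = rho b" using full[OF _ _ i(2)] Xc Yc unfolding core_def by blast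
    have XO: "X \<in> Obj C" using a by auto
    \<comment> \<open>\<open>f\<close> measures the failure of the lifted pair to be a retraction;
      it dies in the quotient and therefore factors through some object of \<open>P\<close>.\<close>
    define f where "f = idn X \<boxplus> neg (b \<cdot> a)"
    have n: "mor (neg (b \<cdot> a)) X X" and f: "mor f X X" using a b unfolding f_def by auto
    have "rho (b \<cdot> a) = rho (idn X)" using rho_Comp[OF a(1) b(1)] a(2) b(2) i(3) rho_Ident[OF XO] by simp
    then have "rho f = rho (b \<cdot> a) \<boxplus>\<^bsub>U\<^esub> rho (neg (b \<cdot> a))"
      using rho_Plus[OF _ n, of "idn X"] XO unfolding f_def by simp
    also have "\<dots> = rho ((b \<cdot> a) \<boxplus> neg (b \<cdot> a))"
      using rho_Plus[OF mor_Comp[OF a(1) b(1)] n] by simp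
    also have "\<dots> = Zero U X X" using a b rho_Zero[OF XO XO] by simp
    finally have z: "rho f = Zero U X X" .
    obtain Q c d where Q: "Q \<in> P" "mor c X Q" "mor d Q X" "f = d \<cdot> c"
      using faithful[OF _ _ f z] Xc unfolding core_def by blast
    have id: "idn X = (b \<cdot> a) \<boxplus> (d \<cdot> c)"
    proof -
      have "(b \<cdot> a) \<boxplus> f = idn X \<boxplus> ((b \<cdot> a) \<boxplus> neg (b \<cdot> a))"
        unfolding f_def using a b by (intro Plus_lcomm) auto
      also have "\<dots> = idn X" using a b by simp
      finally show ?thesis using Q(4) by simp
    qed
    have "Q \<in> Obj C" "Y \<in> Obj C" using Q(2) a by auto
    then obtain E where E: "direct_sum C Y Q E" using direct_sum_exists by blast
    have "E \<in> add_closure C M'" using add_closedD(4)[OF D Y _ E] Q(1) P by blast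
    obtain i j p q where s: "mor i Y E" "mor j Q E" "mor p E Y" "mor q E Q"
       "p \<cdot> i = idn Y" "q \<cdot> j = idn Q" "q \<cdot> i = zr Y Q" "p \<cdot> j = zr Q Y"
      using E unfolding direct_sum_iff by blast
    \<comment> \<open>The factorization of \<open>f\<close> through \<open>Q\<close> becomes a
      second component, so that \<open>v \<cdot> u\<close> is the sum of \<open>b \<cdot> a\<close>
      and \<open>d \<cdot> c\<close>, the identity.\<close>
    define u where "u = (i \<cdot> a) \<boxplus> (j \<cdot> c)"
    define v where "v = (b \<cdot> p) \<boxplus> (d \<cdot> q)"
    note m = a(1) b(1) Q(2,3) s(1-4)
    have uv: "mor u X E" "mor v E X" unfolding u_def v_def using m by auto
    have "p \<cdot> u = a" unfolding u_def using m Comp_reassoc[OF s(5), of a] Comp_reassoc[OF s(8), of c] by simp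
    moreover have "q \<cdot> u = c" unfolding u_def using m Comp_reassoc[OF s(7), of a] Comp_reassoc[OF s(6), of c] by simp
    ultimately have "v \<cdot> u = idn X" unfolding v_def using m uv(1) id by simp
    then obtain E' where "direct_sum C X E' E" using retract_direct_sum[OF uv] by blast
    then show "X \<in> add_closure C M'" using add_closedD(5)[OF D] \<open>E \<in> add_closure C M'\<close> by blast
  qed
qed

lemma add_closure_U_mono:
  assumes M: "M \<subseteq> Obj C" "M' \<subseteq> Obj C" and e: "add_closure C M \<subseteq> add_closure C M'"
  shows "add_closure U M \<subseteq> add_closure U M'"
proof (rule Q.add_closure_least)
  show "Q.add_closed (add_closure U M')" using Q.add_closed_closure M(2) by simp
  show "M \<subseteq> add_closure U M'"
    using add_closure_subset[of M] e add_closure_U[of M'] by blast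
qed

text \<open>The objects of \<open>M\<close> are replaced by all core objects isomorphic to one of
  them in the quotient in every degree, and \<open>P\<close> is adjoined, which adds only zero
  objects there.\<close>

lemma presilting_lift:
  assumes M: "presilting U M"
  obtains M' where "presilting C M'" "P \<subseteq> M'" "add_closure U M' = add_closure U M"
    "\<forall>X\<in>M. \<exists>Y\<in>M'. isomorphic U X Y"
proof
  have O: "M \<subseteq> Obj C" using M unfolding presilting_def by simp
  define K where "K = {Y \<in> core. \<exists>X\<in>M. \<forall>n. isomorphic U (shift C n X) (shift C n Y)}"
  have KO: "K \<subseteq> Obj C" unfolding K_def using core_Obj by blast
  have iso0: "isomorphic U X Y" if "\<forall>n. isomorphic U (shift C n X) (shift C n Y)" for X Y
    using spec[OF that, of 0] by simp
  show "P \<subseteq> P \<union> K" by blast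
  show ex: "\<forall>X\<in>M. \<exists>Y\<in>P \<union> K. isomorphic U X Y"
  proof
    fix X assume X: "X \<in> M"
    then have "X \<in> Obj C" using O by blast
    then obtain Y where Y: "Y \<in> core" "\<And>n. isomorphic U (shift C n X) (shift C n Y)" using dense by blast
    then have "Y \<in> K" unfolding K_def using X by blast
    then show "\<exists>Y\<in>P \<union> K. isomorphic U X Y" using Y(2) iso0 by blast
  qed
  show "presilting C (P \<union> K)"
    unfolding presilting_def
  proof (intro conjI ballI allI impI)
    show "P \<union> K \<subseteq> Obj C" using P_Obj KO by blast
    fix Y Y' and i :: int assume Y: "Y \<in> P \<union> K" and Y': "Y' \<in> P \<union> K" and i: "i > 0"
    have c: "lp 0 Y" "rp 0 Y'" using Y Y' P_core unfolding K_def core_def by blast+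
    have YO: "Y \<in> Obj C" "Y' \<in> Obj C" using c lp_Obj rp_Obj by blast+
    show "hom_zero C Y (shift C i Y')"
    proof (cases "Y \<in> P \<or> Y' \<in> P")
      case True
      then show ?thesis using lpD[OF c(1) i] rpD[OF c(2) i] by blast
    next
      case False
      obtain X where X: "X \<in> M" "\<forall>n. isomorphic U (shift C n X) (shift C n Y)"
        using False Y unfolding K_def by blast
      obtain X' where X': "X' \<in> M" "\<forall>n. isomorphic U (shift C n X') (shift C n Y')"
        using False Y' unfolding K_def by blast
      have "hom_zero U X (shift C i X')" using M X X' i unfolding presilting_def shift_U by blast
      then have z: "hom_zero U Y (shift C i Y')"
        using Q.hom_zero_isomorphic[OF iso0[OF X(2)] spec[OF X'(2), of i]] by blast
      show ?thesis
      proof (rule hom_zeroI)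
        fix f assume f: "mor f Y (shift C i Y')"
        have r: "rp 0 (shift C i Y')" using rp_shift[OF YO(2), of 0 i] rp_mono[OF c(2), of i] i by simp
        have "rho f = Zero U Y (shift C i Y')" using Q.hom_zeroD[OF z mor_rho[OF f]] .
        then obtain Q a b where Q: "Q \<in> P" "mor a Y Q" "mor b Q (shift C i Y')" "f = b \<cdot> a"
          using faithful[OF c(1) r f] by blast
        \<comment> \<open>In a positive degree the kernel disappears: the second factor goes from
          \<open>P\<close> to Y'[i], and \<open>Y'\<close> lies in \<open>rp 0\<close>.\<close>
        have "b = zr Q (shift C i Y')" using hom_zeroD[OF rpD[OF c(2) i Q(1)] Q(3)] .
        then show "f = zr Y (shift C i Y')" using Q(2,4) YO by simp
      qed (use YO in auto)
    qed
  qed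
  show "add_closure U (P \<union> K) = add_closure U M"
  proof
    have cl: "Q.add_closed (add_closure U M)" "Q.add_closed (add_closure U (P \<union> K))"
      using Q.add_closed_closure O KO P_Obj by (auto simp: subset_iff)
    have "Y \<in> add_closure U M" if Y: "Y \<in> K" for Y
    proof -
      obtain X where X: "X \<in> M" "\<forall>n. isomorphic U (shift C n X) (shift C n Y)"
        using Y unfolding K_def by blast
      then show ?thesis using Q.add_closedD(2)[OF cl(1) _ iso0] Q.add_closure_subset by blast
    qed
    moreover have "Y \<in> add_closure U M" if "Y \<in> P" for Y
      using Q.add_closedD(3)[OF cl(1)] zero_object_U_S[OF P_N[OF that]] by blast
    ultimately show "add_closure U (P \<union> K) \<subseteq> add_closure U M"
      using Q.add_closure_least[OF cl(1)] by blast
    show "add_closure U M \<subseteq> add_closure U (P \<union> K)"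
    proof (rule Q.add_closure_least[OF cl(2)])
      show "M \<subseteq> add_closure U (P \<union> K)"
      proof
        fix X assume "X \<in> M"
        then obtain Y where Y: "Y \<in> P \<union> K" "isomorphic U X Y" using ex by blast
        then show "X \<in> add_closure U (P \<union> K)"
          using Q.add_closedD(2)[OF cl(2) _ Q.isomorphic_sym[OF Y(2)]] Q.add_closure_subset by blast
      qed
    qed
  qed
qed

lemma silting_U:
  assumes M: "silting C M" "M \<subseteq> core" shows "silting U M"
proof -
  have MO: "M \<subseteq> Obj C" using M(2) core_Obj by blast
  have t: "thick C M = Obj C" using M(1) unfolding silting_def by blast
  have "N \<subseteq> thick C M" unfolding t using thick_sub_Obj[OF thick_N] by blast
  then have "thick U M = Obj U" using thick_U_eq[OF MO] t by simp
  then show ?thesis using presilting_U M unfolding silting_def by blast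
qed

text \<open>Generation is tested in the quotient: the thick closure of \<open>M'\<close> contains
  \<open>N\<close>, so it is thick there as well; closed under isomorphism in the quotient, it
  contains \<open>M\<close>, which generates everything.\<close>

lemma silting_lift:
  assumes M: "silting U M"
  obtains M' where "silting C M'" "P \<subseteq> M'" "add_closure U M' = add_closure U M"
proof -
  obtain M' where M': "presilting C M'" "P \<subseteq> M'" "add_closure U M' = add_closure U M"
    "\<forall>X\<in>M. \<exists>Y\<in>M'. isomorphic U X Y" using presilting_lift M unfolding silting_def by metis
  have O: "M' \<subseteq> Obj C" using M'(1) unfolding presilting_def by blast
  have t: "thick_sub (thick C M')" using thick_sub_thick[OF O] .
  have N: "N \<subseteq> thick C M'" using thick_least[OF t] M'(2) thick_subset by blast
  have "M \<subseteq> thick C M'"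
    using M'(4) thick_sub_U_isomorphic[OF t N _ Q.isomorphic_sym] thick_subset by blast
  then have "thick U M \<subseteq> thick C M'"
    using U_thick_if_thick_sub[OF t N] unfolding thick_def[of U] by blast
  then have "thick C M' = Obj C"
    using M thick_sub_Obj[OF t] unfolding silting_def by auto
  with M' that show ?thesis unfolding silting_def by blast
qed

text \<open>A representative \<open>M\<close> of the class need not contain \<open>P\<close> itself.
  It lies in the core because the core is additively closed and contains \<open>M0\<close>.\<close>

lemma containing_core:
  assumes "P \<subseteq> M0" "presilting C M0" "add_closure C M = add_closure C M0"
  shows "M \<subseteq> core" "P \<subseteq> add_closure C M"
proof -
  have "M0 \<subseteq> core"
    unfolding core_def lp_def rp_def using assms(1,2) unfolding presilting_def by blast
  then show "M \<subseteq> core"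
    using add_closure_least[OF add_closed_core] add_closure_subset assms(3) by blast
  show "P \<subseteq> add_closure C M" unfolding assms(3) using assms(1) add_closure_subset by blast
qed

section \<open>The induced bijections\<close>

lemma quotient_add_equiv:
  "c \<in> A // add_equiv D A \<longleftrightarrow> (\<exists>M\<in>A. c = {M' \<in> A. add_closure D M = add_closure D M'})"
  unfolding quotient_def add_equiv_def by auto

text \<open>Silting and presilting subcategories are treated together: \<open>pC\<close> and
  \<open>pU\<close> stand for the respective conditions in \<open>C\<close> and in the
  quotient.\<close>

lemma induces_bijection_general:
  assumes C: "\<And>M. pC M \<Longrightarrow> presilting C M"
    and down: "\<And>M. \<lbrakk>pC M; M \<subseteq> core\<rbrakk> \<Longrightarrow> pU M"
    and lift: "\<And>M. pU M \<Longrightarrow> \<exists>M'. pC M' \<and> P \<subseteq> M' \<and> add_closure U M' = add_closure U M"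
  shows "induces_bijection (quotient_functor C N)
    {c \<in> Collect pC // add_equiv C (Collect pC). \<exists>M\<in>c. P \<subseteq> M}
    (Collect pU // add_equiv U (Collect pU))"
proof -
  let ?A = "{c \<in> Collect pC // add_equiv C (Collect pC). \<exists>M\<in>c. P \<subseteq> M}"
  let ?B = "Collect pU // add_equiv U (Collect pU)"
  \<comment> \<open>All representatives are collected at once, so that the image of each of them
    belongs to \<open>F c\<close>; that \<open>F c\<close> is a single class is shown
    afterwards.\<close>
  define F where "F c = {M'. pU M' \<and> (\<exists>M\<in>c. add_closure U M = add_closure U M')}" for c
  have MO: "M \<subseteq> Obj C" if "pC M" for M using C[OF that] unfolding presilting_def by blast
  have rep: "\<exists>M. pC M \<and> P \<subseteq> M \<and> c = {M'. pC M' \<and> add_closure C M = add_closure C M'}" if c: "c \<in> ?A" for c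
  proof -
    obtain M M0 where "pC M" "c = {M'. pC M' \<and> add_closure C M = add_closure C M'}" "M0 \<in> c" "P \<subseteq> M0"
      using c unfolding quotient_add_equiv by auto
    then show ?thesis by (intro exI[of _ M0]) auto
  qed
  \<comment> \<open>The hypotheses are asymmetric: \<open>M\<close> contains \<open>P\<close>,
    whereas \<open>M'\<close> may be any representative, for which \<open>P\<close> is known to lie
    in the additive closure.\<close>
  have U_eq: "add_closure U M = add_closure U M' \<longleftrightarrow> add_closure C M = add_closure C M'"
    if "pC M" "P \<subseteq> M" "pC M'" "M' \<subseteq> core" "P \<subseteq> add_closure C M'" for M M'
  proof
    assume "add_closure C M = add_closure C M'"
    then show "add_closure U M = add_closure U M'"
      using add_closure_U_mono[of M M'] add_closure_U_mono[of M' M] MO[OF that(1)] MO[OF that(3)] by blast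
  next
    assume e: "add_closure U M = add_closure U M'"
    have "M \<subseteq> core" "P \<subseteq> add_closure C M"
      using containing_core[OF that(2) C[OF that(1)], of M] by blast+
    then show "add_closure C M = add_closure C M'"
      using add_closure_reflect[of M M'] add_closure_reflect[of M' M] that(4,5) e by blast
  qed
  have F: "F c = {M'. pU M' \<and> add_closure U M = add_closure U M'}"
    if M: "pC M" "P \<subseteq> M" and c: "c = {M'. pC M' \<and> add_closure C M = add_closure C M'}" for c M
  proof -
    have e: "add_closure U M = add_closure U M1" if "M1 \<in> c" for M1
    proof -
      have M1: "pC M1" "add_closure C M = add_closure C M1" using that unfolding c by blast+
      show ?thesis
        using U_eq[OF M M1(1) containing_core[OF M(2) C[OF M(1)] M1(2)[symmetric]]] M1(2) by blast
    qed
    have "M \<in> c" using M c by blast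
    then have "(\<exists>M1\<in>c. add_closure U M1 = add_closure U M') \<longleftrightarrow> add_closure U M = add_closure U M'" for M'
      using e by metis
    then show ?thesis unfolding F_def by (simp only:)
  qed
  have pU: "pU M" if "pC M" "P \<subseteq> M" for M
    using down that containing_core[OF that(2) C[OF that(1)], of M] by blast
  have "bij_betw F ?A ?B"
    unfolding bij_betw_def
  proof
    show "inj_on F ?A"
    proof (rule inj_onI)
      fix c c' assume c: "c \<in> ?A" and c': "c' \<in> ?A" and e: "F c = F c'"
      obtain M where M: "pC M" "P \<subseteq> M" "c = {M'. pC M' \<and> add_closure C M = add_closure C M'}"
        using rep[OF c] by blast
      obtain M1 where M1: "pC M1" "P \<subseteq> M1" "c' = {M'. pC M' \<and> add_closure C M1 = add_closure C M'}"
        using rep[OF c'] by blast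
      have "M \<in> F c" unfolding F[OF M] using pU M by blast
      then have "add_closure U M1 = add_closure U M" unfolding e F[OF M1] by blast
      then have "add_closure C M1 = add_closure C M"
        using U_eq[OF M1(1,2) M(1)] containing_core[OF M(2) C[OF M(1)], of M] by blast
      then show "c = c'" using M(3) M1(3) by simp
    qed
    show "F ` ?A = ?B"
    proof (intro equalityI subsetI)
      fix d assume "d \<in> F ` ?A"
      then obtain c where c: "c \<in> ?A" "d = F c" by blast
      obtain M where M: "pC M" "P \<subseteq> M" "c = {M'. pC M' \<and> add_closure C M = add_closure C M'}"
        using rep[OF c(1)] by blast
      show "d \<in> ?B" unfolding quotient_add_equiv c(2) F[OF M] using pU[OF M(1,2)] by auto
    next
      fix d assume "d \<in> ?B"
      then obtain L where L: "pU L" "d = {M'. pU M' \<and> add_closure U L = add_closure U M'}"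
        unfolding quotient_add_equiv by auto
      obtain M where M: "pC M" "P \<subseteq> M" "add_closure U M = add_closure U L" using lift[OF L(1)] by blast
      define c where "c = {M'. pC M' \<and> add_closure C M = add_closure C M'}"
      have "c \<in> ?A" unfolding quotient_add_equiv c_def using M(1,2) by auto
      moreover have "d = F c" unfolding F[OF M(1,2) c_def] L(2) M(3) ..
      ultimately show "d \<in> F ` ?A" by blast
    qed
  qed
  moreover have "on_Obj (quotient_functor C N) ` M \<in> F c" if c: "c \<in> ?A" and M: "M \<in> c" for c M
  proof -
    obtain M0 where M0: "pC M0" "P \<subseteq> M0" "c = {M'. pC M' \<and> add_closure C M0 = add_closure C M'}"
      using rep[OF c] by blast
    have "pC M" "M \<subseteq> core" using M M0(3) containing_core[OF M0(2) C[OF M0(1)], of M] by auto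
    then have "M \<in> F c" unfolding F_def using down M by blast
    then show ?thesis by (simp add: on_Obj_eq)
  qed
  ultimately show ?thesis unfolding induces_bijection_def by blast
qed

end

theorem theorem3p7:
  fixes T :: "('o, 'm) triangulated"
    and P :: "'o set"
    and U :: "('o, ('m \<times> 'm) set) triangulated"
    and \<rho> :: "('o, 'm, 'o, ('m \<times> 'm) set) functor_data"
  assumes "triangulated_category T"
    and "presilting T P"
    and "P = add_closure T P"
    and "condP1 T P"
    and "condP2 T P"
    and "U = triangle_quotient T (thick T P)"
    and "\<rho> = quotient_functor T (thick T P)"
  shows "induces_bijection \<rho> (silt_containing T P) (silt U) \<and>
    induces_bijection \<rho> (presilt_containing T P) (presilt U)"
proof -
  interpret presilting_reduction T P
    using assms(1-5) by (intro presilting_reduction.intro presilting_reduction_axioms.intro)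
  show ?thesis
    unfolding silt_containing_def silt_def presilt_containing_def presilt_def assms(6,7)
  proof (intro conjI induces_bijection_general)
    show "\<exists>M'. silting T M' \<and> P \<subseteq> M' \<and>
        add_closure (triangle_quotient T (thick T P)) M' = add_closure (triangle_quotient T (thick T P)) M"
      if "silting (triangle_quotient T (thick T P)) M" for M
      using silting_lift[OF that] by metis
    show "\<exists>M'. presilting T M' \<and> P \<subseteq> M' \<and>
        add_closure (triangle_quotient T (thick T P)) M' = add_closure (triangle_quotient T (thick T P)) M"
      if "presilting (triangle_quotient T (thick T P)) M" for M
      using presilting_lift[OF that] by metis
  qed (use silting_U presilting_U in \<open>auto simp: silting_def\<close>)
qed

end
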